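(* Let $G$ be a (possibly infinite) graph and let $\Psi \subseteq \Omega(G)$ be a set of ends of $G$. Then the following statements are equivalent: (i) $G$ admits a linked, tight and componental rooted tree-decomposition of finite adhesion displaying $\Psi$. (ii) $G$ admits a (rooted) tree-decomposition of finite adhesion displaying $\Psi$. (iii) $\Psi$ is a $G_\delta$-set in $|G|$.
   Context: **Ends and topology.** Graphs may be infinite. A ray is a one-way infinite path. An end of $G$ is an equivalence class of rays of $G$, where two rays are equivalent if no finite vertex set separates them. $\Omega(G)$ is the set of ends. For an end $\varepsilon$ and a finite $S\subseteq V(G)$, $C(S,\varepsilon)$ is the unique component of $G-S$ containing rays of $\varepsilon$, and $\Omega(S,\varepsilon)=\{\psi\in\Omega(G): C(S,\psi)=C(S,\varepsilon)\}$. The space $|G|=V(G)\cup\Omega(G)$ (edges are not included) carries the topology with basis all singletons $\{v\}$, $v\in V(G)$, and all sets $V(C(S,\varepsilon))\cup\Omega(S,\varepsilon)$ with $\varepsilon\in\Omega(G)$ and $S\subseteq V(G)$ finite. A $G_\delta$-set is a countable intersection of open sets. **Tree-decompositions.** A (rooted) tree-decomposition of $G$ is a pair $(T,\mathcal V)$ with $T$ a (rooted) tree and $\mathcal V=(V_t)_{t\in T}$ a family of subsets of $V(G)$ (bags) such that $G=\bigcup_{t\in T}G[V_t]$ and for each $v\in V(G)$ the set $\{t: v\in V_t\}$ induces a connected subgraph of $T$. The adhesion set of an edge $e=xy$ of $T$ is $V_e=V_x\cap V_y$; $(T,\mathcal V)$ has finite adhesion if all $V_e$ are finite. For $e=xy\in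 E(T)$ let $U^e_x$ and $U^e_y$ be the unions of the bags $V_t$ over all $t$ in the component of $T-e$ containing $x$ and $y$, respectively. If $T$ is rooted with root $r$, then for nodes or edges $x,y$ of $T$ write $xTy$ for the minimal path of $T$ containing $x$ and $y$, and put $x\le_T y$ if $x\in rTy$. For an edge $e=xy$ with $x<_Ty$, the part strictly above $e$ is $G\mathring{\uparrow} e=G[U^e_y\setminus V_e]$. A rooted tree-decomposition is: - tight if for every edge $e$ of $T$ there is a component $C$ of $G\mathring{\uparrow} e$ with $N_G(C)=V_e$; - componental if for every edge $e$ of $T$ the graph $G\mathring{\uparrow} e$ is connected; - linked if for all edges $e<_Tf$ of $T$ there are $\min\{|V_g|: g\in E(eTf)\}$ pairwise disjoint $V_e$–$V_f$ paths in $G$. **Displaying ends.** Let $(T,\mathcal V)$ have finite adhesion and let $\varepsilon\in\Omega(G)$. Orient each edge $e=xy$ of $T$ towards $y$ if $C(V_e,\varepsilon)\subseteq G[U^e_y]$ and towards $x$ otherwise. Then either all edges point towards a unique node of $T$, or they point towards a unique end of $T$; let $f(\varepsilon)\in V(T)\cup\Omega(T)$ be this node or end. The boundary of $(T,\mathcal V)$ is $f^{-1}[\Omega(T)]$. $(T,\mathcal V)$ displays $\Psi$ if $\Psi$ is the boundary of $(T,\mathcal V)$ and $f$ restricts to a bijection $\Psi\to\Omega(T)$. (This does not depend on a choice of root.) *)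

theory Defs
  imports "HOL-Analysis.Analysis"
begin

section \<open>Simple graphs, possibly infinite\<close>

record 'v graph =
  verts :: "'v set"
  edges :: "'v set set"

definition simple_graph :: "'v graph \<Rightarrow> bool" where
  "simple_graph G \<longleftrightarrow>
     (\<forall>e\<in>edges G. \<exists>u v. u \<in> verts G \<and> v \<in> verts G \<and> u \<noteq> v \<and> e = {u, v})"

definition induced_subgraph :: "'v graph \<Rightarrow> 'v set \<Rightarrow> 'v graph" where
  "induced_subgraph G W = \<lparr>verts = verts G \<inter> W, edges = {e \<in> edges G. e \<subseteq> W}\<rparr>"

definition delete_verts :: "'v graph \<Rightarrow> 'v set \<Rightarrow> 'v graph" where
  "delete_verts G S = induced_subgraph G (verts G - S)"

definition delete_edge :: "'v graph \<Rightarrow> 'v set \<Rightarrow> 'v graph" where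
  "delete_edge G e = \<lparr>verts = verts G, edges = edges G - {e}\<rparr>"

definition graph_path :: "'v graph \<Rightarrow> 'v list \<Rightarrow> bool" where
  "graph_path G p \<longleftrightarrow> p \<noteq> [] \<and> distinct p \<and> set p \<subseteq> verts G \<and>
     successively (\<lambda>u v. {u, v} \<in> edges G) p"

definition path_edges :: "'v list \<Rightarrow> 'v set set" where
  "path_edges p = {{p ! i, p ! Suc i} | i. Suc i < length p}"

definition joined :: "'v graph \<Rightarrow> 'v \<Rightarrow> 'v \<Rightarrow> bool" where
  "joined G u v \<longleftrightarrow> (\<exists>p. graph_path G p \<and> hd p = u \<and> last p = v)"

(* The empty graph is not connected. *)
definition connected_graph :: "'v graph \<Rightarrow> bool" where
  "connected_graph G \<longleftrightarrow> verts G \<noteq> {} \<and> (\<forall>u\<in>verts G. \<forall>v\<in>verts G. joined G u v)"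

(* Components are induced subgraphs and are represented by their vertex sets. *)
definition component_of :: "'v graph \<Rightarrow> 'v \<Rightarrow> 'v set" where
  "component_of G v = {u. joined G v u}"

definition graph_components :: "'v graph \<Rightarrow> 'v set set" where
  "graph_components G = component_of G ` verts G"

definition neighbourhood :: "'v graph \<Rightarrow> 'v set \<Rightarrow> 'v set" where
  "neighbourhood G C = {v \<in> verts G - C. \<exists>u\<in>C. {u, v} \<in> edges G}"

(* An A-B path meets A exactly in its first and B exactly in its last vertex;
   it is a single vertex if it starts in the intersection of A and B. *)
definition AB_path :: "'v graph \<Rightarrow> 'v set \<Rightarrow> 'v set \<Rightarrow> 'v list \<Rightarrow> bool" where
  "AB_path G A B p \<longleftrightarrow> graph_path G p \<and> set p \<inter> A = {hd p} \<and> set p \<inter> B = {last p}"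

definition separates :: "'v graph \<Rightarrow> 'v set \<Rightarrow> 'v set \<Rightarrow> 'v set \<Rightarrow> bool" where
  "separates G S A B \<longleftrightarrow> (\<forall>p. AB_path G A B p \<longrightarrow> set p \<inter> S \<noteq> {})"


section \<open>Ends and the space of vertices and ends\<close>

definition ray :: "'v graph \<Rightarrow> (nat \<Rightarrow> 'v) \<Rightarrow> bool" where
  "ray G R \<longleftrightarrow> inj R \<and> range R \<subseteq> verts G \<and> (\<forall>n. {R n, R (Suc n)} \<in> edges G)"

definition ray_rel :: "'v graph \<Rightarrow> ((nat \<Rightarrow> 'v) \<times> (nat \<Rightarrow> 'v)) set" where
  "ray_rel G = {(R, R'). ray G R \<and> ray G R' \<and>
     \<not> (\<exists>S. finite S \<and> S \<subseteq> verts G \<and> separates G S (range R) (range R'))}"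

definition graph_ends :: "'v graph \<Rightarrow> (nat \<Rightarrow> 'v) set set" where
  "graph_ends G = {R. ray G R} // ray_rel G"

(* C(S,\<epsilon>) *)
definition end_component :: "'v graph \<Rightarrow> 'v set \<Rightarrow> (nat \<Rightarrow> 'v) set \<Rightarrow> 'v set" where
  "end_component G S \<epsilon> =
     (THE C. C \<in> graph_components (delete_verts G S) \<and> (\<exists>R\<in>\<epsilon>. range R \<subseteq> C))"

(* \<Omega>(S,\<epsilon>) *)
definition ends_in_component :: "'v graph \<Rightarrow> 'v set \<Rightarrow> (nat \<Rightarrow> 'v) set \<Rightarrow> (nat \<Rightarrow> 'v) set set" where
  "ends_in_component G S \<epsilon> = {\<psi> \<in> graph_ends G. end_component G S \<psi> = end_component G S \<epsilon>}"

definition end_space :: "'v graph \<Rightarrow> ('v + (nat \<Rightarrow> 'v) set) topology" where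
  "end_space G = topology_generated_by
     ({{Inl v} | v. v \<in> verts G} \<union>
      {Inl ` end_component G S \<epsilon> \<union> Inr ` ends_in_component G S \<epsilon> | S \<epsilon>.
         finite S \<and> S \<subseteq> verts G \<and> \<epsilon> \<in> graph_ends G})"


section \<open>Tree-decompositions\<close>

definition tree :: "'n graph \<Rightarrow> bool" where
  "tree T \<longleftrightarrow> simple_graph T \<and> connected_graph T \<and>
     \<not> (\<exists>p. graph_path T p \<and> length p \<ge> 3 \<and> {last p, hd p} \<in> edges T)"

definition tree_decomposition :: "'v graph \<Rightarrow> 'n graph \<Rightarrow> ('n \<Rightarrow> 'v set) \<Rightarrow> bool" where
  "tree_decomposition G T B \<longleftrightarrow>
     tree T \<and>
     (\<forall>t\<in>verts T. B t \<subseteq> verts G) \<and>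
     verts G = (\<Union>t\<in>verts T. verts (induced_subgraph G (B t))) \<and>
     edges G = (\<Union>t\<in>verts T. edges (induced_subgraph G (B t))) \<and>
     (\<forall>v\<in>verts G. connected_graph (induced_subgraph T {t \<in> verts T. v \<in> B t}))"

(* For e = {x, y} this is the intersection of B x and B y. *)
definition adhesion_set :: "('n \<Rightarrow> 'v set) \<Rightarrow> 'n set \<Rightarrow> 'v set" where
  "adhesion_set B e = (\<Inter>t\<in>e. B t)"

definition finite_adhesion :: "'n graph \<Rightarrow> ('n \<Rightarrow> 'v set) \<Rightarrow> bool" where
  "finite_adhesion T B \<longleftrightarrow> (\<forall>e\<in>edges T. finite (adhesion_set B e))"

(* The nodes of the component of T - xy containing y. *)
definition edge_side :: "'n graph \<Rightarrow> 'n \<Rightarrow> 'n \<Rightarrow> 'n set" where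
  "edge_side T x y = component_of (delete_edge T {x, y}) y"

(* U^e_y for e = xy *)
definition side_part :: "'n graph \<Rightarrow> ('n \<Rightarrow> 'v set) \<Rightarrow> 'n \<Rightarrow> 'n \<Rightarrow> 'v set" where
  "side_part T B x y = (\<Union>t\<in>edge_side T x y. B t)"

(* In the following, X and Y are nodes or edges of a tree T: a node t is given as {t}, an edge
   as the set of its ends. Since a path in a tree has no chords, it contains X as a node or an
   edge iff X is a subset of its vertex set. Then "minimal_path T X Y p" says that p traverses
   the path XTY (in either direction). *)
definition minimal_path :: "'n graph \<Rightarrow> 'n set \<Rightarrow> 'n set \<Rightarrow> 'n list \<Rightarrow> bool" where
  "minimal_path T X Y p \<longleftrightarrow> graph_path T p \<and> X \<union> Y \<subseteq> set p \<and>
     \<not> (\<exists>q. graph_path T q \<and> X \<union> Y \<subseteq> set q \<and> set q \<subset> set p)"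

definition tree_le :: "'n graph \<Rightarrow> 'n \<Rightarrow> 'n set \<Rightarrow> 'n set \<Rightarrow> bool" where
  "tree_le T r X Y \<longleftrightarrow> (\<exists>p. minimal_path T {r} Y p \<and> X \<subseteq> set p)"

definition tree_less :: "'n graph \<Rightarrow> 'n \<Rightarrow> 'n set \<Rightarrow> 'n set \<Rightarrow> bool" where
  "tree_less T r X Y \<longleftrightarrow> tree_le T r X Y \<and> X \<noteq> Y"

(* The part strictly above the edge xy, where x is the lower node. *)
definition part_above :: "'v graph \<Rightarrow> 'n graph \<Rightarrow> ('n \<Rightarrow> 'v set) \<Rightarrow> 'n \<Rightarrow> 'n \<Rightarrow> 'v graph" where
  "part_above G T B x y = induced_subgraph G (side_part T B x y - adhesion_set B {x, y})"

definition tight :: "'v graph \<Rightarrow> 'n graph \<Rightarrow> 'n \<Rightarrow> ('n \<Rightarrow> 'v set) \<Rightarrow> bool" where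
  "tight G T r B \<longleftrightarrow> (\<forall>x y. {x, y} \<in> edges T \<and> tree_less T r {x} {y} \<longrightarrow>
     (\<exists>C\<in>graph_components (part_above G T B x y). neighbourhood G C = adhesion_set B {x, y}))"

definition componental :: "'v graph \<Rightarrow> 'n graph \<Rightarrow> 'n \<Rightarrow> ('n \<Rightarrow> 'v set) \<Rightarrow> bool" where
  "componental G T r B \<longleftrightarrow> (\<forall>x y. {x, y} \<in> edges T \<and> tree_less T r {x} {y} \<longrightarrow>
     connected_graph (part_above G T B x y))"

definition linked :: "'v graph \<Rightarrow> 'n graph \<Rightarrow> 'n \<Rightarrow> ('n \<Rightarrow> 'v set) \<Rightarrow> bool" where
  "linked G T r B \<longleftrightarrow>
     (\<forall>e\<in>edges T. \<forall>f\<in>edges T. \<forall>p. tree_less T r e f \<and> minimal_path T e f p \<longrightarrow>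
       (\<exists>\<P>. finite \<P> \<and>
            card \<P> = Min ((\<lambda>g. card (adhesion_set B g)) ` path_edges p) \<and>
            (\<forall>P\<in>\<P>. AB_path G (adhesion_set B e) (adhesion_set B f) P) \<and>
            (\<forall>P\<in>\<P>. \<forall>Q\<in>\<P>. P \<noteq> Q \<longrightarrow> set P \<inter> set Q = {})))"


section \<open>Displaying sets of ends\<close>

(* The end \<epsilon> of G orients the edge xy of T towards y; otherwise it orients it towards x. *)
definition oriented_to ::
  "'v graph \<Rightarrow> 'n graph \<Rightarrow> ('n \<Rightarrow> 'v set) \<Rightarrow> (nat \<Rightarrow> 'v) set \<Rightarrow> 'n \<Rightarrow> 'n \<Rightarrow> bool" where
  "oriented_to G T B \<epsilon> x y \<longleftrightarrow> end_component G (adhesion_set B {x, y}) \<epsilon> \<subseteq> side_part T B x y"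

(* The node or end z of T lies in the component of T - xy containing y. *)
definition on_side :: "'n graph \<Rightarrow> 'n \<Rightarrow> 'n \<Rightarrow> 'n + (nat \<Rightarrow> 'n) set \<Rightarrow> bool" where
  "on_side T x y z = (case z of Inl t \<Rightarrow> t \<in> edge_side T x y
                              | Inr \<omega> \<Rightarrow> \<exists>R\<in>\<omega>. range R \<subseteq> edge_side T x y)"

(* f(\<epsilon>): the unique node or end of T towards which all edges point. *)
definition end_target ::
  "'v graph \<Rightarrow> 'n graph \<Rightarrow> ('n \<Rightarrow> 'v set) \<Rightarrow> (nat \<Rightarrow> 'v) set \<Rightarrow> 'n + (nat \<Rightarrow> 'n) set" where
  "end_target G T B \<epsilon> = (THE z. z \<in> Inl ` verts T \<union> Inr ` graph_ends T \<and>
     (\<forall>x y. {x, y} \<in> edges T \<longrightarrow> (oriented_to G T B \<epsilon> x y \<longleftrightarrow> on_side T x y z)))"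

definition boundary :: "'v graph \<Rightarrow> 'n graph \<Rightarrow> ('n \<Rightarrow> 'v set) \<Rightarrow> (nat \<Rightarrow> 'v) set set" where
  "boundary G T B = {\<epsilon> \<in> graph_ends G. end_target G T B \<epsilon> \<in> Inr ` graph_ends T}"

definition displays ::
  "'v graph \<Rightarrow> 'n graph \<Rightarrow> ('n \<Rightarrow> 'v set) \<Rightarrow> (nat \<Rightarrow> 'v) set set \<Rightarrow> bool" where
  "displays G T B \<Psi> \<longleftrightarrow>
     \<Psi> = boundary G T B \<and> bij_betw (end_target G T B) \<Psi> (Inr ` graph_ends T)"

end

(* (ii) ==> (iii): root the tree; the ends oriented up some edge at level n, together with the vertices
   strictly above such an edge, form an open set, and the intersection over all n is the boundary.

   (iii) ==> (i): let O_0, O_1, ... be decreasing open sets with intersection Psi. Starting from the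
   vertex set of G, split each region D at level n into connected regions with finite
   neighbourhoods, such that every end of Psi in D lies in one of them. A new region A either
   has fewer neighbours than D or lies in O_n together with its ends, and D loses an envelope of the
   complement of O_n. Orders cannot decrease for ever, so the ends that survive in all levels are
   those of Psi, and every vertex disappears at some level. The nodes of the tree are the regions;
   the adhesion set of the edge below D is N(D) and the part strictly above it is D.

   For linkedness, let ell D psi be the least order of a set inside D in which the end psi lives.
   Regions of smaller order than D are chosen as large regions of order ell D omega for an end omega,
   and the other regions contain them as subsets if they meet them. So ell is preserved from level to
   level while it is small, and by Menger's theorem a small separator between two adhesion sets
   would give a contradiction at the upper one. *)
theory Submission
  imports Defs
begin

section \<open>Connectivity\<close>

text \<open>Everything is phrased with vertex sets of finite neighbourhood instead of separations,
  so that an end only has to choose between a set and its complement. Three obstacles shape the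
  cutting of a region. Deleting the vertices outside O_n may leave components with infinite
  neighbourhoods; an envelope repairs this without adding ends to the closure. Minimum-order regions
  around different ends may cross; sub- and posimodularity make them disjoint and non-adjacent. And
  a minimum-order region cannot in general be shrunk into O_n without raising its order, which is
  why regions of smaller order are exempt from lying in O_n. That vertices disappear uses that the
  G_delta-set is taken in the space of vertices and ends together: the intersection of the O_n
  contains no vertex, so a vertex in regions of all levels would be a point too many.\<close>

locale sgraph =
  fixes G :: "'v graph"
  assumes simple: "simple_graph G"
begin

abbreviation V :: "'v set" where "V \<equiv> verts G"
abbreviation N :: "'v set \<Rightarrow> 'v set" where "N \<equiv> neighbourhood G"

definition adj :: "'v \<Rightarrow> 'v \<Rightarrow> bool" where "adj u v \<longleftrightarrow> {u, v} \<in> edges G"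

lemma adj_sym: "adj u v \<Longrightarrow> adj v u"
  by (simp add: adj_def insert_commute)

lemma adj_verts: assumes "adj u v" shows "u \<in> V" "v \<in> V" "u \<noteq> v"
proof -
  obtain a b where "a \<in> V" "b \<in> V" "a \<noteq> b" "{u, v} = {a, b}"
    using assms simple unfolding adj_def simple_graph_def by blast
  then show "u \<in> V" "v \<in> V" "u \<noteq> v" by (auto simp: doubleton_eq_iff)
qed

lemma N_iff: "v \<in> N A \<longleftrightarrow> v \<notin> A \<and> (\<exists>u\<in>A. adj u v)"
  unfolding neighbourhood_def adj_def[symmetric] using adj_verts by blast

lemma in_N: "a \<in> A \<Longrightarrow> adj a b \<Longrightarrow> b \<notin> A \<Longrightarrow> b \<in> N A"
  by (auto simp: N_iff)

lemma N_verts: "N A \<subseteq> V"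
  by (auto simp: neighbourhood_def)

lemma N_Int_self: "A \<inter> N A = {}" "N A \<inter> A = {}"
  by (auto simp: N_iff)

text \<open>Walks inside \<open>Z\<close> rather than paths: they compose, reverse and grow with
  \<open>Z\<close> at no cost. \<open>path_reach\<close> and \<open>reach_path\<close> translate
  from and to the list paths of the definitions.\<close>

definition reach :: "'v set \<Rightarrow> 'v \<Rightarrow> 'v \<Rightarrow> bool" where
  "reach Z u v \<longleftrightarrow> u \<in> Z \<and> (\<lambda>a b. b \<in> Z \<and> adj a b)\<^sup>*\<^sup>* u v"

lemma reach_refl: "u \<in> Z \<Longrightarrow> reach Z u u"
  by (simp add: reach_def)

lemma reach_step: "reach Z u v \<Longrightarrow> adj v w \<Longrightarrow> w \<in> Z \<Longrightarrow> reach Z u w"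
  unfolding reach_def by (auto intro: rtranclp.rtrancl_into_rtrancl)

lemma reach_induct [consumes 1, case_names refl step]:
  assumes "reach Z u v" and "u \<in> Z \<Longrightarrow> P u"
    and "\<And>a b. reach Z u a \<Longrightarrow> P a \<Longrightarrow> a \<in> Z \<Longrightarrow> b \<in> Z \<Longrightarrow> adj a b \<Longrightarrow> P b"
  shows "P v"
proof -
  have u: "u \<in> Z" and r: "(\<lambda>a b. b \<in> Z \<and> adj a b)\<^sup>*\<^sup>* u v"
    using assms(1) by (auto simp: reach_def)
  from r have "v \<in> Z \<and> P v"
  proof (induction rule: rtranclp_induct)
    case base show ?case using u assms(2) by simp
  next
    case (step a b)
    then show ?case using assms(3)[of a b] u by (simp add: reach_def)
  qed
  then show ?thesis by simp
qed

lemma reach_in: "reach Z u v \<Longrightarrow> u \<in> Z \<and> v \<in> Z"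
  by (induction rule: reach_induct) (auto simp: reach_def)

lemma reach_trans: "reach Z v w \<Longrightarrow> reach Z u v \<Longrightarrow> reach Z u w"
  by (induction rule: reach_induct) (auto intro: reach_step)

lemma reach_sym: "reach Z u v \<Longrightarrow> reach Z v u"
proof (induction rule: reach_induct)
  case refl then show ?case by (rule reach_refl)
next
  case (step a b)
  have "reach Z b a" using step reach_refl reach_step adj_sym by metis
  then show ?case using step reach_trans by blast
qed

lemma reach_mono: "reach Z u v \<Longrightarrow> Z \<subseteq> Z' \<Longrightarrow> reach Z' u v"
  by (induction rule: reach_induct) (auto intro: reach_refl reach_step)

lemma reach_closed:
  assumes "reach Z u v" "u \<in> A" "\<And>a b. a \<in> A \<Longrightarrow> a \<in> Z \<Longrightarrow> b \<in> Z \<Longrightarrow> adj a b \<Longrightarrow> b \<in> A"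
  shows "v \<in> A"
  using assms(1) by (induction rule: reach_induct) (use assms in blast)+

text \<open>The first vertex outside \<open>A\<close> on a walk from \<open>A\<close> lies in
  \<open>N A\<close>. Nearly all separation arguments below are this fact or one of its variants
  \<open>reach_meets_N\<close>, \<open>conn_dichotomy\<close> and
  \<open>conn_meets_N\<close>.\<close>

lemma reach_avoiding_N: "reach Z u v \<Longrightarrow> u \<in> A \<Longrightarrow> Z \<inter> N A = {} \<Longrightarrow> v \<in> A"
  by (erule reach_closed) (blast intro: in_N)+

lemma reach_meets_N: "reach Z u v \<Longrightarrow> u \<in> A \<Longrightarrow> v \<notin> A \<Longrightarrow> \<exists>w\<in>Z. w \<in> N A"
  using reach_avoiding_N by blast

section \<open>Connected vertex sets and components of induced subgraphs\<close>

definition conn :: "'v set \<Rightarrow> bool" where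
  "conn Z \<longleftrightarrow> Z \<noteq> {} \<and> Z \<subseteq> V \<and> (\<forall>u\<in>Z. \<forall>v\<in>Z. reach Z u v)"

lemma connD: "conn Z \<Longrightarrow> u \<in> Z \<Longrightarrow> v \<in> Z \<Longrightarrow> reach Z u v"
  by (simp add: conn_def)

lemma connI_from:
  assumes "Z \<subseteq> V" "u \<in> Z" "\<And>v. v \<in> Z \<Longrightarrow> reach Z u v" shows "conn Z"
  unfolding conn_def using assms(1,2) reach_trans[OF assms(3) reach_sym[OF assms(3)]] by blast

lemma conn_dichotomy: "conn K \<Longrightarrow> K \<inter> N A = {} \<Longrightarrow> K \<subseteq> A \<or> K \<inter> A = {}"
  using connD reach_avoiding_N by blast

lemma conn_meets_N: "conn K \<Longrightarrow> u \<in> K \<Longrightarrow> u \<in> A \<Longrightarrow> v \<in> K \<Longrightarrow> v \<notin> A \<Longrightarrow> K \<inter> N A \<noteq> {}"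
  using conn_dichotomy by blast

definition comp :: "'v set \<Rightarrow> 'v \<Rightarrow> 'v set" where "comp Z v = {u. reach Z v u}"

definition comps :: "'v set \<Rightarrow> 'v set set" where "comps Z = comp Z ` Z"

lemma comp_self: "v \<in> Z \<Longrightarrow> v \<in> comp Z v"
  by (simp add: comp_def reach_refl)

lemma comp_subset: "comp Z v \<subseteq> Z"
  using reach_in by (auto simp: comp_def)

lemma conn_comp: assumes "Z \<subseteq> V" "v \<in> Z" shows "conn (comp Z v)"
proof (rule connI_from[of _ v])
  show "reach (comp Z v) v u" if "u \<in> comp Z v" for u
  proof -
    have "reach Z v u" using that by (simp add: comp_def)
    then show ?thesis
    proof (induction rule: reach_induct)
      case refl then show ?case using reach_refl comp_self by blast
    next
      case (step a b)
      have "b \<in> comp Z v" using step reach_step by (auto simp: comp_def)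
      then show ?case using step reach_step by blast
    qed
  qed
qed (use assms comp_subset comp_self in blast)+

lemma conn_compsD: "Z \<subseteq> V \<Longrightarrow> K \<in> comps Z \<Longrightarrow> conn K"
  by (auto simp: comps_def conn_comp)

lemma compsD_subset: "K \<in> comps Z \<Longrightarrow> K \<subseteq> Z"
  using comp_subset by (auto simp: comps_def)

lemma Union_comps: "\<Union>(comps Z) = Z"
proof
  show "\<Union>(comps Z) \<subseteq> Z" using compsD_subset by blast
  show "Z \<subseteq> \<Union>(comps Z)" using comp_self unfolding comps_def by blast
qed

lemma comp_eqI: "w \<in> comp Z u \<Longrightarrow> w \<in> comp Z v \<Longrightarrow> comp Z u = comp Z v"
proof -
  assume w: "w \<in> comp Z u" "w \<in> comp Z v"
  then have uv: "reach Z u v" "reach Z v u"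
    using reach_trans[OF reach_sym, of Z v w u] reach_trans[OF reach_sym, of Z u w v]
    by (simp_all add: comp_def)
  show ?thesis
    using reach_trans[OF _ uv(1)] reach_trans[OF _ uv(2)] by (auto simp: comp_def)
qed

lemma comps_disjoint: "K \<in> comps Z \<Longrightarrow> L \<in> comps Z \<Longrightarrow> w \<in> K \<Longrightarrow> w \<in> L \<Longrightarrow> K = L"
  unfolding comps_def using comp_eqI by blast

lemma comps_Int_N: "K \<in> comps Z \<Longrightarrow> Z \<inter> N K = {}"
proof (rule ccontr)
  assume K: "K \<in> comps Z" and "Z \<inter> N K \<noteq> {}"
  then obtain w u where w: "w \<in> Z" "w \<notin> K" "u \<in> K" "adj u w" by (auto simp: N_iff)
  obtain v where v: "K = comp Z v" using K by (auto simp: comps_def)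
  have "reach Z v w" using w v reach_step by (auto simp: comp_def)
  then show False using w v by (simp add: comp_def)
qed

lemma comps_N_subset: assumes "K \<in> comps Z" shows "N K \<subseteq> V - Z"
  using comps_Int_N[OF assms] N_verts by blast

lemma comps_N_subset_N: assumes "K \<in> comps Z" shows "N K \<subseteq> N Z"
  using comps_Int_N[OF assms] compsD_subset[OF assms] by (fastforce simp: N_iff)

lemma conn_subset_comp: "conn K \<Longrightarrow> K \<subseteq> Z \<Longrightarrow> v \<in> K \<Longrightarrow> K \<subseteq> comp Z v"
  unfolding comp_def using connD reach_mono by blast

lemma conn_subset_comps: assumes "conn K" "K \<subseteq> Z" obtains C where "C \<in> comps Z" "K \<subseteq> C"
proof -
  obtain v where "v \<in> K" using assms by (auto simp: conn_def)
  then show ?thesis using that[of "comp Z v"] assms conn_subset_comp by (auto simp: comps_def)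
qed

lemma comps_ex: "v \<in> Z \<Longrightarrow> \<exists>K\<in>comps Z. v \<in> K"
  using Union_comps by blast

lemma comps_eqI:
  assumes "conn K" "K \<subseteq> Z" "Z \<inter> N K = {}" "Z \<subseteq> V" shows "K \<in> comps Z"
proof -
  obtain C where C: "C \<in> comps Z" "K \<subseteq> C" using conn_subset_comps assms by metis
  have "C \<subseteq> K" using conn_dichotomy[of C K] conn_compsD[OF assms(4) C(1)] C assms compsD_subset
    by (metis conn_def disjoint_iff inf.absorb_iff1 inf_commute subset_iff)
  then show ?thesis using C by auto
qed

lemma comps_N_adhesion: "finite (N A) \<Longrightarrow> K \<in> comps A \<Longrightarrow> finite (N K)"
  using comps_N_subset_N finite_subset by blast

section \<open>Paths\<close>

lemma successively_path_edge:
  "successively (\<lambda>u v. {u, v} \<in> edges G) p \<longleftrightarrow> successively adj p"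
  by (simp add: adj_def)

lemma path_reach_hd:
  "successively adj p \<Longrightarrow> p \<noteq> [] \<Longrightarrow> set p \<subseteq> Z \<Longrightarrow> v \<in> set p \<Longrightarrow> reach Z (hd p) v"
proof (induction p arbitrary: v)
  case Nil then show ?case by simp
next
  case (Cons a p)
  show ?case
  proof (cases "p = [] \<or> v = a")
    case True then show ?thesis using Cons.prems by (auto intro: reach_refl)
  next
    case False
    then have "reach Z (hd p) v" using Cons by (auto simp: successively_Cons)
    moreover have "reach Z a (hd p)"
      using Cons.prems False by (cases p) (auto intro: reach_step reach_refl)
    ultimately show ?thesis using reach_trans by auto
  qed
qed

lemma path_reach:
  assumes "graph_path G p" "set p \<subseteq> Z" "u \<in> set p" "v \<in> set p" shows "reach Z u v"
  using path_reach_hd[of p Z u] path_reach_hd[of p Z v] assms reach_sym reach_trans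
  unfolding graph_path_def successively_path_edge by blast

lemma reach_path:
  assumes "reach Z u v" "Z \<subseteq> V"
  shows "\<exists>p. graph_path G p \<and> hd p = u \<and> last p = v \<and> set p \<subseteq> Z"
  using assms(1)
proof (induction rule: reach_induct)
  case refl
  then show ?case using assms(2) by (intro exI[of _ "[u]"]) (auto simp: graph_path_def)
next
  case (step a b)
  then obtain p where p: "graph_path G p" "hd p = u" "last p = a" "set p \<subseteq> Z" by blast
  show ?case
  proof (cases "b \<in> set p")
    \<comment> \<open>The walk returns to a vertex of \<open>p\<close>; the detour is cut off to
      keep the list distinct.\<close>
    case True
    then obtain xs ys where xs: "p = xs @ b # ys" using split_list by metis
    have "graph_path G (xs @ [b])" using p(1) xs
      by (auto simp: graph_path_def successively_append_iff successively_Cons)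
    moreover have "hd (xs @ [b]) = u" using p(2) xs by (cases xs) auto
    ultimately show ?thesis using xs p(4) by (intro exI[of _ "xs @ [b]"]) auto
  next
    case False
    have "graph_path G (p @ [b])" using p step False assms(2)
      by (auto simp: graph_path_def successively_append_iff adj_def)
    moreover have "hd (p @ [b]) = u" using p by (cases p) (auto simp: graph_path_def)
    ultimately show ?thesis using p step by (intro exI[of _ "p @ [b]"]) auto
  qed
qed

lemma joined_iff: "joined G u v \<longleftrightarrow> reach V u v"
proof
  assume "joined G u v"
  then obtain p where "graph_path G p" "hd p = u" "last p = v" by (auto simp: joined_def)
  then show "reach V u v" using path_reach[of p V u v] by (auto simp: graph_path_def)
qed (use reach_path[of V u v] in \<open>auto simp: joined_def\<close>)

lemma graph_path_induced:
  "graph_path (induced_subgraph G W) p \<longleftrightarrow> graph_path G p \<and> set p \<subseteq> W"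
proof -
  have "set p \<subseteq> W \<Longrightarrow> successively (\<lambda>u v. {u, v} \<in> edges G \<and> u \<in> W \<and> v \<in> W) p
      \<longleftrightarrow> successively (\<lambda>u v. {u, v} \<in> edges G) p"
    by (rule successively_cong) auto
  then show ?thesis by (auto simp: graph_path_def induced_subgraph_def)
qed

lemma joined_induced: "joined (induced_subgraph G W) u v \<longleftrightarrow> reach (V \<inter> W) u v"
proof
  assume "joined (induced_subgraph G W) u v"
  then obtain p where "graph_path G p" "set p \<subseteq> W" "hd p = u" "last p = v"
    by (auto simp: joined_def graph_path_induced)
  then show "reach (V \<inter> W) u v" using path_reach[of p "V \<inter> W" u v] by (auto simp: graph_path_def)
qed (use reach_path[of "V \<inter> W" u v] in \<open>auto simp: joined_def graph_path_induced\<close>)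

lemma connected_induced: "connected_graph (induced_subgraph G W) \<longleftrightarrow> conn (V \<inter> W)"
  by (auto simp: connected_graph_def joined_induced conn_def) (auto simp: induced_subgraph_def)

lemma components_induced: "graph_components (induced_subgraph G W) = comps (V \<inter> W)"
  unfolding graph_components_def comps_def component_of_def comp_def joined_induced
  by (simp add: induced_subgraph_def)

lemma components_delete_verts: "graph_components (delete_verts G S) = comps (V - S)"
  using components_induced[of "V - S"] by (simp add: delete_verts_def Int_absorb1)

text \<open>A shortest path in \<open>Z\<close> from \<open>A\<close> to \<open>B\<close> works: a
  further visit to either set would allow a shorter one, which yields the two singleton conditions
  of \<open>AB_path\<close>.\<close>

lemma AB_path_exists:
  assumes "reach Z a b" "Z \<subseteq> V" "a \<in> A" "b \<in> B"
  shows "\<exists>p. AB_path G A B p \<and> set p \<subseteq> Z"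
proof -
  define P where "P p \<longleftrightarrow> graph_path G p \<and> hd p \<in> A \<and> last p \<in> B \<and> set p \<subseteq> Z" for p
  have "\<exists>p. P p" using reach_path[OF assms(1,2)] assms(3,4) by (auto simp: P_def)
  then obtain p0 where "P p0" by blast
  then obtain p where p: "P p" and min: "\<And>q. P q \<Longrightarrow> length p \<le> length q"
    using arg_min_nat_lemma[of P p0 length] by blast
  have ne: "p \<noteq> []" "distinct p" using p by (auto simp: P_def graph_path_def)
  have sub: "x = hd p" if x: "x \<in> set p" "x \<in> A" for x
  proof (rule ccontr)
    assume "x \<noteq> hd p"
    then obtain xs ys where xs: "p = xs @ x # ys" "xs \<noteq> []"
      using split_list[OF x(1)] by (metis append_Nil list.sel(1))
    then have "P (x # ys)" using p x by (auto simp: P_def graph_path_def successively_append_iff)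
    then show False using min[of "x # ys"] xs by auto
  qed
  have sub': "x = last p" if x: "x \<in> set p" "x \<in> B" for x
  proof (rule ccontr)
    assume "x \<noteq> last p"
    then obtain xs ys where xs: "p = xs @ x # ys" "ys \<noteq> []"
      using split_list[OF x(1)] by (metis last_snoc)
    then have "P (xs @ [x])" using p x
      by (cases xs) (auto simp: P_def graph_path_def successively_append_iff successively_Cons hd_append)
    then show False using min[of "xs @ [x]"] xs by (cases ys) auto
  qed
  have "hd p \<in> set p" "last p \<in> set p" using ne by auto
  then have "AB_path G A B p" using p sub sub' unfolding AB_path_def P_def by blast
  then show ?thesis using p by (auto simp: P_def)
qed

lemma separates_iff:
  "separates G S A B \<longleftrightarrow> \<not> (\<exists>a\<in>A. \<exists>b\<in>B. reach (V - S) a b)"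
proof
  show "\<not> (\<exists>a\<in>A. \<exists>b\<in>B. reach (V - S) a b)" if "separates G S A B"
  proof
    assume "\<exists>a\<in>A. \<exists>b\<in>B. reach (V - S) a b"
    then obtain p where "AB_path G A B p" "set p \<subseteq> V - S" using AB_path_exists[of "V - S"] by blast
    then show False using that by (auto simp: separates_def)
  qed
next
  assume *: "\<not> (\<exists>a\<in>A. \<exists>b\<in>B. reach (V - S) a b)"
  show "separates G S A B" unfolding separates_def
  proof (intro allI impI notI)
    fix p assume p: "AB_path G A B p" "set p \<inter> S = {}"
    then have gp: "graph_path G p" "set p \<inter> A = {hd p}" "set p \<inter> B = {last p}" by (auto simp: AB_path_def)
    then have "reach (V - S) (hd p) (last p)"
      using path_reach[of p "V - S" "hd p" "last p"] p(2) by (auto simp: graph_path_def)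
    then show False using * gp by blast
  qed
qed

section \<open>Neighbourhoods are submodular\<close>

lemma N_Int_subset: "N (A \<inter> B) \<subseteq> N A \<union> N B"
  by (auto simp: N_iff)

lemma N_Un_subset: "N (A \<union> B) \<subseteq> N A \<union> N B"
  by (auto simp: N_iff)

lemma N_far_subset: "N (V - A - N A) \<subseteq> N A"
proof
  fix x assume "x \<in> N (V - A - N A)"
  then obtain u where u: "u \<in> V" "u \<notin> A" "u \<notin> N A" "adj u x" "x \<in> A \<or> x \<in> N A"
    using adj_verts(2) by (auto simp only: N_iff[of x "V - A - N A"] Diff_iff)
  then show "x \<in> N A" using in_N[of x A u] adj_sym by blast
qed

lemma N_Diff_subset: "N (A - (K \<union> N K)) \<subseteq> N A \<union> N K"
proof
  fix x assume "x \<in> N (A - (K \<union> N K))"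
  then obtain u where u: "u \<in> A" "u \<notin> K" "u \<notin> N K" "adj u x" "x \<notin> A \<or> x \<in> K \<or> x \<in> N K"
    by (auto simp only: N_iff[of x "A - (K \<union> N K)"] Diff_iff Un_iff)
  then show "x \<in> N A \<union> N K" using in_N[of x K u] in_N[of u A x] adj_sym by blast
qed

text \<open>Both uncrossing laws come from |X| + |Y| = |X \<union> Y| + |X \<inter> Y|: only union
  and intersection of the new neighbourhoods have to be compared with those of the old ones.\<close>

lemma card_uncross:
  assumes "finite P" "finite Q" "X \<union> Y \<subseteq> P \<union> Q" "X \<inter> Y \<subseteq> P \<inter> Q"
  shows "card X + card Y \<le> card P + card Q"
proof -
  have fin: "finite X" "finite Y" using assms finite_subset by (blast, blast)
  have "card X + card Y = card (X \<union> Y) + card (X \<inter> Y)" using fin by (rule card_Un_Int)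
  also have "\<dots> \<le> card (P \<union> Q) + card (P \<inter> Q)"
    using assms by (intro add_mono card_mono) auto
  also have "\<dots> = card P + card Q" using card_Un_Int[OF assms(1,2)] by simp
  finally show ?thesis .
qed

lemma submodular:
  assumes "finite (N A)" "finite (N B)"
  shows "card (N (A \<inter> B)) + card (N (A \<union> B)) \<le> card (N A) + card (N B)"
  by (rule card_uncross[OF assms]) (auto simp: N_iff)

text \<open>The law for two sets that are to be drawn apart instead of merged. A common neighbour of
  the two differences is in neither \<open>A\<close> nor \<open>B\<close>, because the vertices
  adjacent to it were chosen outside \<open>N A\<close> and \<open>N B\<close> respectively; hence
  it lies in both neighbourhoods.\<close>

lemma posimodular:
  assumes "finite (N A)" "finite (N B)"
  shows "card (N (A - (B \<union> N B))) + card (N (B - (A \<union> N A))) \<le> card (N A) + card (N B)"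
proof (rule card_uncross[OF assms])
  show "N (A - (B \<union> N B)) \<union> N (B - (A \<union> N A)) \<subseteq> N A \<union> N B"
    using N_Diff_subset by blast
  show "N (A - (B \<union> N B)) \<inter> N (B - (A \<union> N A)) \<subseteq> N A \<inter> N B"
  proof
    fix x assume "x \<in> N (A - (B \<union> N B)) \<inter> N (B - (A \<union> N A))"
    then obtain u w where "u \<in> A" "u \<notin> B" "u \<notin> N B" "adj u x" "w \<in> B" "w \<notin> A" "w \<notin> N A" "adj w x"
      by (auto simp only: N_iff[of x "A - (B \<union> N B)"] N_iff[of x "B - (A \<union> N A)"] Diff_iff Un_iff Int_iff)
    then show "x \<in> N A \<inter> N B"
      using in_N[of x B u] in_N[of u A x] in_N[of x A w] in_N[of w B x] adj_sym by blast
  qed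
qed

end


section \<open>Ends\<close>

context sgraph begin

abbreviation ev :: "(nat \<Rightarrow> 'v) \<Rightarrow> 'v set \<Rightarrow> bool" where
  "ev R A \<equiv> eventually (\<lambda>n. R n \<in> A) sequentially"

lemma ev_Int: "ev R (A \<inter> B) \<longleftrightarrow> ev R A \<and> ev R B"
  by (simp add: eventually_conj_iff)

lemma ev_mono: "ev R A \<Longrightarrow> A \<subseteq> B \<Longrightarrow> ev R B"
  by (auto elim: eventually_mono)

lemma ray_adj: "ray G R \<Longrightarrow> adj (R n) (R (Suc n))"
  by (simp add: ray_def adj_def)

lemma ray_verts: "ray G R \<Longrightarrow> R n \<in> V"
  by (auto simp: ray_def)

lemma ev_verts: "ray G R \<Longrightarrow> ev R V"
  by (simp add: ray_verts)

lemma ray_ev_avoids_finite: assumes "ray G R" "finite F" shows "ev R (- F)"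
proof -
  have "inj R" using assms by (simp add: ray_def)
  then have "finite {n. R n \<in> F}" using assms(2) finite_vimageI[of F R] by (simp add: vimage_def)
  then show ?thesis unfolding eventually_sequentially
    by (metis (mono_tags, lifting) ComplI finite_nat_set_iff_bounded mem_Collect_eq not_less)
qed

lemma ray_stays:
  assumes "ray G R" "R m \<in> A" "\<And>k. k \<ge> m \<Longrightarrow> R k \<notin> N A" "k \<ge> m" shows "R k \<in> A"
  using assms(4)
proof (induction k rule: dec_induct)
  case base then show ?case using assms by simp
next
  case (step k)
  then show ?case using in_N[of "R k" A "R (Suc k)"] ray_adj[OF assms(1), of k] assms(3)[of "Suc k"] by auto
qed

text \<open>An injective ray meets the finite set \<open>N A\<close> only finitely often, and after
  that it cannot change sides.\<close>

lemma ray_dichotomy: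
  assumes "ray G R" "finite (N A)" shows "ev R A \<or> ev R (- A)"
proof -
  obtain n where n: "\<And>m. m \<ge> n \<Longrightarrow> R m \<notin> N A"
    using ray_ev_avoids_finite[OF assms] by (auto simp: eventually_sequentially)
  show ?thesis
  proof (cases "\<exists>m\<ge>n. R m \<in> A")
    case True
    then obtain m where m: "m \<ge> n" "R m \<in> A" by blast
    then have "R k \<in> A" if "k \<ge> m" for k
      using ray_stays[OF assms(1) m(2) _ that] n by auto
    then show ?thesis by (auto simp: eventually_sequentially)
  next
    case False then show ?thesis by (auto simp: eventually_sequentially)
  qed
qed

lemma ray_reach:
  assumes "ray G R" "\<And>k. k \<ge> m \<Longrightarrow> R k \<in> Z" "n \<ge> m" shows "reach Z (R m) (R n)"
  using assms(3)
proof (induction n rule: dec_induct)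
  case base then show ?case using assms by (simp add: reach_refl)
next
  case (step k)
  then show ?case using ray_adj[OF assms(1), of k] assms(2)[of "Suc k"] by (auto intro: reach_step)
qed

lemma ray_shift: "ray G R \<Longrightarrow> ray G (\<lambda>n. R (n + k))"
  by (auto simp: ray_def inj_def) (metis add_right_cancel)

lemma ray_rel_rays: "(R, R') \<in> ray_rel G \<Longrightarrow> ray G R \<and> ray G R'"
  by (auto simp: ray_rel_def)

lemma ray_rel_ev:
  assumes "(R, R') \<in> ray_rel G" "finite (N A)" "ev R A" shows "ev R' A"
proof (rule ccontr)
  assume "\<not> ev R' A"
  then have "ev R' (- A)" using ray_dichotomy ray_rel_rays assms by blast
  then obtain m where m: "\<And>k. k \<ge> m \<Longrightarrow> R' k \<notin> A" by (auto simp: eventually_sequentially)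
  obtain n where n: "\<And>k. k \<ge> n \<Longrightarrow> R k \<in> A" using assms by (auto simp: eventually_sequentially)
  \<comment> \<open>The initial segments are put into \<open>S\<close> so that a connecting walk
    starts in the tail inside \<open>A\<close> and finishes in the tail outside it. It then crosses
    \<open>N A\<close>, which is part of \<open>S\<close> as well.\<close>
  define S where "S = N A \<union> R ` {..n} \<union> R' ` {..m}"
  have rays: "ray G R" "ray G R'" using ray_rel_rays assms by auto
  have "finite S" "S \<subseteq> V" using assms N_verts rays ray_verts by (auto simp: S_def)
  then have "\<not> separates G S (range R) (range R')" using assms(1) by (auto simp: ray_rel_def)
  then obtain i j where r: "reach (V - S) (R i) (R' j)" by (auto simp: separates_iff)
  then have "R i \<notin> S" "R' j \<notin> S" using reach_in by blast+
  then have "i > n" "j > m" unfolding S_def by (metis UnI1 UnI2 atMost_iff imageI not_le)+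
  then have "R i \<in> A" "R' j \<notin> A" using n m by auto
  then have "\<exists>w\<in>V - S. w \<in> N A" using reach_meets_N[OF r] by blast
  then show False by (auto simp: S_def)
qed

lemma ray_relI:
  assumes "ray G R" "ray G R'"
    and "\<And>S. finite S \<Longrightarrow> S \<subseteq> V \<Longrightarrow> \<exists>i j. reach (V - S) (R i) (R' j)"
  shows "(R, R') \<in> ray_rel G"
  using assms by (fastforce simp: ray_rel_def separates_iff)

text \<open>Equivalent rays are those with tails in the same sets of finite neighbourhood. In this
  form reflexivity, symmetry and transitivity are immediate. For the converse direction, the
  component of a tail outside \<open>S\<close> serves as the test set.\<close>

lemma ray_rel_iff:
  "(R, R') \<in> ray_rel G \<longleftrightarrow> ray G R \<and> ray G R' \<and> (\<forall>A. finite (N A) \<longrightarrow> (ev R A \<longleftrightarrow> ev R' A))"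
proof
  assume *: "(R, R') \<in> ray_rel G"
  then have r: "ray G R" "ray G R'" using ray_rel_rays by auto
  have "ev R A \<longleftrightarrow> ev R' A" if A: "finite (N A)" for A
  proof
    show "ev R A \<Longrightarrow> ev R' A" using ray_rel_ev * A by blast
    assume e: "ev R' A"
    show "ev R A"
    proof (rule ccontr)
      assume "\<not> ev R A"
      \<comment> \<open>Symmetry of the relation is not yet available, so the direction already
        proved is applied to the far side of \<open>A\<close> instead.\<close>
      then have "ev R (- A)" using ray_dichotomy[OF r(1) A] by blast
      then have "ev R (V - A - N A)"
        using ray_ev_avoids_finite[OF r(1) A] ev_verts[OF r(1)] by eventually_elim blast
      then have "ev R' (V - A - N A)"
        using ray_rel_ev[OF *] A finite_subset[OF N_far_subset[of A]] by blast
      then have "ev R' (A \<inter> (V - A - N A))" using e ev_Int by blast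
      then show False by (auto simp: eventually_sequentially)
    qed
  qed
  then show "ray G R \<and> ray G R' \<and> (\<forall>A. finite (N A) \<longrightarrow> (ev R A \<longleftrightarrow> ev R' A))"
    using r by blast
next
  assume *: "ray G R \<and> ray G R' \<and> (\<forall>A. finite (N A) \<longrightarrow> (ev R A \<longleftrightarrow> ev R' A))"
  show "(R, R') \<in> ray_rel G"
  proof (rule ray_relI)
    fix S assume S: "finite S" "S \<subseteq> V"
    obtain n where n: "\<And>k. k \<ge> n \<Longrightarrow> R k \<in> V - S"
      using ray_ev_avoids_finite[of R S] * S ray_verts by (auto simp: eventually_sequentially)
    define A where "A = comp (V - S) (R n)"
    have "A \<in> comps (V - S)" using n[of n] by (auto simp: A_def comps_def)
    then have "N A \<subseteq> S" using comps_N_subset[of A "V - S"] by blast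
    then have "finite (N A)" using S finite_subset by blast
    moreover have "ev R A"
      unfolding eventually_sequentially A_def comp_def
      using ray_reach[of R n "V - S"] * n by blast
    ultimately have "ev R' A" using * by blast
    then obtain j where "R' j \<in> A" by (auto simp: eventually_sequentially)
    then show "\<exists>i j. reach (V - S) (R i) (R' j)" by (auto simp: A_def comp_def)
  qed (use * in auto)
qed

lemma equiv_ray_rel: "equiv {R. ray G R} (ray_rel G)"
  by (rule equivI) (auto simp: refl_on_def sym_def trans_def ray_rel_iff)

section \<open>Ends living in vertex sets\<close>

definition rep :: "(nat \<Rightarrow> 'v) set \<Rightarrow> nat \<Rightarrow> 'v" where "rep \<epsilon> = (SOME R. R \<in> \<epsilon>)"

text \<open>Evaluated at one fixed ray, so that monotonicity and intersections cause no trouble for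
  arbitrary sets. For sets with finite neighbourhood the choice of the ray is immaterial, by
  \<open>lives_iff_ev\<close>.\<close>

definition lives :: "(nat \<Rightarrow> 'v) set \<Rightarrow> 'v set \<Rightarrow> bool" where "lives \<epsilon> A \<longleftrightarrow> ev (rep \<epsilon>) A"

lemma rep_in: assumes "\<epsilon> \<in> graph_ends G" shows "rep \<epsilon> \<in> \<epsilon>"
proof -
  have "\<epsilon> \<noteq> {}" using assms in_quotient_imp_non_empty[OF equiv_ray_rel] by (auto simp: graph_ends_def)
  then show ?thesis unfolding rep_def by (simp add: some_in_eq)
qed

lemma end_rays: assumes "\<epsilon> \<in> graph_ends G" "R \<in> \<epsilon>" shows "ray G R"
  using assms in_quotient_imp_subset[OF equiv_ray_rel] unfolding graph_ends_def by blast

lemma rep_ray: "\<epsilon> \<in> graph_ends G \<Longrightarrow> ray G (rep \<epsilon>)"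
  using rep_in end_rays by blast

lemma end_rel: "\<epsilon> \<in> graph_ends G \<Longrightarrow> R \<in> \<epsilon> \<Longrightarrow> R' \<in> \<epsilon> \<Longrightarrow> (R, R') \<in> ray_rel G"
  unfolding graph_ends_def by (metis equiv_ray_rel quotient_eq_iff)

lemma end_rel_in: "\<epsilon> \<in> graph_ends G \<Longrightarrow> R \<in> \<epsilon> \<Longrightarrow> (R, R') \<in> ray_rel G \<Longrightarrow> R' \<in> \<epsilon>"
  unfolding graph_ends_def by (metis equiv_ray_rel in_quotient_imp_closed)

lemma lives_iff_ev:
  "\<epsilon> \<in> graph_ends G \<Longrightarrow> R \<in> \<epsilon> \<Longrightarrow> finite (N A) \<Longrightarrow> lives \<epsilon> A \<longleftrightarrow> ev R A"
  using end_rel[OF _ rep_in] ray_rel_iff unfolding lives_def by blast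

lemma end_of_ray:
  assumes "ray G R" obtains \<epsilon> where "\<epsilon> \<in> graph_ends G" "R \<in> \<epsilon>"
proof -
  have "ray_rel G `` {R} \<in> graph_ends G" using assms by (auto simp: graph_ends_def intro: quotientI)
  moreover have "R \<in> ray_rel G `` {R}" using assms by (auto simp: ray_rel_iff)
  ultimately show ?thesis using that by blast
qed

lemma lives_iff_ray:
  assumes "\<epsilon> \<in> graph_ends G" "finite (N A)"
  shows "lives \<epsilon> A \<longleftrightarrow> (\<exists>R\<in>\<epsilon>. range R \<subseteq> A)"
proof
  assume "lives \<epsilon> A"
  then obtain n where n: "\<And>k. k \<ge> n \<Longrightarrow> rep \<epsilon> k \<in> A" by (auto simp: lives_def eventually_sequentially)
  define R where "R k = rep \<epsilon> (k + n)" for k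
  have "ray G R" unfolding R_def using ray_shift rep_ray assms by blast
  moreover have "ev R A \<longleftrightarrow> ev (rep \<epsilon>) A" for A
    unfolding R_def by (rule eventually_sequentially_seg)
  ultimately have "(rep \<epsilon>, R) \<in> ray_rel G" using rep_ray assms by (simp add: ray_rel_iff)
  then have "R \<in> \<epsilon>" using end_rel_in rep_in assms by blast
  moreover have "range R \<subseteq> A" using n by (auto simp: R_def)
  ultimately show "\<exists>R\<in>\<epsilon>. range R \<subseteq> A" by blast
next
  assume "\<exists>R\<in>\<epsilon>. range R \<subseteq> A"
  then obtain R where R: "R \<in> \<epsilon>" "range R \<subseteq> A" by blast
  then have "ev R A" by (simp add: range_subsetD)
  then show "lives \<epsilon> A" using lives_iff_ev assms R by blast
qed

lemma lives_Int: "lives \<epsilon> (A \<inter> B) \<longleftrightarrow> lives \<epsilon> A \<and> lives \<epsilon> B"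
  by (simp add: lives_def eventually_conj_iff)

lemma lives_mono: "lives \<epsilon> A \<Longrightarrow> A \<subseteq> B \<Longrightarrow> lives \<epsilon> B"
  unfolding lives_def using ev_mono by blast

lemma lives_nonempty: "lives \<epsilon> A \<Longrightarrow> A \<noteq> {}"
  unfolding lives_def by (auto simp: eventually_sequentially)

lemma lives_disjoint: "lives \<epsilon> A \<Longrightarrow> lives \<epsilon> B \<Longrightarrow> A \<inter> B \<noteq> {}"
  using lives_Int lives_nonempty by blast

lemma lives_verts: "\<epsilon> \<in> graph_ends G \<Longrightarrow> lives \<epsilon> V"
  unfolding lives_def using ev_verts rep_ray by blast

lemma lives_Diff_finite: 
  assumes "\<epsilon> \<in> graph_ends G" "finite F" shows "lives \<epsilon> (A - F) \<longleftrightarrow> lives \<epsilon> A"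
  using ray_ev_avoids_finite[OF rep_ray[OF assms(1)] assms(2)] lives_Int[of \<epsilon> A "-F"]
  by (auto simp: lives_def Diff_eq)

lemma lives_far: 
  assumes "\<epsilon> \<in> graph_ends G" "finite (N A)" shows "lives \<epsilon> (V - A - N A) \<longleftrightarrow> \<not> lives \<epsilon> A"
proof
  show "lives \<epsilon> (V - A - N A) \<Longrightarrow> \<not> lives \<epsilon> A" using lives_disjoint by blast
  assume "\<not> lives \<epsilon> A"
  then have "lives \<epsilon> (V \<inter> - A)"
    using ray_dichotomy[OF rep_ray[OF assms(1)] assms(2)] lives_verts[OF assms(1)] lives_Int lives_def by blast
  then show "lives \<epsilon> (V - A - N A)" using lives_Diff_finite[OF assms] by (simp add: Diff_eq)
qed

text \<open>A tail of the ray inside \<open>A\<close> is connected in \<open>A\<close>, so it stays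
  in one component.\<close>

lemma lives_comps:
  assumes "\<epsilon> \<in> graph_ends G" "finite (N A)" "A \<subseteq> V" "lives \<epsilon> A"
  obtains K where "K \<in> comps A" "lives \<epsilon> K"
proof -
  obtain n where n: "\<And>k. k \<ge> n \<Longrightarrow> rep \<epsilon> k \<in> A"
    using assms by (auto simp: lives_def eventually_sequentially)
  have "rep \<epsilon> k \<in> comp A (rep \<epsilon> n)" if "k \<ge> n" for k
    unfolding comp_def using ray_reach[OF rep_ray[OF assms(1)] n that] by blast
  then have "lives \<epsilon> (comp A (rep \<epsilon> n))" by (auto simp: lives_def eventually_sequentially)
  moreover have "comp A (rep \<epsilon> n) \<in> comps A" using n[of n] by (simp add: comps_def)
  ultimately show ?thesis using that by blast
qed

lemma ends_eqI:
  assumes "\<epsilon> \<in> graph_ends G" "\<epsilon>' \<in> graph_ends G"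
    and "\<And>S. finite S \<Longrightarrow> \<exists>A. conn A \<and> A \<inter> S = {} \<and> lives \<epsilon> A \<and> lives \<epsilon>' A"
  shows "\<epsilon> = \<epsilon>'"
proof -
  have "(rep \<epsilon>, rep \<epsilon>') \<in> ray_rel G"
  proof (rule ray_relI)
    fix S assume "finite S" "S \<subseteq> V"
    then obtain A where A: "conn A" "A \<inter> S = {}" "lives \<epsilon> A" "lives \<epsilon>' A" using assms(3) by blast
    then obtain i j where "rep \<epsilon> i \<in> A" "rep \<epsilon>' j \<in> A"
      unfolding lives_def eventually_sequentially by blast
    moreover have "A \<subseteq> V - S" using A by (auto simp: conn_def)
    ultimately show "\<exists>i j. reach (V - S) (rep \<epsilon> i) (rep \<epsilon>' j)" using A(1) connD reach_mono by blast
  qed (use assms rep_ray in auto)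
  then have "rep \<epsilon>' \<in> \<epsilon>" using end_rel_in rep_in assms by blast
  then show ?thesis using assms rep_in[of \<epsilon>'] quotient_disj[OF equiv_ray_rel, of \<epsilon> \<epsilon>']
    unfolding graph_ends_def by blast
qed

abbreviation ecomp :: "'v set \<Rightarrow> (nat \<Rightarrow> 'v) set \<Rightarrow> 'v set" where "ecomp \<equiv> end_component G"

lemma N_delete_comps: "K \<in> comps (V - S) \<Longrightarrow> N K \<subseteq> S"
  using comps_N_subset by blast

text \<open>Justifies the definite description in \<open>end_component\<close>: a tail of the end
  avoids \<open>S\<close> and so picks a component, and two components in which the end lives would
  intersect.\<close>

lemma ecomp:
  assumes "\<epsilon> \<in> graph_ends G" "finite S"
  shows "ecomp S \<epsilon> \<in> comps (V - S)" "lives \<epsilon> (ecomp S \<epsilon>)"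
proof -
  have fin: "finite (N K)" if "K \<in> comps (V - S)" for K
    using N_delete_comps[OF that] assms(2) finite_subset by blast
  have eq: "(K \<in> graph_components (delete_verts G S) \<and> (\<exists>R\<in>\<epsilon>. range R \<subseteq> K)) \<longleftrightarrow>
      (K \<in> comps (V - S) \<and> lives \<epsilon> K)" for K
    using lives_iff_ray[OF assms(1) fin] by (auto simp: components_delete_verts)
  have "N (V - S) \<subseteq> S" using N_verts[of "V - S"] N_Int_self(1)[of "V - S"] by blast
  then obtain K where K: "K \<in> comps (V - S)" "lives \<epsilon> K"
    using lives_comps[OF assms(1), of "V - S"] assms lives_verts lives_Diff_finite finite_subset
    by (metis Diff_subset)
  have "ecomp S \<epsilon> \<in> comps (V - S) \<and> lives \<epsilon> (ecomp S \<epsilon>)"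
    unfolding end_component_def eq
  proof (rule theI)
    show "K \<in> comps (V - S) \<and> lives \<epsilon> K" using K by simp
    fix L assume L: "L \<in> comps (V - S) \<and> lives \<epsilon> L"
    then obtain w where "w \<in> K" "w \<in> L" using K lives_disjoint by blast
    then show "L = K" using comps_disjoint K L by blast
  qed
  then show "ecomp S \<epsilon> \<in> comps (V - S)" "lives \<epsilon> (ecomp S \<epsilon>)" by auto
qed

lemma ecomp_facts:
  assumes "\<epsilon> \<in> graph_ends G" "finite S"
  shows "conn (ecomp S \<epsilon>)" "ecomp S \<epsilon> \<inter> S = {}" "N (ecomp S \<epsilon>) \<subseteq> S" "ecomp S \<epsilon> \<subseteq> V"
  using ecomp[OF assms] conn_compsD[of "V - S"] compsD_subset[of "ecomp S \<epsilon>" "V - S"]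
    N_delete_comps by auto

lemma ecomp_eq_iff:
  assumes "\<epsilon> \<in> graph_ends G" "\<phi> \<in> graph_ends G" "finite S"
  shows "ecomp S \<phi> = ecomp S \<epsilon> \<longleftrightarrow> lives \<phi> (ecomp S \<epsilon>)"
proof
  show "lives \<phi> (ecomp S \<epsilon>) \<Longrightarrow> ecomp S \<phi> = ecomp S \<epsilon>"
    using ecomp[OF assms(1,3)] ecomp[OF assms(2,3)] lives_disjoint comps_disjoint
    by (metis disjoint_iff)
qed (use ecomp[OF assms(2,3)] in metis)

text \<open>The bridge from the components in the definitions to \<open>lives\<close>: a connected
  set that avoids \<open>S\<close>, and with it \<open>N A\<close>, cannot straddle the border of
  \<open>A\<close>. The set \<open>S\<close> may exceed \<open>N A\<close> because it will be an
  adhesion set.\<close>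

lemma ecomp_subset_iff:
  assumes "\<epsilon> \<in> graph_ends G" "finite S" "N A \<subseteq> S"
  shows "ecomp S \<epsilon> \<subseteq> A \<longleftrightarrow> lives \<epsilon> A"
proof
  assume "lives \<epsilon> A"
  then have "ecomp S \<epsilon> \<inter> A \<noteq> {}" using ecomp assms lives_disjoint by blast
  then show "ecomp S \<epsilon> \<subseteq> A" using conn_dichotomy[of "ecomp S \<epsilon>" A] ecomp_facts[OF assms(1,2)] assms(3) by blast
qed (use ecomp assms lives_mono in blast)

section \<open>The space of vertices and ends\<close>

text \<open>These sets take over the role of the basis of the topology: they are closed under
  intersection, open when \<open>N A\<close> is finite, and small enough to fit around an end in any
  open set.\<close>

definition hat :: "'v set \<Rightarrow> ('v + (nat \<Rightarrow> 'v) set) set" where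
  "hat A = Inl ` A \<union> Inr ` {\<phi> \<in> graph_ends G. lives \<phi> A}"

lemma hat_Int: "hat (A \<inter> B) = hat A \<inter> hat B"
  by (auto simp: hat_def lives_Int)

lemma hat_mono: "A \<subseteq> B \<Longrightarrow> hat A \<subseteq> hat B"
  using hat_Int[of A B] by (simp add: inf.absorb_iff1)

lemma hat_ecomp:
  assumes "\<epsilon> \<in> graph_ends G" "finite S"
  shows "hat (ecomp S \<epsilon>) = Inl ` ecomp S \<epsilon> \<union> Inr ` ends_in_component G S \<epsilon>"
  using ecomp_eq_iff[OF assms(1) _ assms(2)] by (auto simp: hat_def ends_in_component_def)

lemma openin_end_space_vertex: "v \<in> V \<Longrightarrow> openin (end_space G) {Inl v}"
  unfolding end_space_def by (rule topology_generated_by_Basis) auto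

lemma openin_hat_ecomp:
  assumes "\<epsilon> \<in> graph_ends G" "finite S" "S \<subseteq> V" shows "openin (end_space G) (hat (ecomp S \<epsilon>))"
  unfolding end_space_def hat_ecomp[OF assms(1,2)]
  by (rule topology_generated_by_Basis) (use assms in blast)

text \<open>In general this is no basic set, but the basic set given by the separator
  \<open>N A\<close> fits around each end in it, and vertices are isolated.\<close>

lemma openin_hat:
  assumes "finite (N A)" "A \<subseteq> V" shows "openin (end_space G) (hat A)"
proof -
  have "hat A = \<Union> ((\<lambda>v. {Inl v}) ` A \<union> (\<lambda>\<epsilon>. hat (ecomp (N A) \<epsilon>)) ` {\<epsilon> \<in> graph_ends G. lives \<epsilon> A})"
  proof (intro equalityI subsetI)
    fix x assume "x \<in> hat A"
    then show "x \<in> \<Union> ((\<lambda>v. {Inl v}) ` A \<union> (\<lambda>\<epsilon>. hat (ecomp (N A) \<epsilon>)) ` {\<epsilon> \<in> graph_ends G. lives \<epsilon> A})"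
      using ecomp[OF _ assms(1)] by (auto simp: hat_def)
  next
    fix x assume "x \<in> \<Union> ((\<lambda>v. {Inl v}) ` A \<union> (\<lambda>\<epsilon>. hat (ecomp (N A) \<epsilon>)) ` {\<epsilon> \<in> graph_ends G. lives \<epsilon> A})"
    then consider v where "v \<in> A" "x = Inl v" |
      \<epsilon> where "\<epsilon> \<in> graph_ends G" "lives \<epsilon> A" "x \<in> hat (ecomp (N A) \<epsilon>)" by blast
    then show "x \<in> hat A"
    proof cases
      case 2
      then have "ecomp (N A) \<epsilon> \<subseteq> A" using ecomp_subset_iff assms by blast
      then show ?thesis using 2 hat_mono by blast
    qed (auto simp: hat_def)
  qed
  moreover have "openin (end_space G) U"
    if U: "U \<in> (\<lambda>v. {Inl v}) ` A \<union> (\<lambda>\<epsilon>. hat (ecomp (N A) \<epsilon>)) ` {\<epsilon> \<in> graph_ends G. lives \<epsilon> A}" for U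
  proof -
    consider v where "v \<in> A" "U = {Inl v}" | \<epsilon> where "\<epsilon> \<in> graph_ends G" "U = hat (ecomp (N A) \<epsilon>)"
      using U by blast
    then show ?thesis
      using openin_end_space_vertex openin_hat_ecomp[OF _ assms(1) N_verts] assms(2) by cases auto
  qed
  ultimately show ?thesis by (simp only:) (rule openin_Union, blast)
qed

text \<open>Induction over the generation of the topology, using that finite neighbourhoods survive
  intersections of two sets. The last step passes to a component to make the set connected.\<close>

lemma open_contains_hat:
  assumes "openin (end_space G) U" "Inr \<epsilon> \<in> U" "\<epsilon> \<in> graph_ends G"
  shows "\<exists>A. conn A \<and> finite (N A) \<and> lives \<epsilon> A \<and> hat A \<subseteq> U"
proof -
  define \<B> where "\<B> = {{Inl v} | v. v \<in> verts G} \<union>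
      {Inl ` end_component G S \<epsilon> \<union> Inr ` ends_in_component G S \<epsilon> | S \<epsilon>.
         finite S \<and> S \<subseteq> verts G \<and> \<epsilon> \<in> graph_ends G}"
  have "generate_topology_on \<B> U"
    using assms(1) unfolding end_space_def \<B>_def[symmetric] openin_topology_generated_by_iff .
  then have "\<exists>A. A \<subseteq> V \<and> finite (N A) \<and> lives \<epsilon> A \<and> hat A \<subseteq> U" using assms(2)
  proof induction
    case Empty then show ?case by simp
  next
    case (Int U W)
    then obtain A B where AB: "A \<subseteq> V" "finite (N A)" "lives \<epsilon> A" "hat A \<subseteq> U"
      "finite (N B)" "lives \<epsilon> B" "hat B \<subseteq> W" by auto
    have "finite (N (A \<inter> B))" using finite_subset[OF N_Int_subset] AB by blast
    then show ?case using AB hat_Int[of A B] lives_Int[of \<epsilon> A B] by (intro exI[of _ "A \<inter> B"]) blast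
  next
    case (UN K)
    then obtain U where "U \<in> K" "Inr \<epsilon> \<in> U" by blast
    then show ?case using UN.IH[of U] by blast
  next
    case (Basis U)
    then obtain S \<phi> where S: "finite S" "\<phi> \<in> graph_ends G"
      "U = Inl ` end_component G S \<phi> \<union> Inr ` ends_in_component G S \<phi>" by (auto simp: \<B>_def)
    then have "U = hat (ecomp S \<phi>)" using hat_ecomp by simp
    moreover have "finite (N (ecomp S \<phi>))" using ecomp_facts(3) S finite_subset by metis
    ultimately show ?case using ecomp_facts(4)[OF S(2,1)] Basis
      by (intro exI[of _ "ecomp S \<phi>"]) (auto simp: hat_def)
  qed
  then obtain A where A: "A \<subseteq> V" "finite (N A)" "lives \<epsilon> A" "hat A \<subseteq> U" by blast
  obtain K where K: "K \<in> comps A" "lives \<epsilon> K" using lives_comps A assms by metis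
  have "conn K" using K A conn_compsD by blast
  moreover have "finite (N K)" using K A comps_N_adhesion by blast
  moreover have "hat K \<subseteq> U" using hat_mono compsD_subset[OF K(1)] A by blast
  ultimately show ?thesis using K by blast
qed

end


section \<open>Menger's theorem\<close>

context sgraph begin

definition linkage :: "'v set \<Rightarrow> 'v set \<Rightarrow> 'v list set \<Rightarrow> bool" where
  "linkage A B P \<longleftrightarrow> finite P \<and> (\<forall>p\<in>P. AB_path G A B p) \<and> pairwise (\<lambda>p q. set p \<inter> set q = {}) P"

lemma AB_path_ne: "AB_path G A B p \<Longrightarrow> p \<noteq> []"
  by (simp add: AB_path_def graph_path_def)

lemma AB_path_last: "AB_path G A B p \<Longrightarrow> last p \<in> set p \<and> last p \<in> B"
  by (auto simp: AB_path_def)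

lemma linkage_last_inj: assumes "linkage A B P" shows "inj_on last P"
proof (rule inj_onI)
  fix p q assume pq: "p \<in> P" "q \<in> P" "last p = last q"
  then have "last p \<in> set p \<inter> set q" using AB_path_last assms unfolding linkage_def by (metis IntI)
  then show "p = q" using assms pq unfolding linkage_def pairwise_def by blast
qed

lemma linkage_disjoint: "linkage A B P \<Longrightarrow> p \<in> P \<Longrightarrow> q \<in> P \<Longrightarrow> p \<noteq> q \<Longrightarrow> set p \<inter> set q = {}"
  by (simp add: linkage_def pairwise_def)

lemma graph_path_append:
  assumes "graph_path G q" "graph_path G (last q # t)" "set q \<inter> set t = {}"
  shows "graph_path G (q @ t)"
  using assms by (auto simp: graph_path_def successively_append_iff successively_Cons)

text \<open>The paths of \<open>Q\<close> meet \<open>B'\<close> only in their last vertices, so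
  tails inside \<open>B'\<close> can be appended without hitting other paths. In the augmentation
  this leads a linkage to an enlarged target \<open>B'\<close> back to the original target
  \<open>B\<close>.\<close>

lemma linkage_extend:
  assumes Q: "linkage A B' Q"
    and path: "\<And>v. v \<in> last ` Q \<Longrightarrow> graph_path G (v # t v)"
    and B': "\<And>v. v \<in> last ` Q \<Longrightarrow> set (t v) \<subseteq> B'"
    and A: "\<And>v. v \<in> last ` Q \<Longrightarrow> set (t v) \<inter> A = {}"
    and B: "\<And>v. v \<in> last ` Q \<Longrightarrow> set (v # t v) \<inter> B = {last (v # t v)}" "B \<subseteq> B'"
    and disj: "\<And>v w. v \<in> last ` Q \<Longrightarrow> w \<in> last ` Q \<Longrightarrow> v \<noteq> w \<Longrightarrow> set (v # t v) \<inter> set (w # t w) = {}"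
  shows "\<exists>Q'. linkage A B Q' \<and> card Q' = card Q \<and> last ` Q' = (\<lambda>v. last (v # t v)) ` last ` Q"
proof -
  define f where "f q = q @ t (last q)" for q
  have q: "graph_path G q" "set q \<inter> A = {hd q}" "set q \<inter> B' = {last q}" "q \<noteq> []" if "q \<in> Q" for q
    using Q that AB_path_ne[of A B' q] by (auto simp: linkage_def AB_path_def)
  have lastf: "last (f q) = last (last q # t (last q))" if "q \<in> Q" for q
    using q[OF that] by (simp add: f_def)
  have dt: "last q \<notin> set (t (last q))" if "q \<in> Q" for q
    using path[of "last q"] that by (auto simp: graph_path_def)
  have AB: "AB_path G A B (f q)" if qQ: "q \<in> Q" for q
  proof -
    have l: "last q \<in> last ` Q" using qQ by blast
    have "set q \<inter> set (t (last q)) \<subseteq> {last q}" using q(3)[OF qQ] B'[OF l] by blast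
    then have "set q \<inter> set (t (last q)) = {}" using dt[OF qQ] by blast
    then have 1: "graph_path G (f q)" unfolding f_def using graph_path_append q(1)[OF qQ] path[OF l] by blast
    have 2: "set (f q) \<inter> A = {hd (f q)}" using q[OF qQ] A[OF l] by (auto simp: f_def)
    have "set (f q) \<inter> B = set (last q # t (last q)) \<inter> B"
      using q(3,4)[OF qQ] B(2) by (auto simp: f_def)
    then have 3: "set (f q) \<inter> B = {last (f q)}" using B(1)[OF l] lastf[OF qQ] by simp
    show ?thesis using 1 2 3 by (simp add: AB_path_def)
  qed
  have dis: "set (f p) \<inter> set (f q) = {}" if pq: "p \<in> Q" "q \<in> Q" "p \<noteq> q" for p q
  proof -
    have ne: "last p \<noteq> last q" using linkage_last_inj[OF Q] pq by (auto simp: inj_on_def)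
    have "set (last p # t (last p)) \<inter> set (last q # t (last q)) = {}"
      using disj[of "last p" "last q"] pq ne by blast
    moreover have "set p \<inter> set (t (last q)) \<subseteq> {last p}" "set q \<inter> set (t (last p)) \<subseteq> {last q}"
      using q(3) B' pq by blast+
    moreover have "set p \<inter> set q = {}" using linkage_disjoint[OF Q] pq by blast
    ultimately show ?thesis by (auto simp: f_def)
  qed
  have "inj_on f Q"
  proof (rule inj_onI)
    fix p q assume pq: "p \<in> Q" "q \<in> Q" "f p = f q"
    then show "p = q" using dis[of p q] AB_path_ne[OF AB, of p] by (cases "p = q") auto
  qed
  then have "card (f ` Q) = card Q" by (rule card_image)
  moreover have "linkage A B (f ` Q)"
    using Q AB dis unfolding linkage_def pairwise_def by (metis (no_types, lifting) finite_imageI imageE)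
  moreover have "last ` f ` Q = (\<lambda>v. last (v # t v)) ` last ` Q"
    unfolding image_image using lastf by (intro image_cong) auto
  ultimately show ?thesis by blast
qed

lemma graph_path_suffix: "graph_path G (xs @ ys) \<Longrightarrow> ys \<noteq> [] \<Longrightarrow> graph_path G ys"
  by (auto simp: graph_path_def successively_append_iff)

lemma graph_path_prefix: "graph_path G (xs @ ys) \<Longrightarrow> xs \<noteq> [] \<Longrightarrow> graph_path G xs"
  by (auto simp: graph_path_def successively_append_iff)

lemma Int_singleton_subset: "S \<inter> B = {l} \<Longrightarrow> S' \<subseteq> S \<Longrightarrow> l \<in> S' \<Longrightarrow> S' \<inter> B = {l}"
  by blast

lemma Int_singleton_disjoint: "S \<inter> B = {l} \<Longrightarrow> S' \<subseteq> S \<Longrightarrow> l \<notin> S' \<Longrightarrow> S' \<inter> B = {}"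
  by (rule equals0I) (metis IntE IntI singletonD subsetD)

text \<open>The augmentation argument of Boehme, Goering and Harant; it only inducts on the finite
  linkage, so the graph may be infinite.\<close>
lemma linkage_augment:
  assumes "linkage A B P" "A \<subseteq> V" "B \<subseteq> V"
    and "\<And>S. finite S \<Longrightarrow> S \<subseteq> V \<Longrightarrow> card S \<le> card P \<Longrightarrow> \<not> separates G S A B"
  shows "\<exists>Q. linkage A B Q \<and> card Q = Suc (card P) \<and> last ` P \<subseteq> last ` Q"
  using assms
proof (induction "card (\<Union>(set ` P))" arbitrary: B P rule: less_induct)
  case less
  note P = less.prems(1)
  have finP: "finite P" using P by (simp add: linkage_def)
  have AB: "AB_path G A B p" if "p \<in> P" for p using P that by (simp add: linkage_def)
  \<comment> \<open>The last vertices of \<open>P\<close> are too few to separate, so some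
    \<open>A\<close>-\<open>B\<close> path \<open>R\<close> ends at a new vertex of
    \<open>B\<close>.\<close>
  have "\<not> separates G (last ` P) A B"
  proof (rule less.prems(4))
    show "last ` P \<subseteq> V" using AB_path_last[OF AB] less.prems(3) by blast
    show "card (last ` P) \<le> card P" using finP by (rule card_image_le)
  qed (use finP in simp)
  then obtain R where R: "AB_path G A B R" "set R \<inter> last ` P = {}" by (auto simp: separates_def)
  show ?case
  proof (cases "set R \<inter> \<Union>(set ` P) = {}")
    case True
    have "R \<notin> P" using True AB_path_last[OF R(1)] by blast
    moreover have "linkage A B (insert R P)"
      using P R(1) True unfolding linkage_def pairwise_insert by blast
    ultimately show ?thesis using finP by (intro exI[of _ "insert R P"]) auto
  next
    case False
    then obtain R1 x R2 where R12: "R = R1 @ x # R2" "x \<in> \<Union>(set ` P)" "\<forall>y\<in>set R2. y \<notin> \<Union>(set ` P)"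
      using split_list_last_prop[of R "\<lambda>y. y \<in> \<Union>(set ` P)"] by blast
    then obtain p where p: "p \<in> P" "x \<in> set p" by blast
    have xl: "x \<noteq> last p" using R(2) R12(1) p by auto
    obtain p1 p2 where p12: "p = p1 @ x # p2" using p split_list by metis
    have p2: "p2 \<noteq> []" using xl p12 by auto
    have pAB: "graph_path G p" "set p \<inter> A = {hd p}" "set p \<inter> B = {last p}" "distinct p"
      using AB[OF p(1)] by (auto simp: AB_path_def graph_path_def)
    have RAB: "graph_path G R" "set R \<inter> A = {hd R}" "set R \<inter> B = {last R}" "distinct R"
      using R(1) by (auto simp: AB_path_def graph_path_def)
    have Rp: "set R2 \<inter> set q = {}" if "q \<in> P" for q using R12(3) that by blast
    \<comment> \<open>With \<open>x\<close> the last vertex of \<open>R\<close> on a path of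
      \<open>P\<close>, the segments of \<open>p\<close> and \<open>R\<close> from \<open>x\<close>
      on join the target, and \<open>p\<close> is cut off at \<open>x\<close>. The shortened linkage
      covers fewer vertices, so the induction hypothesis applies to it.\<close>
    define B' where "B' = B \<union> set (x # p2) \<union> set (x # R2)"
    define p' where "p' = p1 @ [x]"
    define P' where "P' = insert p' (P - {p})"
    have sp': "set p' \<subset> set p" using p12 p2 pAB(4) by (auto simp: p'_def neq_Nil_conv)
    have p'ne: "p' \<noteq> []" by (simp add: p'_def)
    have xp': "x \<in> set p'" by (simp add: p'_def)
    have dp: "set q \<inter> set p = {}" if "q \<in> P - {p}" for q
      using linkage_disjoint[OF P, of q p] that p by blast
    have p'nP: "p' \<notin> P - {p}" using dp[of p'] xp' p(2) by blast
    have cardP': "card P' = card P" using finP p'nP p(1) unfolding P'_def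
      using card_Suc_Diff1[of P p] by simp
    have lastp: "last p = last p2" "last p \<in> set p2" using p12 p2 by auto
    have lk': "linkage A B' P'" unfolding linkage_def
    proof (intro conjI ballI)
      show "finite P'" using finP by (simp add: P'_def)
      fix q assume q: "q \<in> P'"
      show "AB_path G A B' q"
      proof (cases "q = p'")
        case True
        have "graph_path G p'" using graph_path_prefix[of p' p2] pAB(1) p12 by (simp add: p'_def)
        moreover have "hd p' = hd p" using p12 by (cases p1) (auto simp: p'_def)
        moreover have "set p' \<inter> A = {hd p'}"
          using calculation(2) pAB(2) sp' p'ne hd_in_set[of p'] by auto
        moreover have "set p' \<inter> B' = {last p'}"
        proof -
          have "last p \<notin> set p'" using pAB(4) p12 lastp by (auto simp: p'_def)
          moreover have "set p' \<inter> B \<subseteq> {last p}"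
            using Int_mono[OF psubset_imp_subset[OF sp'] order_refl, of B] pAB(3) by simp
          ultimately have "set p' \<inter> B = {}" by blast
          moreover have "set p1 \<inter> set (x # p2) = {}" using pAB(4) p12 by auto
          moreover have "set p1 \<inter> set R2 = {}" using Rp[OF p(1)] p12 by auto
          ultimately show ?thesis using pAB(4) p12 by (auto simp: B'_def p'_def)
        qed
        ultimately show ?thesis using True by (simp add: AB_path_def)
      next
        case False
        then have q: "q \<in> P - {p}" using q by (simp add: P'_def)
        have "set q \<inter> B' = set q \<inter> B"
          using dp[OF q] Rp[of q] q p(2) p12 by (auto simp: B'_def)
        then show ?thesis using AB[of q] q by (simp add: AB_path_def)
      qed
    next
      show "pairwise (\<lambda>p q. set p \<inter> set q = {}) P'"
        using P dp sp' unfolding P'_def pairwise_insert linkage_def pairwise_def by blast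
    qed
    have smaller: "card (\<Union>(set ` P')) < card (\<Union>(set ` P))"
    proof (rule psubset_card_mono)
      show "finite (\<Union>(set ` P))" using finP by auto
      have "last p \<notin> \<Union>(set ` P')" using dp lastp(2) p12 pAB(4) by (fastforce simp: P'_def p'_def)
      moreover have "last p \<in> \<Union>(set ` P)" using AB_path_last[OF AB[OF p(1)]] p(1) by blast
      moreover have "\<Union>(set ` P') \<subseteq> \<Union>(set ` P)" using sp' p(1) unfolding P'_def by blast
      ultimately show "\<Union>(set ` P') \<subset> \<Union>(set ` P)" by blast
    qed
    have B'V: "B' \<subseteq> V" using less.prems(3) pAB(1) RAB(1) p12 R12(1) by (auto simp: B'_def graph_path_def)
    have "\<exists>Q. linkage A B' Q \<and> card Q = Suc (card P') \<and> last ` P' \<subseteq> last ` Q"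
    proof (rule less.hyps[OF smaller lk' less.prems(2) B'V])
      fix S assume "finite S" "S \<subseteq> V" "card S \<le> card P'"
      then have "\<not> separates G S A B" using less.prems(4) cardP' by simp
      then show "\<not> separates G S A B'" unfolding separates_iff B'_def by blast
    qed
    then obtain Q where Q: "linkage A B' Q" "card Q = Suc (card P)" "last ` P' \<subseteq> last ` Q"
      using cardP' by auto
    have finQ: "finite Q" using Q(1) by (simp add: linkage_def)
    have cl: "card (last ` Q) = Suc (card P)" using card_image[OF linkage_last_inj[OF Q(1)]] Q(2) by simp
    have cl': "card (last ` P') = card P" using card_image[OF linkage_last_inj[OF lk']] cardP' by simp
    have "card (last ` Q - last ` P') = 1" using card_Diff_subset[OF _ Q(3)] finP cl cl' by (simp add: P'_def)
    \<comment> \<open>\<open>Q\<close> retains the last vertices of \<open>P'\<close>, among them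
      \<open>x\<close>, and gains exactly one, which is \<open>y\<close>.\<close>
    then obtain y where y: "last ` Q - last ` P' = {y}" by (auto simp: card_1_singleton_iff)
    have lP': "last ` P' = insert x (last ` (P - {p}))" by (simp add: P'_def p'_def)
    have lQ: "last ` Q = insert y (insert x (last ` (P - {p})))" using y lP' Q(3) by blast
    have yx: "y \<noteq> x" "y \<notin> last ` (P - {p})" using y lP' by auto
    obtain qy where "qy \<in> Q" "y = last qy" using lQ by blast
    then have yB': "y \<in> B'" using Q(1) AB_path_last[of A B' qy] by (simp add: linkage_def)
    have hq: "last q \<in> set q" "last q \<in> B" "last q \<notin> set p" "last q \<notin> set R2" if "q \<in> P - {p}" for q
      using AB_path_last[OF AB, of q] dp[OF that] Rp[of q] that by auto
    have pxp: "graph_path G (x # p2)" using graph_path_suffix[of p1 "x # p2"] pAB(1) p12 by simp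
    have pxR: "graph_path G (x # R2)" using graph_path_suffix[of R1 "x # R2"] RAB(1) R12(1) by simp
    have hdR: "set R2 \<inter> A = {}"
    proof -
      have "hd R \<notin> set R2" using RAB(4) R12(1) by (cases R1) auto
      moreover have "set R2 \<subseteq> set R" using R12(1) by auto
      ultimately show ?thesis using Int_singleton_disjoint[OF RAB(2)] by blast
    qed
    have hdp: "set p2 \<inter> A = {}"
    proof -
      have "hd p \<notin> set p2" using pAB(4) p12 by (cases p1) auto
      moreover have "set p2 \<subseteq> set p" using p12 by auto
      ultimately show ?thesis using Int_singleton_disjoint[OF pAB(2)] by blast
    qed
    have Bp: "set (x # p2) \<inter> B = {last (x # p2)}"
    proof -
      have "last (x # p2) = last p" "last p \<in> set (x # p2)" "set (x # p2) \<subseteq> set p"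
        using lastp p2 p12 by auto
      then show ?thesis using Int_singleton_subset[OF pAB(3)] by simp
    qed
    have BR: "set (x # R2) \<inter> B = {last (x # R2)}"
    proof -
      have "last R = last (x # R2)" using R12(1) by simp
      moreover have "last (x # R2) \<in> set (x # R2)" by (rule last_in_set) simp
      moreover have "set (x # R2) \<subseteq> set R" using R12(1) by auto
      ultimately show ?thesis using Int_singleton_subset[OF RAB(3), of "set (x # R2)"] by simp
    qed
    have x_q: "x \<notin> last ` (P - {p})" using hq p(2) by blast
    have R2p2: "set R2 \<inter> set p2 = {}" using Rp[OF p(1)] p12 by auto
    have dx: "x \<notin> set p2" "x \<notin> set R2" using pAB(4) p12 RAB(4) R12(1) by auto
    \<comment> \<open>Continuations from \<open>x\<close> and \<open>y\<close> into
      \<open>B\<close>. If \<open>y\<close> lies on \<open>p2\<close>, then \<open>y\<close> follows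
      \<open>p\<close> and \<open>x\<close> follows \<open>R2\<close>; if \<open>y\<close> lies on
      \<open>R2\<close>, then \<open>y\<close> follows \<open>R\<close> and \<open>x\<close> follows
      \<open>p2\<close>; otherwise \<open>y\<close> is in \<open>B\<close> already and
      \<open>x\<close> follows \<open>p2\<close>. In each case \<open>last p\<close> is among the
      new last vertices.\<close>
    obtain tx ty where t: "graph_path G (x # tx)" "graph_path G (y # ty)"
      "set tx \<subseteq> B'" "set ty \<subseteq> B'" "set tx \<inter> A = {}" "set ty \<inter> A = {}"
      "set (x # tx) \<inter> B = {last (x # tx)}" "set (y # ty) \<inter> B = {last (y # ty)}"
      "set (x # tx) \<inter> set (y # ty) = {}"
      "set tx \<subseteq> set p2 \<union> set R2" "set ty \<subseteq> set p2 \<union> set R2" 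
      "last p \<in> {last (x # tx), last (y # ty)}"
    proof (cases "y \<in> set p2")
      case True
      then obtain p3 p4 where p34: "p2 = p3 @ y # p4" using split_list by metis
      have "graph_path G (y # p4)" using graph_path_suffix[of "x # p3" "y # p4"] pxp p34 by simp
      moreover have l: "last (y # p4) = last p" using lastp p34 by simp
      moreover have "set (y # p4) \<inter> B = {last (y # p4)}"
      proof -
        have "set (y # p4) \<subseteq> set p" "last (y # p4) \<in> set (y # p4)" using p12 p34 by auto
        then show ?thesis using Int_singleton_subset[OF pAB(3), of "set (y # p4)"] l by simp
      qed
      ultimately show ?thesis
        by (intro that[of R2 p4]) (use pxR hdR hdp BR p34 R2p2 dx in \<open>auto simp: B'_def\<close>)
    next
      case yp2: False
      show ?thesis
      proof (cases "y \<in> set R2")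
        case True
        then obtain R3 R4 where R34: "R2 = R3 @ y # R4" using split_list by metis
        have "graph_path G (y # R4)" using graph_path_suffix[of "x # R3" "y # R4"] pxR R34 by simp
        moreover have l: "last (y # R4) = last R" using R34 R12(1) by simp
        moreover have "set (y # R4) \<inter> B = {last (y # R4)}"
        proof -
          have "set (y # R4) \<subseteq> set R" "last (y # R4) \<in> set (y # R4)" using R34 R12(1) by auto
          then show ?thesis using Int_singleton_subset[OF RAB(3), of "set (y # R4)"] l by simp
        qed
        ultimately show ?thesis
          by (intro that[of p2 R4]) (use pxp hdR hdp Bp R34 R2p2 dx lastp p2 in \<open>auto simp: B'_def\<close>)
      next
        case False
        then have yB: "y \<in> B" using yB' yp2 yx by (auto simp: B'_def)
        then have "graph_path G [y]" using less.prems(3) by (auto simp: graph_path_def)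
        then show ?thesis
          by (intro that[of p2 "[]"]) (use pxp hdp Bp dx lastp p2 yB yp2 yx in \<open>auto simp: B'_def\<close>)
      qed
    qed
    define tl where "tl v = (if v = x then tx else if v = y then ty else [])" for v
    have tls: "tl x = tx" "tl y = ty" "\<And>v. v \<in> last ` (P - {p}) \<Longrightarrow> tl v = []"
      using yx x_q by (auto simp: tl_def)
    obtain K where K: "K = last ` (P - {p})" by blast
    have cs: "v = x \<or> v = y \<or> v \<in> K" if "v \<in> last ` Q" for v using that lQ K by blast
    have tlK: "tl v = []" if "v \<in> K" for v using tls(3) that K by blast
    have hq': "v \<in> B" "v \<notin> set p2" "v \<notin> set R2" "v \<noteq> x" "v \<noteq> y" if "v \<in> K" for v
      using that hq p12 x_q yx K by auto
    have "\<exists>Q'. linkage A B Q' \<and> card Q' = card Q \<and> last ` Q' = (\<lambda>v. last (v # tl v)) ` last ` Q"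
    proof (rule linkage_extend[OF Q(1)])
      fix v assume v: "v \<in> last ` Q"
      have vV: "v \<in> V" if "v \<in> K" using hq'(1)[OF that] less.prems(3) by blast
      show "graph_path G (v # tl v)" using cs[OF v] t(1,2) tls(1,2) tlK vV by (auto simp: graph_path_def)
      show "set (tl v) \<subseteq> B'" using cs[OF v] t(3,4) tls(1,2) tlK by auto
      show "set (tl v) \<inter> A = {}" using cs[OF v] t(5,6) tls(1,2) tlK by auto
      show "set (v # tl v) \<inter> B = {last (v # tl v)}" using cs[OF v] t(7,8) tls(1,2) tlK hq'(1) by auto
      fix w assume w: "w \<in> last ` Q" "v \<noteq> w"
      show "set (v # tl v) \<inter> set (w # tl w) = {}"
        using cs[OF v] cs[OF w(1)] w(2) t(9-11) tls(1,2) tlK hq' by auto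
    qed (auto simp: B'_def)
    then obtain Q' where Q': "linkage A B Q'" "card Q' = card Q" "last ` Q' = (\<lambda>v. last (v # tl v)) ` last ` Q"
      by blast
    have "last q \<in> last ` Q'" if "q \<in> P" for q
    proof (cases "q = p")
      case True then show ?thesis using t(12) tls Q'(3) lQ by auto
    next
      case False
      then have "last q \<in> last ` (P - {p})" using that by blast
      then have "last q \<in> last ` Q" "last (last q # tl (last q)) = last q" using tls(3) lQ by auto
      then show ?thesis unfolding Q'(3) by force
    qed
    then show ?thesis using Q' Q(2) by auto
  qed
qed

text \<open>Graph and sets may be infinite; the finite number \<open>k\<close> of paths is reached
  by augmenting the empty linkage \<open>k\<close> times.\<close>

theorem menger:
  assumes "A \<subseteq> V" "B \<subseteq> V"
    and "\<And>S. finite S \<Longrightarrow> S \<subseteq> V \<Longrightarrow> card S < k \<Longrightarrow> \<not> separates G S A B"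
  shows "\<exists>P. linkage A B P \<and> card P = k"
  using assms(3)
proof (induction k)
  case 0
  show ?case by (intro exI[of _ "{}"]) (simp add: linkage_def pairwise_def)
next
  case (Suc k)
  then obtain P where P: "linkage A B P" "card P = k" by auto
  then show ?case using linkage_augment[OF P(1) assms(1,2)] Suc.prems by auto
qed

end


section \<open>Rooted trees\<close>

text \<open>A rooted tree is given by parent and level functions, and its graph \<open>T\<close> is
  derived from them. The tree order is iteration of \<open>par\<close>, which is total because the
  root is its own parent. The up-closure \<open>up y\<close> is also the side above the edge below
  \<open>y\<close>, by \<open>edge_side_up\<close>.\<close>

locale rtree =
  fixes M :: "'n set" and r :: 'n and par :: "'n \<Rightarrow> 'n" and lev :: "'n \<Rightarrow> nat"
  assumes root_in: "r \<in> M" and par_root: "par r = r" and lev_root: "lev r = 0"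
    and par_step: "\<And>x. x \<in> M \<Longrightarrow> x \<noteq> r \<Longrightarrow> par x \<in> M \<and> lev x = Suc (lev (par x))"
begin

definition up :: "'n \<Rightarrow> 'n set" where "up y = {z \<in> M. \<exists>k. (par ^^ k) z = y}"

lemma par_in: "x \<in> M \<Longrightarrow> par x \<in> M"
  using par_step par_root by (cases "x = r") auto

lemma lev_par: "x \<in> M \<Longrightarrow> lev (par x) = lev x - 1"
  using par_step[of x] par_root lev_root by (cases "x = r") auto

lemma lev_0_iff: "x \<in> M \<Longrightarrow> lev x = 0 \<longleftrightarrow> x = r"
  using par_step[of x] lev_root by (cases "x = r") auto

lemma par_neq: "x \<in> M \<Longrightarrow> x \<noteq> r \<Longrightarrow> par x \<noteq> x"
  using par_step by (metis n_not_Suc_n)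

lemma anc_in: "x \<in> M \<Longrightarrow> (par ^^ k) x \<in> M"
  by (induction k) (auto simp: par_in)

lemma lev_anc: "x \<in> M \<Longrightarrow> lev ((par ^^ k) x) = lev x - k"
  by (induction k) (auto simp: lev_par anc_in)

lemma anc_lev: "x \<in> M \<Longrightarrow> (par ^^ lev x) x = r"
  using lev_0_iff[OF anc_in, of x "lev x"] lev_anc[of x "lev x"] by simp

lemma anc_root: "(par ^^ k) r = r"
  by (induction k) (auto simp: par_root)

lemma up_in: "z \<in> up y \<Longrightarrow> z \<in> M \<and> y \<in> M"
  using anc_in by (auto simp: up_def)

lemma up_subset: "up y \<subseteq> M"
  using up_in by blast

lemma up_self: "y \<in> M \<Longrightarrow> y \<in> up y"
  unfolding up_def by (auto intro: exI[of _ 0])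

lemma up_trans: "z \<in> up y \<Longrightarrow> y \<in> up x \<Longrightarrow> z \<in> up x"
  unfolding up_def
proof clarsimp
  fix k l assume "z \<in> M"
  show "\<exists>m. (par ^^ m) z = (par ^^ l) ((par ^^ k) z)"
    by (rule exI[of _ "l + k"]) (simp add: funpow_add)
qed

lemma up_child: "y \<in> M \<Longrightarrow> y \<in> up (par y)"
  unfolding up_def by (auto intro: exI[of _ 1])

lemma up_mono: "y \<in> up x \<Longrightarrow> up y \<subseteq> up x"
  using up_trans by blast

lemma up_anc: "y \<in> M \<Longrightarrow> y \<in> up ((par ^^ k) y)"
  by (auto simp: up_def)

lemma up_lev: "z \<in> up y \<Longrightarrow> lev y \<le> lev z"
  by (auto simp: up_def lev_anc)

lemma up_root: "up r = M"
proof -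
  have "z \<in> up r" if "z \<in> M" for z
    using that anc_lev by (auto simp: up_def)
  then show ?thesis using up_subset by blast
qed

lemma up_anc_eq: assumes "z \<in> up y" shows "(par ^^ (lev z - lev y)) z = y"
proof -
  obtain k where k: "z \<in> M" "(par ^^ k) z = y" using assms by (auto simp: up_def)
  have ly: "lev y = lev z - k" using lev_anc[OF k(1), of k] k(2) by simp
  show ?thesis
  proof (cases "k \<le> lev z")
    case True then show ?thesis using ly k by simp
  next
    case False
    then have "y = r" using ly lev_0_iff k anc_in by force
    then show ?thesis using anc_lev[OF k(1)] lev_root by simp
  qed
qed

lemma up_eqI: "z \<in> up y \<Longrightarrow> lev z \<le> lev y \<Longrightarrow> z = y"
  using up_anc_eq[of z y] by simp

text \<open>Both nodes are iterates of \<open>par\<close> at \<open>z\<close>, so they are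
  comparable, and their levels tell which is the lower one.\<close>

lemma up_linear: assumes "z \<in> up x" "z \<in> up y" "lev x \<le> lev y" shows "y \<in> up x"
proof -
  have "lev z - lev x = (lev y - lev x) + (lev z - lev y)" using assms up_lev[of z y] by simp
  then have "(par ^^ (lev y - lev x)) y = x"
    using up_anc_eq[OF assms(1)] up_anc_eq[OF assms(2)] by (simp add: funpow_add)
  then show ?thesis using up_in[OF assms(2)] by (auto simp: up_def)
qed

lemma up_disjoint: "z \<in> up x \<Longrightarrow> z \<in> up y \<Longrightarrow> lev x = lev y \<Longrightarrow> x = y"
  using up_linear[of z x y] up_eqI[of y x] by simp

lemma up_par: assumes "z \<in> up y" "z \<noteq> y" shows "par z \<in> up y" "z \<noteq> r"
proof -
  obtain k where k: "z \<in> M" "(par ^^ k) z = y" using assms by (auto simp: up_def)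
  then obtain j where "k = Suc j" using assms(2) by (cases k) auto
  then have "(par ^^ j) (par z) = y" using k by (simp add: funpow_swap1)
  then show "par z \<in> up y" using k par_in by (auto simp: up_def)
  show "z \<noteq> r" using k anc_root assms(2) by auto
qed

lemma up_antisym: "y \<in> up x \<Longrightarrow> x \<in> up y \<Longrightarrow> x = y"
  using up_eqI[of y x] up_lev[of x y] by simp

lemma par_notin_up: "x \<in> M \<Longrightarrow> x \<noteq> r \<Longrightarrow> par x \<notin> up x"
  using up_lev[of "par x" x] par_step[of x] by auto

lemma root_notin_up: "x \<in> M \<Longrightarrow> x \<noteq> r \<Longrightarrow> r \<notin> up x"
  using up_lev[of r x] lev_root lev_0_iff by auto

lemma up_to_child:
  assumes "z \<in> up y" "z \<noteq> y"
  obtains x where "x \<in> M" "x \<noteq> r" "par x = y" "z \<in> up x"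
proof -
  define k where "k = lev z - lev y"
  have zM: "z \<in> M" using assms up_in by blast
  have "k \<noteq> 0" using up_eqI[OF assms(1)] assms(2) by (auto simp: k_def)
  then obtain j where j: "k = Suc j" by (cases k) auto
  define x where "x = (par ^^ j) z"
  have 1: "par x = y" using up_anc_eq[OF assms(1)] j by (simp add: x_def k_def)
  have 2: "z \<in> up x" unfolding x_def using up_anc zM by blast
  have "lev x = Suc (lev y)" using lev_anc[OF zM, of j] j by (simp add: x_def k_def)
  then have "x \<noteq> r" using lev_root by auto
  then show ?thesis using that[of x] 1 2 up_in by blast
qed

lemma level_induct [consumes 1, case_names root step]:
  assumes "x \<in> M" "P r" "\<And>x. x \<in> M \<Longrightarrow> x \<noteq> r \<Longrightarrow> P (par x) \<Longrightarrow> P x" shows "P x"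
  using assms(1)
proof (induction "lev x" arbitrary: x)
  case 0 then show ?case using lev_0_iff assms(2) by metis
next
  case (Suc n)
  then have "x \<noteq> r" using lev_root by auto
  then show ?case using Suc assms(3)[of x] par_step[of x] by auto
qed

lemma up_induct [consumes 1, case_names base step]:
  assumes "z \<in> up y" "P y" "\<And>x. x \<in> up y \<Longrightarrow> x \<noteq> y \<Longrightarrow> P (par x) \<Longrightarrow> P x" shows "P z"
proof -
  have "z \<in> M" using assms up_in by blast
  then have "z \<in> up y \<longrightarrow> P z"
  proof (induction rule: level_induct)
    case root
    then show ?case using assms(2) up_par(2)[of r y] by blast
  next
    case (step x)
    then show ?case using assms(2,3) up_par(1)[of x y] by blast
  qed
  then show ?thesis using assms by blast
qed

section \<open>The graph of a rooted tree\<close>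

definition T :: "'n graph" where
  "T = \<lparr>verts = M, edges = {{x, par x} | x. x \<in> M \<and> x \<noteq> r}\<rparr>"

lemma verts_T [simp]: "verts T = M" by (simp add: T_def)

lemma edges_T: "e \<in> edges T \<longleftrightarrow> (\<exists>x\<in>M - {r}. e = {x, par x})"
  by (auto simp: T_def)

lemma simple_T: "simple_graph T"
  unfolding simple_graph_def edges_T using par_in par_neq by (fastforce simp: T_def)

sublocale T: sgraph T
  by unfold_locales (rule simple_T)

lemma T_adj: "T.adj u v \<longleftrightarrow> (u \<in> M - {r} \<and> v = par u) \<or> (v \<in> M - {r} \<and> u = par v)"
  unfolding T.adj_def edges_T by (auto simp: doubleton_eq_iff)

lemma T_adj_par: "x \<in> M \<Longrightarrow> x \<noteq> r \<Longrightarrow> T.adj (par x) x"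
  by (auto simp: T_adj)

lemma crossing:
  assumes "T.adj u v" "u \<in> up x" "v \<notin> up x" shows "u = x \<and> v = par x \<and> x \<noteq> r"
proof -
  consider "u \<in> M - {r}" "v = par u" | "v \<in> M - {r}" "u = par v" using assms T_adj by blast
  then show ?thesis
  proof cases
    case 1
    then have "u = x" using assms up_par(1)[of u x] by blast
    then show ?thesis using 1 by auto
  next
    case 2
    then have "v \<in> up x" using assms up_child up_trans by blast
    then show ?thesis using assms by blast
  qed
qed

lemma N_up: assumes "x \<in> M" "x \<noteq> r" shows "T.N (up x) = {par x}"
proof
  show "T.N (up x) \<subseteq> {par x}"
  proof
    fix v assume "v \<in> T.N (up x)"
    then obtain u where "v \<notin> up x" "u \<in> up x" "T.adj u v" unfolding T.N_iff by blast
    then show "v \<in> {par x}" using crossing[of u v x] by blast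
  qed
  show "{par x} \<subseteq> T.N (up x)"
    using T.in_N[of x "up x" "par x"] up_self assms par_notin_up T_adj_par T.adj_sym by blast
qed

lemma N_down: "T.N (M - up y) \<subseteq> {y}"
proof
  fix z assume "z \<in> T.N (M - up y)"
  then obtain u where u: "z \<notin> M - up y" "u \<in> M - up y" "T.adj u z" unfolding T.N_iff by blast
  then have "z \<in> up y" using T.adj_verts by auto
  then show "z \<in> {y}" using crossing[of z u y] u T.adj_sym by blast
qed

lemma N_up_finite: "x \<in> M \<Longrightarrow> finite (T.N (up x))"
proof (cases "x = r")
  case True
  then have "T.N (up x) = {}" using T.N_verts[of "up x"] T.N_Int_self(1)[of "up x"] up_root by auto
  then show ?thesis by simp
qed (simp add: N_up)

end

text \<open>Stated for any graph that contains the parent edges, since it serves search trees inside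
  \<open>G\<close> as well as decomposition trees. Asking only for the nodes between
  \<open>y\<close> and \<open>z\<close> in \<open>Z\<close> yields the connectedness of
  \<open>up y\<close> and of the intervals of the tree order alike.\<close>

lemma (in sgraph) rtree_up_reach:
  assumes "rtree M r par lev" "M \<subseteq> V" "\<And>x. x \<in> M \<Longrightarrow> x \<noteq> r \<Longrightarrow> adj (par x) x"
    and "z \<in> rtree.up M par y" "\<And>x. x \<in> rtree.up M par y \<Longrightarrow> z \<in> rtree.up M par x \<Longrightarrow> x \<in> Z"
  shows "reach Z y z"
proof -
  interpret rtree M r par lev by fact
  define W where "W = {x \<in> up y. z \<in> up x}"
  have "x \<in> up y \<Longrightarrow> z \<in> up x \<longrightarrow> reach W y x" for x
  proof (induction rule: up_induct)
    case base
    show ?case using assms(4) up_self up_in reach_refl by (auto simp: W_def)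
  next
    case (step x)
    show ?case
    proof
      assume zx: "z \<in> up x"
      have x: "x \<in> M" "x \<noteq> r" using step up_in up_par(2) by blast+
      have "reach W y (par x)" using step zx up_trans up_child x by blast
      then show "reach W y x" using reach_step assms(3)[OF x] step zx by (auto simp: W_def)
    qed
  qed
  then have "reach W y z" using assms(4) up_self up_in by blast
  then show ?thesis using reach_mono[of W y z Z] assms(5) by (auto simp: W_def)
qed

lemma (in sgraph) rtree_conn_up:
  assumes "rtree M r par lev" "M \<subseteq> V" "\<And>x. x \<in> M \<Longrightarrow> x \<noteq> r \<Longrightarrow> adj (par x) x" "y \<in> M"
  shows "conn (rtree.up M par y)"
proof -
  interpret rtree M r par lev by fact
  show ?thesis
    using connI_from[of "up y" y] rtree_up_reach[OF assms(1-3)] up_subset assms(2,4) up_self by blast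
qed

text \<open>The level is the distance from \<open>c\<close> inside \<open>C\<close>, expressed by
  powers of the step relation; a parent is the last but one vertex of a shortest walk.\<close>

lemma (in sgraph) bfs_tree:
  assumes "conn C" "c \<in> C"
  shows "\<exists>par lev. rtree C c par lev \<and> (\<forall>x\<in>C - {c}. adj (par x) x)"
proof -
  define E where "E = (\<lambda>a b. b \<in> C \<and> adj a b)"
  define lev where "lev x = (LEAST n. (E ^^ n) c x)" for x
  have ex: "\<exists>n. (E ^^ n) c x" if "x \<in> C" for x
    using connD[OF assms that] unfolding reach_def E_def[symmetric] by (simp add: rtranclp_power)
  have lev: "(E ^^ lev x) c x" if "x \<in> C" for x
    unfolding lev_def using ex[OF that] by (rule LeastI_ex)
  have le: "lev x \<le> n" if "(E ^^ n) c x" for x n unfolding lev_def using that by (rule Least_le)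
  have "\<exists>y. y \<in> C \<and> adj y x \<and> lev x = Suc (lev y)" if x: "x \<in> C" "x \<noteq> c" for x
  proof -
    have "lev x \<noteq> 0" using lev[OF x(1)] x(2) by (metis relpowp_0_E)
    then obtain n where n: "lev x = Suc n" by (cases "lev x") auto
    then obtain y where y: "(E ^^ n) c y" "E y x" using lev[OF x(1)] by (auto elim: relpowp_Suc_E)
    have yC: "y \<in> C"
    proof (cases n)
      case 0 then show ?thesis using y assms by simp
    next
      case (Suc m) then show ?thesis using y by (auto elim!: relpowp_Suc_E simp: E_def)
    qed
    have "lev x \<le> Suc (lev y)" using le[of "Suc (lev y)" x] lev[OF yC] y(2) by auto
    then show ?thesis using y yC le[OF y(1)] n by (auto simp: E_def)
  qed
  then obtain p where p: "\<And>x. x \<in> C \<Longrightarrow> x \<noteq> c \<Longrightarrow> p x \<in> C \<and> adj (p x) x \<and> lev x = Suc (lev (p x))"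
    by metis
  have "lev c = 0" using le[of 0 c] by simp
  then have "rtree C c (\<lambda>x. if x = c then c else p x) lev"
    by unfold_locales (use assms p in auto)
  then show ?thesis using p by (intro exI[of _ "\<lambda>x. if x = c then c else p x"] exI[of _ lev]) auto
qed

lemma sgraph_connected_iff: "simple_graph G \<Longrightarrow> connected_graph G \<longleftrightarrow> sgraph.conn G (verts G)"
proof -
  assume "simple_graph G"
  then interpret sgraph G by unfold_locales
  show ?thesis by (auto simp: connected_graph_def conn_def joined_iff)
qed

text \<open>A spanning search tree of \<open>T\<close> is all of \<open>T\<close>: a missing edge
  would close a cycle with the tree path between its ends, and this path has at least three vertices
  because the edge is not in the search tree.\<close>

lemma tree_is_rtree:
  assumes "tree T" "r \<in> verts T"
  shows "\<exists>par lev. rtree (verts T) r par lev \<and> T = rtree.T (verts T) r par"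
proof -
  interpret sgraph T using assms by unfold_locales (simp add: tree_def)
  have "conn V" using assms(1) sgraph_connected_iff[OF simple] by (simp add: tree_def)
  then obtain par lev where *: "rtree V r par lev" "\<And>x. x \<in> V - {r} \<Longrightarrow> adj (par x) x"
    using bfs_tree assms(2) by blast
  interpret R: rtree V r par lev by fact
  have sub: "e \<in> edges T" if "e \<in> edges R.T" for e
    using that *(2) adj_sym unfolding R.edges_T adj_def by (metis insert_commute)
  have "e \<in> edges R.T" if e: "e \<in> edges T" for e
  proof (rule ccontr)
    assume ne: "e \<notin> edges R.T"
    obtain u v where uv: "e = {u, v}" "u \<in> V" "v \<in> V" "u \<noteq> v"
      using e simple unfolding simple_graph_def by blast
    have "R.T.conn V" using R.T.rtree_conn_up[OF R.rtree_axioms _ _ R.root_in] R.T_adj_par R.up_root by simp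
    then have "R.T.reach V u v" using R.T.connD uv by blast
    then obtain p where p: "graph_path R.T p" "hd p = u" "last p = v"
      using R.T.reach_path[of V u v] by auto
    have suc: "successively (\<lambda>u v. {u, v} \<in> edges R.T) p" "p \<noteq> []" using p(1) by (auto simp: graph_path_def)
    have "successively (\<lambda>u v. {u, v} \<in> edges T) p"
      using suc(1) by (rule successively_mono) (use sub in auto)
    then have "graph_path T p" using p(1) by (simp add: graph_path_def)
    moreover have "{last p, hd p} \<in> edges T" using e uv p by (simp add: insert_commute)
    moreover have "length p \<ge> 3"
    proof (rule ccontr)
      assume "\<not> length p \<ge> 3"
      moreover have "length p \<noteq> 0" using suc(2) by simp
      ultimately have "length p = 1 \<or> length p = 2" by linarith
      then show False
      proof
        assume "length p = 1"
        then show False using p uv by (cases p) auto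
      next
        assume "length p = 2"
        then have "p = [u, v]" using p
          by (cases p; cases "tl p") auto
        then show False using suc ne uv by simp
      qed
    qed
    ultimately show False using assms(1) unfolding tree_def by blast
  qed
  then have "edges T = edges R.T" using sub by blast
  then have "T = R.T" by simp
  then show ?thesis using *(1) by blast
qed

context rtree begin

lemma path_crosses:
  assumes "graph_path T p" "u \<in> set p" "v \<in> set p" "u \<in> up x" "v \<notin> up x"
  shows "x \<in> set p \<and> par x \<in> set p \<and> {x, par x} \<in> path_edges p \<and> x \<noteq> r"
proof -
  have "\<exists>i. Suc i < length p \<and> (p ! i \<in> up x) \<noteq> (p ! Suc i \<in> up x)"
  proof (rule ccontr)
    assume c: "\<not> ?thesis"
    have "i < length p \<Longrightarrow> (p ! i \<in> up x) = (p ! 0 \<in> up x)" for i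
      by (induction i) (use c in auto)
    then show False using assms by (metis in_set_conv_nth)
  qed
  then obtain i where i: "Suc i < length p" "(p ! i \<in> up x) \<noteq> (p ! Suc i \<in> up x)" by blast
  have "T.adj (p ! i) (p ! Suc i)"
    using assms(1) successively_nth[OF _ i(1)] by (auto simp: graph_path_def T.adj_def)
  then have "{p ! i, p ! Suc i} = {x, par x} \<and> x \<noteq> r"
    using crossing[of "p ! i" "p ! Suc i" x] crossing[of "p ! Suc i" "p ! i" x] i(2) T.adj_sym
    by (cases "p ! i \<in> up x") auto
  moreover have "{p ! i, p ! Suc i} \<in> path_edges p" using i by (auto simp: path_edges_def)
  moreover have "{p ! i, p ! Suc i} \<subseteq> set p" using i by auto
  ultimately show ?thesis by auto
qed

text \<open>By \<open>path_crosses\<close>, a path joining the ends of the edge from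
  \<open>x\<close> to \<open>par x\<close> traverses that very edge. If these ends are its first and
  last vertex, they are consecutive and the path has only two vertices.\<close>

lemma tree_T: "tree T"
  unfolding tree_def
proof (intro conjI notI)
  show "simple_graph T" by (rule simple_T)
  have "T.conn M" using T.rtree_conn_up[OF rtree_axioms _ _ root_in] T_adj_par up_root by simp
  then show "connected_graph T" using sgraph_connected_iff simple_T by force
  assume "\<exists>p. graph_path T p \<and> 3 \<le> length p \<and> {last p, hd p} \<in> edges T"
  then obtain p x where p: "graph_path T p" "3 \<le> length p" and x: "x \<in> M" "x \<noteq> r" "{last p, hd p} = {x, par x}"
    unfolding edges_T by blast
  have pne: "p \<noteq> []" "distinct p" using p by (auto simp: graph_path_def)
  have in_p: "x \<in> set p" "par x \<in> set p"
    using x(3) hd_in_set[OF pne(1)] last_in_set[OF pne(1)] unfolding doubleton_eq_iff by metis+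
  have "{x, par x} \<in> path_edges p"
    using path_crosses[OF p(1) in_p] up_self par_notin_up x by blast
  then obtain i where i: "Suc i < length p" "{last p, hd p} = {p ! i, p ! Suc i}"
    using x by (auto simp: path_edges_def)
  have "last p = p ! (length p - 1)" "hd p = p ! 0" using pne by (auto simp: last_conv_nth hd_conv_nth)
  then have "(length p - 1 = i \<and> 0 = Suc i) \<or> (length p - 1 = Suc i \<and> 0 = i)"
    using i pne p(2) nth_eq_iff_index_eq[OF pne(2)] unfolding doubleton_eq_iff
    by (metis (no_types, lifting) Suc_lessD Suc_pred diff_less length_greater_0_conv less_Suc_eq zero_less_one)
  then show False using p(2) i by auto
qed

lemma edge_side_up:
  assumes "x \<in> M" "x \<noteq> r"
  shows "edge_side T (par x) x = up x" "edge_side T x (par x) = M - up x"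
proof -
  define H where "H = delete_edge T {x, par x}"
  have simple_H: "simple_graph H" using simple_T by (auto simp: H_def simple_graph_def delete_edge_def)
  interpret H: sgraph H by unfold_locales (rule simple_H)
  have vH: "verts H = M" by (simp add: H_def delete_edge_def)
  have adjH: "H.adj u v \<longleftrightarrow> T.adj u v \<and> {u, v} \<noteq> {x, par x}" for u v
    unfolding H.adj_def T.adj_def by (simp add: H_def delete_edge_def)
  have NH: "H.N (up x) = {}"
  proof (rule ccontr)
    assume "H.N (up x) \<noteq> {}"
    then obtain u v where "v \<notin> up x" "u \<in> up x" "H.adj u v" using H.N_iff by (metis ex_in_conv)
    then show False using crossing[of u v x] adjH by auto
  qed
  have c: "component_of H v = {u. H.reach M v u}" for v
    by (simp add: component_of_def H.joined_iff vH)
  have up_reach: "H.reach M x z" if z: "z \<in> up x" for z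
    using z
  proof (induction rule: up_induct)
    case base then show ?case using assms by (simp add: H.reach_refl)
  next
    case (step y)
    then have "T.adj (par y) y" using T_adj_par up_par(2) up_in by blast
    moreover have "par y \<in> up x" using step up_par by blast
    then have "{par y, y} \<noteq> {x, par x}"
      using step par_notin_up[OF assms] by (auto simp: doubleton_eq_iff)
    ultimately show ?case using step H.reach_step[of M x "par y" y] adjH up_in by blast
  qed
  have "z \<in> up x" if "H.reach M x z" for z
    using H.reach_avoiding_N[OF that, of "up x"] NH up_self assms by simp
  then show "edge_side T (par x) x = up x"
    using up_reach unfolding edge_side_def by (auto simp: c H_def[symmetric] insert_commute)
  have down: "z \<notin> up x \<longrightarrow> H.reach M r z" if "z \<in> M" for z
    using that
  proof (induction rule: level_induct)
    case root then show ?case using root_in by (simp add: H.reach_refl)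
  next
    case (step y)
    show ?case
    proof
      assume y: "y \<notin> up x"
      then have py: "par y \<notin> up x \<or> y = x" using up_trans[of y "par y" x] up_child step by blast
      have "y \<noteq> x" using y up_self assms by blast
      moreover then have "{par y, y} \<noteq> {x, par x}" using y par_notin_up[OF assms] step py
          up_self[OF assms(1)] by (auto simp: doubleton_eq_iff)
      ultimately show "H.reach M r y"
        using H.reach_step[of M r "par y" y] T_adj_par step py adjH by blast
    qed
  qed
  have "z \<notin> up x" if "H.reach M (par x) z" for z
    using H.reach_avoiding_N[OF H.reach_sym[OF that], of "up x"] NH par_notin_up assms by auto
  moreover have "H.reach M (par x) z" if "z \<in> M - up x" for z
    using down[of z] down[of "par x"] that par_notin_up assms par_in H.reach_sym H.reach_trans by blast
  ultimately show "edge_side T x (par x) = M - up x"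
    using H.reach_in unfolding edge_side_def by (auto simp: c H_def[symmetric])
qed

section \<open>Intervals of the tree order and minimal paths\<close>

definition seg :: "'n \<Rightarrow> 'n \<Rightarrow> 'n set" where "seg x y = {z \<in> up x. y \<in> up z}"

lemma reach_seg: assumes "y \<in> up x" shows "T.reach (seg x y) x y"
  by (rule T.rtree_up_reach[OF rtree_axioms]) (use assms T_adj_par in \<open>auto simp: seg_def\<close>)

lemma seg_ends: "y \<in> up x \<Longrightarrow> x \<in> seg x y \<and> y \<in> seg x y"
  using up_in up_self by (auto simp: seg_def)

lemma minimal_path_root:
  assumes "minimal_path T {r} Y p" "y \<in> Y" "y \<in> M" "Y \<subseteq> seg r y"
  shows "set p = seg r y"
proof -
  have p: "graph_path T p" "r \<in> set p" "y \<in> set p" using assms by (auto simp: minimal_path_def)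
  have sub: "seg r y \<subseteq> set q" if q: "graph_path T q" "r \<in> set q" "y \<in> set q" for q
  proof
    fix z assume z: "z \<in> seg r y"
    then have "z \<in> M" "y \<in> up z" using up_in by (auto simp: seg_def)
    then show "z \<in> set q" using q path_crosses[OF q(1), of y r z] root_notin_up[of z] by blast
  qed
  have "y \<in> up r" using assms up_root by simp
  then obtain q where q: "graph_path T q" "hd q = r" "last q = y" "set q \<subseteq> seg r y"
    using T.reach_path[OF reach_seg[of y r]] up_subset by (auto simp: seg_def)
  have "r \<in> set q" "y \<in> set q" using q by (auto simp: graph_path_def)
  then have "set q = seg r y" using sub q by blast
  then show ?thesis using assms sub[OF p] q(1) seg_ends[OF \<open>y \<in> up r\<close>]
    unfolding minimal_path_def by (metis Un_subset_iff empty_subsetI insert_subset psubsetI)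
qed

lemma tree_less_node:
  assumes "{x, y} \<in> edges T" "tree_less T r {x} {y}" shows "y \<in> M" "y \<noteq> r" "x = par y"
proof -
  have xy: "(x \<in> M - {r} \<and> y = par x) \<or> (y \<in> M - {r} \<and> x = par y)"
    using assms(1) T_adj by (auto simp: T.adj_def)
  obtain p where p: "minimal_path T {r} {y} p" "x \<in> set p"
    using assms(2) by (auto simp: tree_less_def tree_le_def)
  have yM: "y \<in> M" using xy par_in by blast
  have "set p = seg r y" using minimal_path_root[OF p(1) _ yM] seg_ends[of y r] yM up_root by auto
  then have "y \<in> up x" using p by (auto simp: seg_def)
  then have "\<not> (x \<in> M - {r} \<and> y = par x)" using par_notin_up by blast
  then show "y \<in> M" "y \<noteq> r" "x = par y" using xy by auto
qed

lemma tree_less_edge: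
  assumes "x \<in> M" "x \<noteq> r" "y \<in> M" "y \<noteq> r" "tree_less T r {x, par x} {y, par y}"
  shows "y \<in> up x" "x \<noteq> y"
proof -
  obtain p where p: "minimal_path T {r} {y, par y} p" "x \<in> set p"
    using assms(5) by (auto simp: tree_less_def tree_le_def)
  have "{y, par y} \<subseteq> seg r y" using up_root assms up_self up_child par_in by (auto simp: seg_def)
  then have "set p = seg r y" using minimal_path_root[OF p(1) _ assms(3)] by blast
  then show "y \<in> up x" using p by (auto simp: seg_def)
  show "x \<noteq> y" using assms(5) by (auto simp: tree_less_def)
qed

text \<open>The minimal path climbs from \<open>par x\<close> through the interval to
  \<open>y\<close>, so its edges are those below the nodes of the interval. Linkedness thereby
  becomes a statement about nodes.\<close>

lemma minimal_path_edges:
  assumes "x \<in> M" "x \<noteq> r" "y \<in> up x" "minimal_path T {x, par x} {y, par y} p"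
  shows "path_edges p = (\<lambda>z. {z, par z}) ` seg x y"
proof -
  have yM: "y \<in> M" "y \<noteq> r" using up_in assms up_par(2) by (blast, metis)
  have p: "graph_path T p" "x \<in> set p" "par x \<in> set p" "y \<in> set p" using assms by (auto simp: minimal_path_def)
  have sub: "z \<in> set q \<and> {z, par z} \<in> path_edges q"
    if q: "graph_path T q" "par x \<in> set q" "y \<in> set q" and z: "z \<in> seg x y" for q z
  proof -
    have "par x \<notin> up z" using z par_notin_up[OF assms(1,2)] up_mono[of z x] by (auto simp: seg_def)
    then show ?thesis using path_crosses[OF q(1) q(3,2)] z by (auto simp: seg_def)
  qed
  have "T.reach (insert (par x) (seg x y)) (par x) x"
    using T.reach_step[OF T.reach_refl, of "par x" _ x] T_adj_par[OF assms(1,2)] seg_ends[OF assms(3)] by blast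
  then have "T.reach (insert (par x) (seg x y)) (par x) y"
    using T.reach_trans T.reach_mono[OF reach_seg[OF assms(3)]] by blast
  then obtain q where q: "graph_path T q" "hd q = par x" "last q = y" "set q \<subseteq> insert (par x) (seg x y)"
    using T.reach_path[of "insert (par x) (seg x y)" "par x" y] up_subset par_in assms(1)
    by (auto simp: seg_def)
  have qin: "par x \<in> set q" "y \<in> set q" using q hd_in_set[of q] last_in_set[of q] by (auto simp: graph_path_def)
  have setq: "set q = insert (par x) (seg x y)" using sub[OF q(1) qin] q(4) qin by blast
  have pary: "par y \<in> insert (par x) (seg x y)"
    using assms(3) up_par(1)[of y x] up_child yM by (cases "y = x") (auto simp: seg_def)
  have setp: "set p = insert (par x) (seg x y)"
  proof (rule ccontr)
    assume "set p \<noteq> insert (par x) (seg x y)"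
    moreover have "insert (par x) (seg x y) \<subseteq> set p" using sub[OF p(1,3,4)] p(3) by auto
    ultimately have "set q \<subset> set p" using setq by auto
    moreover have "{x, par x} \<union> {y, par y} \<subseteq> set q" using setq pary seg_ends[OF assms(3)] by auto
    ultimately show False using assms(4) q(1) unfolding minimal_path_def by blast
  qed
  show ?thesis
  proof
    show "(\<lambda>z. {z, par z}) ` seg x y \<subseteq> path_edges p" using sub[OF p(1,3,4)] by blast
    show "path_edges p \<subseteq> (\<lambda>z. {z, par z}) ` seg x y"
    proof
      fix e assume "e \<in> path_edges p"
      then obtain i where i: "Suc i < length p" "e = {p ! i, p ! Suc i}" by (auto simp: path_edges_def)
      have "e \<in> edges T" using p(1) successively_nth[OF _ i(1)] i(2) by (auto simp: graph_path_def)
      then obtain z where z: "z \<in> M" "z \<noteq> r" "e = {z, par z}" unfolding edges_T by blast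
      have zp: "z \<in> set p" "par z \<in> set p" using i z by (auto simp: doubleton_eq_iff)
      \<comment> \<open>\<open>par x\<close> is the lowest node of the path, so its own parent
        cannot lie on it.\<close>
      have "z \<noteq> par x"
      proof
        assume "z = par x"
        then have "lev (par z) < lev (par x)" using par_step z by auto
        moreover have "lev (par x) \<le> lev w" if "w \<in> set p" for w
          using that setp up_lev[of w x] lev_par[OF assms(1)] by (auto simp: seg_def)
        ultimately show False using zp by force
      qed
      then show "e \<in> (\<lambda>z. {z, par z}) ` seg x y" using zp setp z by auto
    qed
  qed
qed

section \<open>Ends of rooted trees\<close>

text \<open>A ray of the end leaves \<open>y\<close> for good, and the subtree above a child of
  \<open>y\<close> is attached at \<open>y\<close> only; so a tail stays above one child.\<close>

lemma T_end_level:
  assumes "\<omega> \<in> graph_ends T" shows "\<exists>y\<in>M. lev y = n \<and> T.lives \<omega> (up y)"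
proof (induction n)
  case 0
  show ?case using root_in lev_root up_root T.lives_verts[OF assms] by auto
next
  case (Suc n)
  then obtain y where y: "y \<in> M" "lev y = n" "T.lives \<omega> (up y)" by blast
  define R where "R = T.rep \<omega>"
  have R: "ray T R" using T.rep_ray assms by (simp add: R_def)
  have "T.ev R (up y - {y})"
    using y(3) T.lives_Diff_finite[OF assms, of "{y}" "up y"] unfolding T.lives_def R_def by simp
  then obtain m where m: "\<And>k. k \<ge> m \<Longrightarrow> R k \<in> up y - {y}" by (auto simp: eventually_sequentially)
  obtain x where x: "x \<in> M" "x \<noteq> r" "par x = y" "R m \<in> up x"
    using up_to_child[of "R m" y] m[of m] by auto
  have "R k \<in> up x" if "k \<ge> m" for k
    using T.ray_stays[OF R x(4) _ that] N_up[OF x(1,2)] m x(3) by auto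
  then have "T.lives \<omega> (up x)" unfolding T.lives_def R_def[symmetric] by (auto simp: eventually_sequentially)
  moreover have "lev x = Suc n" using par_step x y by auto
  ultimately show ?case using x by blast
qed

text \<open>Subtrees of high level are connected and avoid a given finite set, so that set does not
  separate two ends that live in the same subtrees.\<close>

lemma T_ends_eqI:
  assumes "\<omega> \<in> graph_ends T" "\<omega>' \<in> graph_ends T"
    and "\<And>y. y \<in> M \<Longrightarrow> T.lives \<omega> (up y) \<Longrightarrow> T.lives \<omega>' (up y)"
  shows "\<omega> = \<omega>'"
proof (rule T.ends_eqI[OF assms(1,2)])
  fix S :: "'n set" assume "finite S"
  then obtain n where n: "\<And>s. s \<in> S \<Longrightarrow> lev s < n"
    by (metis finite_imageI finite_nat_set_iff_bounded imageI)
  obtain y where y: "y \<in> M" "lev y = n" "T.lives \<omega> (up y)" using T_end_level assms by blast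
  have "up y \<inter> S = {}" using n up_lev y by fastforce
  moreover have "T.conn (up y)" using T.rtree_conn_up[OF rtree_axioms _ _ y(1)] T_adj_par by simp
  ultimately show "\<exists>A. T.conn A \<and> A \<inter> S = {} \<and> T.lives \<omega> A \<and> T.lives \<omega>' A"
    using y assms(3) by blast
qed

lemma T_end_of_branch:
  assumes "\<And>n. y n \<in> M" "\<And>n. lev (y n) = n" "\<And>n. par (y (Suc n)) = y n"
  shows "\<exists>\<omega>\<in>graph_ends T. \<forall>n. T.lives \<omega> (up (y n))"
proof -
  have "inj y" by (rule injI) (metis assms(2))
  moreover have "{y n, y (Suc n)} \<in> edges T" for n
  proof -
    have "y (Suc n) \<noteq> r" using assms(2)[of "Suc n"] lev_root by auto
    then show ?thesis using T_adj_par[of "y (Suc n)"] assms by (simp add: T.adj_def)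
  qed
  ultimately have "ray T y" using assms(1) by (auto simp: ray_def)
  then obtain \<omega> where \<omega>: "\<omega> \<in> graph_ends T" "y \<in> \<omega>" using T.end_of_ray by blast
  have "y m \<in> up (y n)" if "m \<ge> n" for m n
    using that
  proof (induction m rule: dec_induct)
    case base then show ?case using up_self assms by blast
  next
    case (step m) then show ?case using up_trans up_child[OF assms(1), of "Suc m"] assms(3) by metis
  qed
  then have "T.ev y (up (y n))" for n by (auto simp: eventually_sequentially)
  then show ?thesis using T.lives_iff_ev[OF \<omega>] N_up_finite assms(1) \<omega>(1) by blast
qed

end


section \<open>Envelopes\<close>

context sgraph begin

text \<open>Each set that meets \<open>F\<close> picks a point of \<open>F\<close>, and by
  disjointness no point is picked twice. The map \<open>g\<close> lets the family be indexed by
  nodes or rays.\<close>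

lemma finite_meeting:
  assumes "finite F" "\<And>A B. A \<in> \<F> \<Longrightarrow> B \<in> \<F> \<Longrightarrow> A \<noteq> B \<Longrightarrow> g A \<inter> g B = {}"
  shows "finite {A \<in> \<F>. g A \<inter> F \<noteq> {}}"
proof -
  define h where "h A = (SOME x. x \<in> g A \<inter> F)" for A
  have h: "h A \<in> g A \<inter> F" if "A \<in> \<F>" "g A \<inter> F \<noteq> {}" for A
    unfolding h_def some_in_eq using that(2) .
  have "inj_on h {A \<in> \<F>. g A \<inter> F \<noteq> {}}"
  proof (rule inj_onI)
    fix A B assume "A \<in> {A \<in> \<F>. g A \<inter> F \<noteq> {}}" "B \<in> {A \<in> \<F>. g A \<inter> F \<noteq> {}}" "h A = h B"
    then show "A = B" using h[of A] h[of B] assms(2)[of A B] by auto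
  qed
  moreover have "h ` {A \<in> \<F>. g A \<inter> F \<noteq> {}} \<subseteq> F" using h by blast
  ultimately show ?thesis using assms(1) inj_on_finite by blast
qed

text \<open>The star-comb dichotomy, read off a breadth-first search tree.\<close>
lemma star_comb:
  assumes C: "conn C" "infinite (N C)"
  shows "(\<exists>c\<in>C. \<forall>S. finite S \<and> c \<notin> S \<longrightarrow> (\<exists>z\<in>N C. reach (V - S) c z)) \<or>
    (\<exists>R. ray G R \<and> range R \<subseteq> C \<and>
      (\<forall>S. finite S \<longrightarrow> (\<forall>\<^sub>F n in sequentially. \<exists>z\<in>N C. reach (V - S) (R n) z)))"
proof (subst disj_imp, rule impI)
  assume "\<not> (\<exists>c\<in>C. \<forall>S. finite S \<and> c \<notin> S \<longrightarrow> (\<exists>z\<in>N C. reach (V - S) c z))"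
  then have nostar: "\<forall>c\<in>C. \<exists>S. finite S \<and> c \<notin> S \<and> (\<forall>z\<in>N C. \<not> reach (V - S) c z)"
    by simp
  obtain c where c: "c \<in> C" using C by (auto simp: conn_def)
  obtain par lev where rt: "rtree C c par lev" and adjp: "\<And>x. x \<in> C \<Longrightarrow> x \<noteq> c \<Longrightarrow> adj (par x) x"
    using bfs_tree[OF C(1) c] by blast
  interpret rtree C c par lev by fact
  have CV: "C \<subseteq> V" using C by (auto simp: conn_def)
  \<comment> \<open>\<open>A x\<close> collects the neighbours of \<open>C\<close> attached to the
    subtree above \<open>x\<close>. It is infinite at the root, and the spine of the comb runs
    through children for which it stays infinite.\<close>
  define A where "A x = {z \<in> N C. \<exists>u\<in>up x. adj u z}" for x
  have Ac: "A c = N C" unfolding A_def up_root by (auto simp: N_iff)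
  have upreach: "reach (V - S) x u" if "u \<in> up x" "up x \<inter> S = {}" for x u S
  proof (rule rtree_up_reach[OF rt CV adjp that(1)])
    fix y assume "y \<in> up x" "u \<in> up y"
    then show "y \<in> V - S" using that(2) up_subset[of x] CV by auto
  qed auto
  have child: "\<exists>y\<in>C. y \<noteq> c \<and> par y = x \<and> infinite (A y)" if x: "x \<in> C" "infinite (A x)" for x
  proof (rule ccontr)
    assume *: "\<not> ?thesis"
    \<comment> \<open>\<open>x\<close> is not the centre of a star, so a finite \<open>S\<close>
      cuts it off from \<open>N C\<close>. Child subtrees that avoid \<open>S\<close> then
      contribute only vertices of \<open>S\<close>, and the finitely many others contribute finite
      sets by assumption.\<close>
    obtain S where S: "finite S" "x \<notin> S" "\<forall>z\<in>N C. \<not> reach (V - S) x z"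
      using bspec[OF nostar x(1)] by (elim exE conjE)
    define Y where "Y = {y \<in> {y \<in> C. y \<noteq> c \<and> par y = x}. up y \<inter> S \<noteq> {}}"
    have "finite Y" unfolding Y_def
    proof (rule finite_meeting[OF S(1)])
      fix y y' assume y: "y \<in> {y \<in> C. y \<noteq> c \<and> par y = x}" "y' \<in> {y \<in> C. y \<noteq> c \<and> par y = x}" "y \<noteq> y'"
      have "lev y = lev y'" using par_step y by auto
      then show "up y \<inter> up y' = {}" using up_disjoint y(3) by blast
    qed
    have "A x \<subseteq> S \<union> (\<Union>y\<in>Y. A y)"
    proof
      fix z assume "z \<in> A x"
      then obtain u where u: "z \<in> N C" "u \<in> up x" "adj u z" by (auto simp: A_def)
      show "z \<in> S \<union> (\<Union>y\<in>Y. A y)"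
      proof (rule ccontr)
        assume n: "z \<notin> S \<union> (\<Union>y\<in>Y. A y)"
        have zV: "z \<in> V - S" using n u(3) adj_verts by auto
        have xV: "reach (V - S) x x" using x CV S by (auto intro: reach_refl)
        have "reach (V - S) x u"
        proof (cases "u = x")
          case True then show ?thesis using xV by simp
        next
          case False
          then obtain y where y: "y \<in> C" "y \<noteq> c" "par y = x" "u \<in> up y" using up_to_child u(2) by metis
          then have "up y \<inter> S = {}" using n u by (auto simp: A_def Y_def)
          moreover then have "reach (V - S) x y"
            using reach_step[OF xV, of y] adjp[of y] y up_self[of y] CV by auto
          ultimately show ?thesis using upreach[OF y(4)] reach_trans by blast
        qed
        then show False using bspec[OF S(3) u(1)] reach_step u(3) zV by blast
      qed
    qed
    moreover have "finite (A y)" if "y \<in> Y" for y using * that by (auto simp: Y_def)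
    ultimately have "finite (A x)" using S(1) \<open>finite Y\<close> by (meson finite_UN finite_Un finite_subset)
    then show False using x by simp
  qed
  define nxt where "nxt x = (SOME y. y \<in> C \<and> y \<noteq> c \<and> par y = x \<and> infinite (A y))" for x
  have nxt: "nxt x \<in> C \<and> nxt x \<noteq> c \<and> par (nxt x) = x \<and> infinite (A (nxt x))"
    if "x \<in> C" "infinite (A x)" for x
    unfolding nxt_def by (rule someI_ex) (use child[OF that] in blast)
  define R where "R n = (nxt ^^ n) c" for n
  have R: "R n \<in> C \<and> infinite (A (R n)) \<and> lev (R n) = n" for n
  proof (induction n)
    case 0 then show ?case using c C Ac lev_root by (simp add: R_def)
  next
    case (Suc n)
    have e: "R (Suc n) = nxt (R n)" by (simp add: R_def)
    have *: "nxt (R n) \<in> C" "nxt (R n) \<noteq> c" "par (nxt (R n)) = R n" "infinite (A (nxt (R n)))"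
      using nxt Suc by auto
    then show ?case using par_step[of "nxt (R n)"] Suc e by auto
  qed
  have "inj R" by (rule injI) (metis R)
  moreover have "{R n, R (Suc n)} \<in> edges G" for n
  proof -
    have e: "R (Suc n) = nxt (R n)" by (simp add: R_def)
    then show ?thesis using nxt[of "R n"] R[of n] adjp[of "nxt (R n)"] by (auto simp: adj_def)
  qed
  ultimately have "ray G R" using R CV by (auto simp: ray_def)
  moreover have "range R \<subseteq> C" using R by blast
  moreover have "\<forall>\<^sub>F n in sequentially. \<exists>z\<in>N C. reach (V - S) (R n) z" if S: "finite S" for S
  proof -
    \<comment> \<open>Subtrees rooted above the levels of \<open>S\<close> avoid \<open>S\<close>,
      and their infinite \<open>A\<close> supplies a neighbour of \<open>C\<close> outside
      \<open>S\<close>.\<close>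
    obtain n where n: "\<And>s. s \<in> S \<Longrightarrow> lev s < n"
      using S by (metis finite_imageI finite_nat_set_iff_bounded imageI)
    have "\<exists>z\<in>N C. reach (V - S) (R m) z" if m: "m \<ge> n" for m
    proof -
      have dis: "up (R m) \<inter> S = {}" using n up_lev[of _ "R m"] R[of m] m by fastforce
      have "\<not> A (R m) \<subseteq> S" using R[of m] S finite_subset by blast
      then obtain z u where z: "z \<in> N C" "z \<notin> S" "u \<in> up (R m)" "adj u z" by (auto simp: A_def)
      have "reach (V - S) (R m) z"
        using reach_step[OF upreach[OF z(3) dis] z(4)] z(2) adj_verts[OF z(4)] by blast
      then show ?thesis using z(1) by blast
    qed
    then show ?thesis by (auto simp: eventually_sequentially)
  qed
  ultimately show "\<exists>R. ray G R \<and> range R \<subseteq> C \<and>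
      (\<forall>S. finite S \<longrightarrow> (\<forall>\<^sub>F n in sequentially. \<exists>z\<in>N C. reach (V - S) (R n) z))" by blast
qed

lemma maximal_disjoint_rays:
  "\<exists>\<R>. \<R> \<subseteq> Q \<and> pairwise (\<lambda>R R'. range R \<inter> range R' = {}) \<R> \<and>
    (\<forall>R\<in>Q. \<exists>R'\<in>\<R>. range R \<inter> range R' \<noteq> {})" for Q :: "(nat \<Rightarrow> 'v) set"
proof -
  define \<A> where "\<A> = {\<R>. \<R> \<subseteq> Q \<and> pairwise (\<lambda>R R'. range R \<inter> range R' = {}) \<R>}"
  have "\<exists>M\<in>\<A>. \<forall>X\<in>\<A>. M \<subseteq> X \<longrightarrow> X = M"
  proof (rule subset_Zorn_nonempty)
    show "\<A> \<noteq> {}" unfolding \<A>_def by (auto intro: exI[of _ "{}"])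
    fix \<C> assume ne: "\<C> \<noteq> {}" and ch: "subset.chain \<A> \<C>"
    have "range R \<inter> range R' = {}" if "R \<in> \<Union>\<C>" "R' \<in> \<Union>\<C>" "R \<noteq> R'" for R R'
    proof -
      obtain X X' where X: "X \<in> \<C>" "X' \<in> \<C>" "R \<in> X" "R' \<in> X'" using \<open>R \<in> \<Union>\<C>\<close> \<open>R' \<in> \<Union>\<C>\<close> by blast
      then obtain Y where "Y \<in> \<C>" "R \<in> Y" "R' \<in> Y" using ch unfolding subset_chain_def by blast
      then show ?thesis using ch \<open>R \<noteq> R'\<close> unfolding subset_chain_def \<A>_def pairwise_def by blast
    qed
    moreover have "\<Union>\<C> \<subseteq> Q" using ch unfolding subset_chain_def \<A>_def by blast
    ultimately show "\<Union>\<C> \<in> \<A>" by (simp add: \<A>_def pairwise_def)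
  qed
  then obtain \<R> where \<R>: "\<R> \<in> \<A>" "\<And>X. X \<in> \<A> \<Longrightarrow> \<R> \<subseteq> X \<Longrightarrow> X = \<R>" by blast
  have "\<exists>R'\<in>\<R>. range R \<inter> range R' \<noteq> {}" if "R \<in> Q" for R
  proof (rule ccontr)
    assume *: "\<not> ?thesis"
    then have "range R \<inter> range R' = {} \<and> range R' \<inter> range R = {}" if "R' \<in> \<R>" for R'
      using that by blast
    then have "insert R \<R> \<in> \<A>" using \<R>(1) that by (simp add: \<A>_def pairwise_insert)
    then have "R \<in> \<R>" using \<R>(2) by blast
    then show False using * by blast
  qed
  then show ?thesis using \<R>(1) by (auto simp: \<A>_def)
qed

text \<open>\<open>X\<close> and \<open>Y\<close> are the vertices and the ends of a closed set. Its envelope \<open>W\<close> has the same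
  ends in its closure and finite adhesion: one adds a maximal set of disjoint rays to ends in \<open>Y\<close>
  and then all vertices that no finite set separates from what one has.\<close>
lemma envelope:
  assumes X: "X \<subseteq> V" and Y: "Y \<subseteq> graph_ends G"
    and closed: "\<And>\<epsilon>. \<epsilon> \<in> graph_ends G \<Longrightarrow> \<epsilon> \<notin> Y \<Longrightarrow>
      \<exists>A. A \<subseteq> V \<and> finite (N A) \<and> lives \<epsilon> A \<and> A \<inter> X = {} \<and> (\<forall>\<phi>\<in>Y. \<not> lives \<phi> A)"
  obtains W where "X \<subseteq> W" "W \<subseteq> V"
    and "\<And>K. K \<in> comps (V - W) \<Longrightarrow> finite (N K) \<and> (\<forall>\<phi>\<in>Y. \<not> lives \<phi> K)"
    and "\<And>\<epsilon>. \<epsilon> \<in> graph_ends G \<Longrightarrow> \<epsilon> \<notin> Y \<Longrightarrow>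
      \<exists>A. A \<subseteq> V \<and> finite (N A) \<and> lives \<epsilon> A \<and> A \<inter> W = {}"
proof -
  obtain \<R> where \<R>: "\<R> \<subseteq> \<Union>Y" "pairwise (\<lambda>R R'. range R \<inter> range R' = {}) \<R>"
    "\<And>R. R \<in> \<Union>Y \<Longrightarrow> \<exists>R'\<in>\<R>. range R \<inter> range R' \<noteq> {}"
    using maximal_disjoint_rays[of "\<Union>Y"] by blast
  have ray\<R>: "ray G R" if "R \<in> \<R>" for R using that \<R>(1) Y end_rays by blast
  define U where "U = X \<union> (\<Union>R\<in>\<R>. range R)"
  \<comment> \<open>Closing under this condition excludes stars: the centre of an infinite star
    attached to \<open>W\<close> is itself inseparable from \<open>U\<close>.\<close>
  define W where "W = {v \<in> V. \<forall>S. finite S \<longrightarrow> v \<notin> S \<longrightarrow> (\<exists>u\<in>U. reach (V - S) v u)}"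
  have UV: "U \<subseteq> V" using X ray\<R> ray_verts by (auto simp: U_def)
  have UW: "U \<subseteq> W"
  proof
    fix u assume u: "u \<in> U"
    then have "reach (V - S) u u" if "u \<notin> S" for S using that UV by (intro reach_refl) blast
    then show "u \<in> W" using u UV by (auto simp: W_def)
  qed
  \<comment> \<open>Each ray of the family finally leaves \<open>A\<close>, and one that meets
    \<open>A\<close> must cross the finite \<open>N A\<close>. As the rays are disjoint, finitely
    many of them meet \<open>A\<close>, each in finitely many vertices. Deleting these keeps the
    neighbourhood finite, and then no vertex of \<open>W\<close> is left.\<close>
  have away: "\<exists>A. A \<subseteq> V \<and> finite (N A) \<and> lives \<epsilon> A \<and> A \<inter> W = {}"
    if \<epsilon>: "\<epsilon> \<in> graph_ends G" "\<epsilon> \<notin> Y" for \<epsilon>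
  proof -
    obtain A where A: "A \<subseteq> V" "finite (N A)" "lives \<epsilon> A" "A \<inter> X = {}" "\<And>\<phi>. \<phi> \<in> Y \<Longrightarrow> \<not> lives \<phi> A"
      using closed[OF \<epsilon>] by blast
    have nev: "\<not> ev R A" if "R \<in> \<R>" for R
    proof -
      obtain \<phi> where "\<phi> \<in> Y" "R \<in> \<phi>" using \<R>(1) \<open>R \<in> \<R>\<close> by blast
      then show ?thesis using A(2,5) lives_iff_ev Y by blast
    qed
    have meets: "range R \<inter> N A \<noteq> {}" if R: "R \<in> \<R>" "range R \<inter> A \<noteq> {}" for R
    proof
      assume e: "range R \<inter> N A = {}"
      obtain n where "R n \<in> A" using R by blast
      then have "R k \<in> A" if "k \<ge> n" for k using ray_stays[OF ray\<R>[OF R(1)] _ _ that] e by blast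
      then show False using nev[OF R(1)] by (auto simp: eventually_sequentially)
    qed
    have "finite {R \<in> \<R>. range R \<inter> N A \<noteq> {}}"
      by (rule finite_meeting[OF A(2)]) (use \<R>(2) in \<open>auto simp: pairwise_def\<close>)
    then have finR: "finite {R \<in> \<R>. range R \<inter> A \<noteq> {}}"
      by (rule rev_finite_subset) (use meets in blast)
    have "finite (range R \<inter> A)" if R: "R \<in> \<R>" for R
    proof -
      have "ev R (- A)" using ray_dichotomy[OF ray\<R>[OF R] A(2)] nev[OF R] by blast
      then obtain n where "\<And>k. k \<ge> n \<Longrightarrow> R k \<notin> A" by (auto simp: eventually_sequentially)
      then have "range R \<inter> A \<subseteq> R ` {..<n}" by (force simp: not_le[symmetric])
      then show ?thesis using finite_subset by blast
    qed
    then have "finite (\<Union>R\<in>{R \<in> \<R>. range R \<inter> A \<noteq> {}}. range R \<inter> A)" using finR by blast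
    moreover have "A \<inter> U \<subseteq> (\<Union>R\<in>{R \<in> \<R>. range R \<inter> A \<noteq> {}}. range R \<inter> A)" using A(4) by (auto simp: U_def)
    ultimately have finAU: "finite (A \<inter> U)" using finite_subset by blast
    define A' where "A' = A - A \<inter> U"
    have "N A' \<subseteq> N A \<union> (A \<inter> U)" by (auto simp: A'_def N_iff)
    then have fin: "finite (N A')" using A(2) finAU by (meson finite_Un finite_subset)
    have "A' \<inter> W = {}"
    proof (rule ccontr)
      assume "A' \<inter> W \<noteq> {}"
      then obtain v where v: "v \<in> A'" "v \<in> W" by blast
      moreover have "v \<notin> N A'" using v N_Int_self(1)[of A'] by blast
      ultimately obtain u where u: "u \<in> U" "reach (V - N A') v u" using fin by (auto simp: W_def)
      then have "u \<in> A'" using reach_avoiding_N v(1) by blast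
      then show False using u by (auto simp: A'_def)
    qed
    moreover have "lives \<epsilon> A'" using lives_Diff_finite[OF \<epsilon>(1) finAU] A(3) by (simp add: A'_def)
    ultimately show ?thesis using fin A(1) by (intro exI[of _ A']) (auto simp: A'_def)
  qed
  \<comment> \<open>An infinite \<open>N K\<close> would yield a star or a comb attached to
    \<open>W\<close>. The centre of a star would be in \<open>W\<close>. The spine of a comb to an
    end in \<open>Y\<close> would meet the maximal family and thus \<open>W\<close>; for an end
    outside \<open>Y\<close>, \<open>away\<close> provides a neighbourhood disjoint from
    \<open>W\<close>.\<close>
  have comp_fin: "finite (N K)" if K: "K \<in> comps (V - W)" for K
  proof (rule ccontr)
    assume inf: "infinite (N K)"
    have KW: "K \<inter> W = {}" using compsD_subset[OF K] by blast
    have NW: "N K \<subseteq> W" using comps_N_subset[OF K] by blast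
    have "conn K" using conn_compsD[OF _ K] by blast
    from star_comb[OF this inf] show False
    proof
      assume "\<exists>c\<in>K. \<forall>S. finite S \<and> c \<notin> S \<longrightarrow> (\<exists>z\<in>N K. reach (V - S) c z)"
      then obtain c where c: "c \<in> K" "\<And>S. finite S \<Longrightarrow> c \<notin> S \<Longrightarrow> \<exists>z\<in>N K. reach (V - S) c z" by blast
      have "\<exists>u\<in>U. reach (V - S) c u" if S: "finite S" "c \<notin> S" for S
      proof -
        obtain z where z: "z \<in> N K" "reach (V - S) c z" using c(2)[OF S] by blast
        then have "z \<in> W" "z \<notin> S" using NW reach_in by auto
        then obtain u where "u \<in> U" "reach (V - S) z u" using S by (auto simp: W_def)
        then show ?thesis using z reach_trans by blast
      qed
      moreover have "c \<in> V" using c(1) compsD_subset[OF K] by blast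
      ultimately have "c \<in> W" by (auto simp: W_def)
      then show False using c(1) KW by blast
    next
      assume "\<exists>R. ray G R \<and> range R \<subseteq> K \<and>
        (\<forall>S. finite S \<longrightarrow> (\<forall>\<^sub>F n in sequentially. \<exists>z\<in>N K. reach (V - S) (R n) z))"
      then obtain R where R: "ray G R" "range R \<subseteq> K"
        "\<And>S. finite S \<Longrightarrow> \<forall>\<^sub>F n in sequentially. \<exists>z\<in>N K. reach (V - S) (R n) z" by blast
      obtain \<epsilon> where \<epsilon>: "\<epsilon> \<in> graph_ends G" "R \<in> \<epsilon>" using end_of_ray[OF R(1)] .
      show False
      proof (cases "\<epsilon> \<in> Y")
        case True
        then obtain R' where "R' \<in> \<R>" "range R \<inter> range R' \<noteq> {}" using \<R>(3) \<epsilon>(2) by blast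
        moreover then have "range R' \<subseteq> W" using UW by (auto simp: U_def)
        ultimately show False using KW R(2) by blast
      next
        case False
        then obtain A where A: "finite (N A)" "lives \<epsilon> A" "A \<inter> W = {}" using away \<epsilon>(1) by blast
        have "ev R A" using A lives_iff_ev \<epsilon> by blast
        then have "\<forall>\<^sub>F n in sequentially. R n \<in> A \<and> (\<exists>z\<in>N K. reach (V - N A) (R n) z)"
          using R(3)[OF A(1)] by (rule eventually_conj)
        then obtain n z where "R n \<in> A" "z \<in> N K" "reach (V - N A) (R n) z"
          by (auto simp: eventually_sequentially)
        then have "z \<in> A \<inter> W" using reach_avoiding_N NW by blast
        then show False using A(3) by blast
      qed
    qed
  qed
  show ?thesis
  proof (rule that[of W])
    show "X \<subseteq> W" using UW by (auto simp: U_def)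
    show "W \<subseteq> V" by (auto simp: W_def)
    fix K assume K: "K \<in> comps (V - W)"
    have "\<not> lives \<phi> K" if \<phi>: "\<phi> \<in> Y" for \<phi>
    proof
      assume "lives \<phi> K"
      then obtain R where R: "R \<in> \<phi>" "range R \<subseteq> K" using lives_iff_ray comp_fin[OF K] Y \<phi> by blast
      then obtain R' where "R' \<in> \<R>" "range R \<inter> range R' \<noteq> {}" using \<R>(3) \<phi> by blast
      moreover then have "range R' \<subseteq> W" using UW by (auto simp: U_def)
      ultimately show False using R(2) compsD_subset[OF K] by blast
    qed
    then show "finite (N K) \<and> (\<forall>\<phi>\<in>Y. \<not> lives \<phi> K)" using comp_fin[OF K] by blast
  qed (use away in blast)
qed

end


section \<open>Cutting a region into linked regions\<close>

context sgraph begin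

text \<open>For connected members this makes the family the set of components of its union, see
  \<open>comps_Union_apart\<close>.\<close>

definition apart :: "'v set set \<Rightarrow> bool" where
  "apart \<F> \<longleftrightarrow> (\<forall>A\<in>\<F>. \<forall>B\<in>\<F>. A \<noteq> B \<longrightarrow> A \<inter> (B \<union> N B) = {})"

lemma apartD: "apart \<F> \<Longrightarrow> A \<in> \<F> \<Longrightarrow> B \<in> \<F> \<Longrightarrow> A \<noteq> B \<Longrightarrow> A \<inter> B = {} \<and> A \<inter> N B = {}"
  unfolding apart_def by blast

lemma Int_N_sym: assumes "A \<inter> N B = {}" "A \<inter> B = {}" shows "B \<inter> N A = {}"
proof (rule equals0I)
  fix b assume "b \<in> B \<inter> N A"
  then obtain a where "a \<in> A" "adj a b" "b \<in> B" by (auto simp: N_iff)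
  then have "a \<in> N B" using in_N[of b B a] adj_sym assms(2) by blast
  then show False using assms(1) \<open>a \<in> A\<close> by blast
qed

lemma N_subset: assumes "K \<subseteq> D" shows "N K \<subseteq> D \<union> N D"
proof
  fix v assume "v \<in> N K"
  then obtain u where "u \<in> K" "adj u v" by (auto simp: N_iff)
  then show "v \<in> D \<union> N D" using in_N[of u D v] assms by blast
qed

lemma apart_comps: "apart (comps Z)"
  unfolding apart_def
proof (intro ballI impI)
  fix A B assume AB: "A \<in> comps Z" "B \<in> comps Z" "A \<noteq> B"
  then have "A \<inter> B = {}" using comps_disjoint by blast
  moreover have "A \<inter> N B = {}" using comps_Int_N[OF AB(2)] compsD_subset[OF AB(1)] by blast
  ultimately show "A \<inter> (B \<union> N B) = {}" by blast
qed

lemma comps_Union_apart: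
  assumes "apart \<F>" "\<And>K. K \<in> \<F> \<Longrightarrow> conn K" shows "comps (\<Union>\<F>) = \<F>"
proof -
  have UV: "\<Union>\<F> \<subseteq> V" using assms(2) by (auto simp: conn_def)
  have sub: "K \<in> comps (\<Union>\<F>)" if K: "K \<in> \<F>" for K
  proof (rule comps_eqI[OF assms(2)[OF K] _ _ UV])
    show "\<Union>\<F> \<inter> N K = {}"
    proof (rule equals0I)
      fix v assume "v \<in> \<Union>\<F> \<inter> N K"
      then obtain L where "L \<in> \<F>" "v \<in> L" "v \<in> N K" by blast
      then show False using apartD[OF assms(1), of L K] K N_Int_self(1)[of K] by (cases "L = K") blast+
    qed
  qed (use K in blast)
  have "C \<in> \<F>" if C: "C \<in> comps (\<Union>\<F>)" for C
  proof -
    have "C \<noteq> {}" using conn_compsD[OF UV C] by (simp add: conn_def)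
    then obtain v K where v: "v \<in> C" "K \<in> \<F>" "v \<in> K" using compsD_subset[OF C] by blast
    then show ?thesis using comps_disjoint[OF C sub[OF v(2)] v(1,3)] v(2) by simp
  qed
  then show ?thesis using sub by blast
qed

text \<open>The competing sets may be disconnected, which keeps them closed under the set operations
  of uncrossing. By \<open>lives_conn_part\<close> a component in which the end lives has no larger
  neighbourhood.\<close>

definition ell :: "'v set \<Rightarrow> (nat \<Rightarrow> 'v) set \<Rightarrow> nat" where
  "ell D \<psi> = (LEAST n. \<exists>B\<subseteq>D. finite (N B) \<and> card (N B) = n \<and> lives \<psi> B)"

lemma ell_le: "B \<subseteq> D \<Longrightarrow> finite (N B) \<Longrightarrow> lives \<psi> B \<Longrightarrow> ell D \<psi> \<le> card (N B)"
  unfolding ell_def by (rule Least_le) blast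

lemma ell_witness:
  assumes "finite (N D)" "lives \<psi> D"
  obtains B where "B \<subseteq> D" "finite (N B)" "lives \<psi> B" "card (N B) = ell D \<psi>"
proof -
  have "\<exists>n. \<exists>B\<subseteq>D. finite (N B) \<and> card (N B) = n \<and> lives \<psi> B" using assms by blast
  then have "\<exists>B\<subseteq>D. finite (N B) \<and> card (N B) = ell D \<psi> \<and> lives \<psi> B"
    unfolding ell_def by (rule LeastI_ex)
  then show ?thesis using that by blast
qed

lemma lives_conn_part:
  assumes "\<psi> \<in> graph_ends G" "finite (N B)" "lives \<psi> B" "B \<subseteq> V"
  obtains K where "K \<subseteq> B" "conn K" "finite (N K)" "lives \<psi> K" "N K \<subseteq> N B"
proof -
  obtain K where K: "K \<in> comps B" "lives \<psi> K" using lives_comps assms by metis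
  then show ?thesis using that[of K] compsD_subset conn_compsD[OF assms(4)] comps_N_subset_N[OF K(1)]
    assms(2) finite_subset by metis
qed

lemma ell_mono:
  assumes "D' \<subseteq> D" "finite (N D')" "lives \<psi> D'" shows "ell D \<psi> \<le> ell D' \<psi>"
proof -
  obtain B where "B \<subseteq> D'" "finite (N B)" "lives \<psi> B" "card (N B) = ell D' \<psi>"
    using ell_witness assms(2,3) by metis
  then show ?thesis using ell_le[of B D \<psi>] assms(1) by auto
qed

lemma finite_N_Int: "finite (N A) \<Longrightarrow> finite (N B) \<Longrightarrow> finite (N (A \<inter> B))"
  using N_Int_subset by (meson finite_Un finite_subset)

lemma finite_N_Un: "finite (N A) \<Longrightarrow> finite (N B) \<Longrightarrow> finite (N (A \<union> B))"
  using N_Un_subset by (meson finite_Un finite_subset)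

text \<open>For an optimal set \<open>B\<close> around \<open>\<psi>\<close>, the union
  \<open>F \<union> B\<close> competes for \<open>\<omega>\<close> and so has at least the order of
  \<open>F\<close>. By submodularity \<open>F \<inter> B\<close> has at most the order of
  \<open>B\<close>, and it competes inside \<open>F\<close>.\<close>

lemma ell_uncross:
  assumes D: "finite (N D)" and F: "F \<subseteq> D" "finite (N F)" "lives \<omega> F" "card (N F) \<le> ell D \<omega>"
    and \<psi>: "lives \<psi> F"
  shows "ell F \<psi> \<le> ell D \<psi>"
proof -
  have "lives \<psi> D" using \<psi> F lives_mono by blast
  then obtain B where B: "B \<subseteq> D" "finite (N B)" "lives \<psi> B" "card (N B) = ell D \<psi>"
    using ell_witness D by metis
  have "ell D \<omega> \<le> card (N (F \<union> B))"
    using F B finite_N_Un lives_mono[OF F(3)] by (intro ell_le) auto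
  moreover have "ell F \<psi> \<le> card (N (F \<inter> B))"
    using F B finite_N_Int \<psi> lives_Int by (intro ell_le) auto
  ultimately show ?thesis using submodular[OF F(2) B(2)] F(4) B(4) by linarith
qed

text \<open>Optimality for a single witness end is enough for every uncrossing below.\<close>

definition tight_region :: "(nat \<Rightarrow> 'v) set set \<Rightarrow> 'v set \<Rightarrow> 'v set \<Rightarrow> bool" where
  "tight_region \<Psi> D K \<longleftrightarrow> K \<subseteq> D \<and> conn K \<and> finite (N K) \<and> (\<exists>\<omega>\<in>\<Psi>. lives \<omega> K \<and> ell D \<omega> = card (N K))"

text \<open>Among the regions of minimum order around \<open>\<omega>\<close> one meeting the fewest neighbourhoods in \<open>\<F>\<close>
  crosses none of them: otherwise sub- or posimodularity uncrosses.\<close>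
lemma uncrossed_region:
  assumes D: "D \<subseteq> V" "finite (N D)" and \<Psi>: "\<Psi> \<subseteq> graph_ends G"
    and \<F>: "apart \<F>" "\<And>K. K \<in> \<F> \<Longrightarrow> tight_region \<Psi> D K"
    and \<omega>: "\<omega> \<in> \<Psi>" "lives \<omega> D" "\<And>K. K \<in> \<F> \<Longrightarrow> \<not> lives \<omega> K"
  obtains A where "A \<subseteq> D" "conn A" "finite (N A)" "lives \<omega> A" "card (N A) = ell D \<omega>"
    "\<And>K. K \<in> \<F> \<Longrightarrow> K \<inter> N A = {}"
proof -
  define j where "j = ell D \<omega>"
  define P where "P A \<longleftrightarrow> A \<subseteq> D \<and> conn A \<and> finite (N A) \<and> lives \<omega> A \<and> card (N A) = j" for A
  define m where "m A = card {K \<in> \<F>. K \<inter> N A \<noteq> {}}" for A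
  have \<omega>E: "\<omega> \<in> graph_ends G" using \<omega> \<Psi> by blast
  \<comment> \<open>A set around \<open>\<omega>\<close> of order at most \<open>j\<close> contains
    a connected one, and the order of the latter cannot drop below the minimum
    \<open>j\<close>.\<close>
  have PI: "\<exists>K. P K \<and> K \<subseteq> B \<and> N K \<subseteq> N B" if B: "B \<subseteq> D" "finite (N B)" "lives \<omega> B" "card (N B) \<le> j" for B
  proof -
    obtain K where K: "K \<subseteq> B" "conn K" "finite (N K)" "lives \<omega> K" "N K \<subseteq> N B"
      using lives_conn_part[OF \<omega>E B(2,3)] B(1) D by blast
    have "card (N K) \<le> j" using card_mono[OF B(2) K(5)] B(4) by simp
    moreover have "j \<le> card (N K)" unfolding j_def using K B by (intro ell_le) auto
    ultimately show ?thesis using K B(1) by (auto simp: P_def)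
  qed
  obtain B where "B \<subseteq> D" "finite (N B)" "lives \<omega> B" "card (N B) = ell D \<omega>" using ell_witness D \<omega> by metis
  then obtain A0 where "P A0" using PI[of B] by (auto simp: j_def)
  then obtain A where A: "P A" and Amin: "\<And>A'. P A' \<Longrightarrow> m A \<le> m A'"
    using arg_min_nat_lemma[of P A0 m] by blast
  have fin: "finite {K \<in> \<F>. K \<inter> N A \<noteq> {}}"
    using A apartD[OF \<F>(1)] by (intro finite_meeting) (auto simp: P_def)
  have "K \<inter> N A = {}" if K: "K \<in> \<F>" for K
  proof (rule ccontr)
    assume KA: "K \<inter> N A \<noteq> {}"
    obtain \<kappa> where \<kappa>: "\<kappa> \<in> \<Psi>" "lives \<kappa> K" "ell D \<kappa> = card (N K)" and K': "K \<subseteq> D" "conn K" "finite (N K)"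
      using \<F>(2)[OF K] by (auto simp: tight_region_def)
    have \<kappa>E: "\<kappa> \<in> graph_ends G" using \<kappa> \<Psi> by blast
    have A': "A \<subseteq> D" "conn A" "finite (N A)" "lives \<omega> A" "card (N A) = j" using A by (auto simp: P_def)
    \<comment> \<open>If the witness end of \<open>K\<close> lives in \<open>A\<close>, then
      \<open>A \<inter> K\<close> has at least the order of \<open>K\<close>, so
      \<open>A \<union> K\<close> has order at most \<open>j\<close> and \<open>A\<close> may
      swallow \<open>K\<close>. Otherwise \<open>K - (A \<union> N A)\<close> has at least the order
      of \<open>K\<close>, so \<open>A\<close> may withdraw from \<open>K\<close> and
      \<open>N K\<close> without exceeding \<open>j\<close>.\<close>
    have "\<exists>A'. P A' \<and> N A' \<subseteq> N A \<union> N K \<and> K \<inter> N A' = {}"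
    proof (cases "lives \<kappa> A")
      case True
      have "card (N K) \<le> card (N (A \<inter> K))"
        unfolding \<kappa>(3)[symmetric] using A' K' True \<kappa> finite_N_Int lives_Int by (intro ell_le) auto
      then have "card (N (A \<union> K)) \<le> j" using submodular[OF A'(3) K'(3)] A'(5) by linarith
      moreover have "lives \<omega> (A \<union> K)" using A'(4) lives_mono by blast
      ultimately obtain A1 where A1: "P A1" "A1 \<subseteq> A \<union> K" "N A1 \<subseteq> N (A \<union> K)"
        using PI[of "A \<union> K"] A' K' finite_N_Un by blast
      have "N (A \<union> K) \<subseteq> N A \<union> N K" "K \<inter> N (A \<union> K) = {}" using N_Un_subset by (auto simp: N_iff)
      then show ?thesis using A1 by blast
    next
      case False
      define A1 where "A1 = A - (K \<union> N K)"
      define K1 where "K1 = K - (A \<union> N A)"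
      have NA1: "N A1 \<subseteq> N A \<union> N K" unfolding A1_def by (rule N_Diff_subset)
      have NK1: "N K1 \<subseteq> N K \<union> N A" unfolding K1_def by (rule N_Diff_subset)
      have fins: "finite (N A1)" "finite (N K1)"
        using NA1 NK1 A'(3) K'(3) by (meson finite_Un finite_subset)+
      have "lives \<kappa> (K \<inter> (V - A - N A))" using lives_far[OF \<kappa>E A'(3)] False \<kappa>(2) lives_Int by blast
      then have "lives \<kappa> K1" by (rule lives_mono) (auto simp: K1_def)
      then have "card (N K) \<le> card (N K1)" unfolding \<kappa>(3)[symmetric]
        using K' fins by (intro ell_le) (auto simp: K1_def)
      then have le: "card (N A1) \<le> j"
        using posimodular[OF A'(3) K'(3)] A'(5) unfolding A1_def K1_def by linarith
      have "lives \<omega> (A \<inter> (V - K - N K))" using lives_far[OF \<omega>E K'(3)] \<omega>(3)[OF K] A'(4) lives_Int by blast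
      then have "lives \<omega> A1" by (rule lives_mono) (auto simp: A1_def)
      then obtain A2 where A2: "P A2" "A2 \<subseteq> A1" "N A2 \<subseteq> N A1"
        using PI[of A1] fins le A'(1) by (auto simp: A1_def)
      have "K \<inter> N A1 = {}"
      proof (rule Int_N_sym)
        show "A1 \<inter> N K = {}" "A1 \<inter> K = {}" by (auto simp: A1_def)
      qed
      then show ?thesis using A2 NA1 by blast
    qed
    then obtain A' where A': "P A'" "N A' \<subseteq> N A \<union> N K" "K \<inter> N A' = {}" by blast
    \<comment> \<open>The new neighbourhood lies in \<open>N A \<union> N K\<close>, and the other
      members of \<open>\<F>\<close> are disjoint from \<open>N K\<close>. So no member becomes
      crossed, while \<open>K\<close> no longer is.\<close>
    have "{L \<in> \<F>. L \<inter> N A' \<noteq> {}} \<subset> {L \<in> \<F>. L \<inter> N A \<noteq> {}}"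
    proof (rule psubsetI)
      show "{L \<in> \<F>. L \<inter> N A' \<noteq> {}} \<subseteq> {L \<in> \<F>. L \<inter> N A \<noteq> {}}"
      proof clarify
        fix L assume L: "L \<in> \<F>" "L \<inter> N A' \<noteq> {}" "L \<inter> N A = {}"
        then have "L \<noteq> K" using A'(3) by blast
        then have "L \<inter> N K = {}" using apartD[OF \<F>(1) L(1) K] by blast
        then show False using L A'(2) by blast
      qed
      show "{L \<in> \<F>. L \<inter> N A' \<noteq> {}} \<noteq> {L \<in> \<F>. L \<inter> N A \<noteq> {}}" using K KA A'(3) by blast
    qed
    then have "m A' < m A" unfolding m_def using fin by (rule psubset_card_mono[rotated])
    then show False using Amin[OF A'(1)] by simp
  qed
  then show ?thesis using that[of A] A by (auto simp: P_def j_def)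
qed

section \<open>Families of minimum-order regions that catch all ends of small order\<close>

lemma chain_Union_reach:
  assumes ch: "subset.chain \<A> \<C>" and Z1: "Z1 \<in> \<C>" "v \<in> Z1" and "reach (\<Union>\<C>) v u"
  shows "\<exists>Z\<in>\<C>. Z1 \<subseteq> Z \<and> reach Z v u"
  using assms(4)
proof (induction rule: reach_induct)
  case refl then show ?case using Z1 reach_refl by blast
next
  case (step a b)
  then obtain Z Z' where Z: "Z \<in> \<C>" "Z1 \<subseteq> Z" "reach Z v a" "Z' \<in> \<C>" "b \<in> Z'" by blast
  then have "Z \<subseteq> Z' \<or> Z' \<subseteq> Z" using ch unfolding subset_chain_def by blast
  then obtain W where W: "W \<in> \<C>" "Z \<subseteq> W" "Z' \<subseteq> W" using Z by blast
  then have "reach W v b" using reach_step[OF reach_mono[OF Z(3) W(2)]] Z step by blast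
  then show ?case using W Z by blast
qed

text \<open>Zorn's lemma is applied to vertex sets rather than families, because a new region may
  swallow old ones; the regions are recovered as components. A component of the union of a chain is
  an old region or an increasing union of regions of order \<open>j\<close>. In the second case its
  neighbourhood has at most \<open>j\<close> elements, since each finite part of it already shows in
  some member of the chain, and at least \<open>j\<close>, since an end of \<open>ell\<close> value
  \<open>j\<close> lives in it. A maximal set catches the required ends by
  \<open>uncrossed_region\<close>.\<close>

lemma tight_regions_next:
  assumes D: "D \<subseteq> V" "finite (N D)" and \<Psi>: "\<Psi> \<subseteq> graph_ends G"
    and \<F>: "apart \<F>" "\<And>K. K \<in> \<F> \<Longrightarrow> tight_region \<Psi> D K \<and> card (N K) < j"
  shows "\<exists>\<G>. apart \<G> \<and> (\<forall>K\<in>\<G>. tight_region \<Psi> D K \<and> card (N K) \<le> j) \<and>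
    (\<forall>K\<in>\<F>. \<forall>\<psi>. lives \<psi> K \<longrightarrow> (\<exists>L\<in>\<G>. lives \<psi> L)) \<and>
    (\<forall>\<psi>\<in>\<Psi>. lives \<psi> D \<longrightarrow> ell D \<psi> = j \<longrightarrow> (\<exists>L\<in>\<G>. lives \<psi> L))"
proof -
  define good where "good K \<longleftrightarrow> K \<in> \<F> \<or> tight_region \<Psi> D K \<and> card (N K) = j" for K
  define \<Z> where "\<Z> = {Z. \<Union>\<F> \<subseteq> Z \<and> Z \<subseteq> D \<and> (\<forall>K\<in>comps Z. good K)}"
  have \<F>conn: "conn K" if "K \<in> \<F>" for K using \<F>(2)[OF that] by (simp add: tight_region_def)
  have comps\<F>: "comps (\<Union>\<F>) = \<F>" by (rule comps_Union_apart[OF \<F>(1) \<F>conn])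
  have "\<exists>M\<in>\<Z>. \<forall>X\<in>\<Z>. M \<subseteq> X \<longrightarrow> X = M"
  proof (rule subset_Zorn_nonempty)
    have "\<Union>\<F> \<subseteq> D" using \<F>(2) by (auto simp: tight_region_def)
    then have "\<Union>\<F> \<in> \<Z>" using comps\<F> by (auto simp: \<Z>_def good_def)
    then show "\<Z> \<noteq> {}" by blast
    fix \<C> assume ne: "\<C> \<noteq> {}" and ch: "subset.chain \<Z> \<C>"
    have \<C>: "\<Union>\<F> \<subseteq> Z" "Z \<subseteq> D" "\<And>K. K \<in> comps Z \<Longrightarrow> good K" if "Z \<in> \<C>" for Z
      using ch that unfolding subset_chain_def \<Z>_def by blast+
    have "good K" if K: "K \<in> comps (\<Union>\<C>)" for K
    proof -
      obtain v where v: "v \<in> \<Union>\<C>" "K = comp (\<Union>\<C>) v" using K by (auto simp: comps_def)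
      have subK: "comp Z v \<subseteq> K" if "Z \<in> \<C>" for Z
        unfolding v(2) comp_def using reach_mono[of Z v _ "\<Union>\<C>"] that by blast
      have inK: "\<exists>Z\<in>\<C>. Z1 \<subseteq> Z \<and> u \<in> comp Z v" if "u \<in> K" "Z1 \<in> \<C>" "v \<in> Z1" for u Z1
        using chain_Union_reach[OF ch that(2,3), of u] that(1) by (auto simp: v(2) comp_def)
      have cv: "comp Z v \<in> comps Z" if "Z \<in> \<C>" "v \<in> Z" for Z using that by (simp add: comps_def)
      show ?thesis
      proof (cases "\<exists>Z1\<in>\<C>. v \<in> Z1 \<and> comp Z1 v \<notin> \<F>")
        case False
        obtain Z0 where Z0: "Z0 \<in> \<C>" "v \<in> Z0" using v by blast
        then have F0: "comp Z0 v \<in> \<F>" using False by blast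
        have "u \<in> comp Z0 v" if u: "u \<in> K" for u
        proof -
          obtain Z where Z: "Z \<in> \<C>" "Z0 \<subseteq> Z" "u \<in> comp Z v" using inK u Z0 by blast
          then have "comp Z v \<in> \<F>" using False Z0 by blast
          moreover have "v \<in> comp Z v" "v \<in> comp Z0 v" using Z Z0 comp_self by auto
          ultimately have "comp Z v = comp Z0 v" using apartD[OF \<F>(1) _ F0] by blast
          then show ?thesis using Z by simp
        qed
        then have "K = comp Z0 v" using subK[OF Z0(1)] by blast
        then show ?thesis using F0 by (simp add: good_def)
      next
        \<comment> \<open>Once the component of \<open>v\<close> is no old region, it never becomes
          one along the chain, because each member of the chain contains all old regions.\<close>
        case True
        then obtain Z1 where Z1: "Z1 \<in> \<C>" "v \<in> Z1" "comp Z1 v \<notin> \<F>" by blast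
        have tr: "tight_region \<Psi> D (comp Z v) \<and> card (N (comp Z v)) = j" if Z: "Z \<in> \<C>" "Z1 \<subseteq> Z" for Z
        proof -
          have vZ: "v \<in> Z" using Z Z1 by blast
          have "comp Z v \<notin> \<F>"
          proof
            assume F: "comp Z v \<in> \<F>"
            then have "comp Z v \<subseteq> Z1" using \<C>(1)[OF Z1(1)] by blast
            then have "comp Z v \<subseteq> comp Z1 v" using conn_subset_comp[OF \<F>conn[OF F]] comp_self[OF vZ] by blast
            moreover have "comp Z1 v \<subseteq> comp Z v" unfolding comp_def using reach_mono Z(2) by blast
            ultimately show False using F Z1(3) by simp
          qed
          then show ?thesis using \<C>(3)[OF Z(1) cv[OF Z(1) vZ]] by (auto simp: good_def)
        qed
        have "finite (N K) \<and> card (N K) \<le> j"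
        proof (rule finite_if_finite_subsets_card_bdd)
          fix Q assume Q: "Q \<subseteq> N K" "finite Q"
          have "\<exists>Z\<in>\<C>. Z1 \<subseteq> Z \<and> Q \<subseteq> N (comp Z v)"
            using Q(2,1)
          proof (induction Q rule: finite_induct)
            case empty then show ?case using Z1 by blast
          next
            case (insert q Q)
            then obtain Z where Z: "Z \<in> \<C>" "Z1 \<subseteq> Z" "Q \<subseteq> N (comp Z v)" by auto
            obtain u where u: "q \<notin> K" "u \<in> K" "adj u q" using insert.prems by (auto simp: N_iff)
            obtain Z' where Z': "Z' \<in> \<C>" "Z1 \<subseteq> Z'" "u \<in> comp Z' v" using inK[OF u(2) Z1(1,2)] by blast
            have "Z \<subseteq> Z' \<or> Z' \<subseteq> Z" using ch Z(1) Z'(1) unfolding subset_chain_def by blast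
            then obtain W where W: "W \<in> \<C>" "Z \<subseteq> W" "Z' \<subseteq> W" using Z Z' by blast
            have mono: "comp Z v \<subseteq> comp W v" "comp Z' v \<subseteq> comp W v"
              unfolding comp_def using reach_mono W by blast+
            have "x \<in> N (comp W v)" if x: "x \<in> insert q Q" for x
            proof -
              have "x \<notin> comp W v" using subK[OF W(1)] x insert.prems N_Int_self(1)[of K] by blast
              moreover have "\<exists>y\<in>comp W v. adj y x"
              proof (cases "x = q")
                case True then show ?thesis using u Z'(3) mono by blast
              next
                case False
                then have "x \<in> N (comp Z v)" using x Z(3) by blast
                then show ?thesis using mono unfolding N_iff by blast
              qed
              ultimately show ?thesis using N_iff by blast
            qed
            then show ?case using W Z(2) by blast
          qed
          then obtain Z where "Z \<in> \<C>" "Z1 \<subseteq> Z" "Q \<subseteq> N (comp Z v)" by blast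
          then show "card Q \<le> j" using tr[of Z] card_mono[of "N (comp Z v)" Q]
            by (auto simp: tight_region_def)
        qed
        moreover obtain \<omega> where \<omega>: "\<omega> \<in> \<Psi>" "lives \<omega> (comp Z1 v)" "ell D \<omega> = j"
          using tr[OF Z1(1)] by (auto simp: tight_region_def)
        moreover have "lives \<omega> K" using lives_mono[OF \<omega>(2) subK[OF Z1(1)]] .
        moreover have KD: "K \<subseteq> D" using compsD_subset[OF K] \<C>(2) by blast
        ultimately have "card (N K) = j" using ell_le[OF KD, of \<omega>] by auto
        moreover have "conn K" using conn_compsD[OF _ K] \<C>(2) D(1) by blast
        ultimately show ?thesis unfolding good_def tight_region_def
          using \<omega> \<open>lives \<omega> K\<close> KD \<open>finite (N K) \<and> card (N K) \<le> j\<close> by blast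
      qed
    qed
    moreover have "\<Union>\<F> \<subseteq> \<Union>\<C>" using \<C>(1) ne by blast
    moreover have "\<Union>\<C> \<subseteq> D" using \<C>(2) by blast
    ultimately show "\<Union>\<C> \<in> \<Z>" by (simp add: \<Z>_def)
  qed
  then obtain Z where Z\<Z>: "Z \<in> \<Z>" and Zmax: "\<And>X. X \<in> \<Z> \<Longrightarrow> Z \<subseteq> X \<Longrightarrow> X = Z" by blast
  have Z: "\<Union>\<F> \<subseteq> Z" "Z \<subseteq> D" "\<And>K. K \<in> comps Z \<Longrightarrow> good K" using Z\<Z> by (simp_all add: \<Z>_def)
  have tr: "tight_region \<Psi> D K \<and> card (N K) \<le> j" if "K \<in> comps Z" for K
    using Z(3)[OF that] \<F>(2)[of K] by (auto simp: good_def)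
  have cover: "\<exists>L\<in>comps Z. lives \<psi> L" if \<psi>: "\<psi> \<in> \<Psi>" "lives \<psi> D" "ell D \<psi> = j" for \<psi>
  proof (rule ccontr)
    assume no: "\<not> ?thesis"
    obtain A where A: "A \<subseteq> D" "conn A" "finite (N A)" "lives \<psi> A" "card (N A) = j"
      "\<And>K. K \<in> comps Z \<Longrightarrow> K \<inter> N A = {}"
      using uncrossed_region[OF D \<Psi> apart_comps, of Z \<psi>] tr no \<psi> by metis
    \<comment> \<open>Since \<open>A\<close> crosses no component of \<open>Z\<close>, each
      component is absorbed by \<open>A\<close> or kept. The result is admissible with union
      \<open>Z \<union> A\<close>, so maximality forces \<open>A\<close> into a component of
      \<open>Z\<close>, where \<open>\<psi>\<close> would then live.\<close>
    define \<H> where "\<H> = insert A {K \<in> comps Z. K \<inter> A = {}}"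
    have UH: "\<Union>\<H> = Z \<union> A"
    proof -
      have "K \<subseteq> A \<or> K \<inter> A = {}" if "K \<in> comps Z" for K
        using conn_dichotomy[OF _ A(6)[OF that]] tr[OF that] by (auto simp: tight_region_def)
      then have "x \<in> \<Union>\<H>" if "x \<in> Z" "x \<notin> A" for x
        using comps_ex[OF that(1)] that(2) unfolding \<H>_def by blast
      then show ?thesis using compsD_subset unfolding \<H>_def by blast
    qed
    have "apart \<H>" unfolding apart_def
    proof (intro ballI impI)
      fix K L assume KL: "K \<in> \<H>" "L \<in> \<H>" "K \<noteq> L"
      consider "K = A" "L \<in> comps Z" "L \<inter> A = {}" | "L = A" "K \<in> comps Z" "K \<inter> A = {}" |
        "K \<in> comps Z" "L \<in> comps Z" using KL by (auto simp: \<H>_def)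
      then show "K \<inter> (L \<union> N L) = {}"
      proof cases
        case 1 then show ?thesis using Int_N_sym[OF A(6)[OF 1(2)] 1(3)] by blast
      next
        case 2 then show ?thesis using A(6)[OF 2(2)] by blast
      next
        case 3 then show ?thesis using apartD[OF apart_comps] KL(3) by blast
      qed
    qed
    moreover have "conn K" if "K \<in> \<H>" for K
      using that A(2) tr by (auto simp: \<H>_def tight_region_def)
    ultimately have "comps (Z \<union> A) = \<H>" using comps_Union_apart UH by metis
    moreover have "good A" using A \<psi> by (auto simp: good_def tight_region_def)
    ultimately have "Z \<union> A \<in> \<Z>" using Z A(1) by (auto simp: \<Z>_def \<H>_def)
    then have "A \<subseteq> Z" using Zmax by blast
    then obtain K where "K \<in> comps Z" "A \<subseteq> K" using conn_subset_comps[OF A(2)] by metis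
    then show False using no lives_mono[OF A(4)] by blast
  qed
  show ?thesis
  proof (intro exI[of _ "comps Z"] conjI ballI allI impI)
    fix \<psi> K assume K: "K \<in> \<F>" "lives \<psi> K"
    then have "K \<subseteq> Z" using Z(1) by blast
    then obtain L where "L \<in> comps Z" "K \<subseteq> L" using conn_subset_comps[OF \<F>conn[OF K(1)]] by metis
    then show "\<exists>L\<in>comps Z. lives \<psi> L" using lives_mono[OF K(2)] by blast
  qed (use apart_comps tr cover in auto)
qed

text \<open>One value of \<open>ell\<close> is treated at a time, so that the regions added by
  \<open>tight_regions_next\<close> share the order \<open>j\<close>. Old regions may be swallowed,
  but the ends living in them stay caught.\<close>

lemma tight_regions:
  assumes D: "D \<subseteq> V" "finite (N D)" and \<Psi>: "\<Psi> \<subseteq> graph_ends G"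
  shows "\<exists>\<F>. apart \<F> \<and> (\<forall>K\<in>\<F>. tight_region \<Psi> D K \<and> card (N K) < j) \<and>
    (\<forall>\<psi>\<in>\<Psi>. lives \<psi> D \<longrightarrow> ell D \<psi> < j \<longrightarrow> (\<exists>K\<in>\<F>. lives \<psi> K))"
proof (induction j)
  case 0
  show ?case by (rule exI[of _ "{}"]) (simp add: apart_def)
next
  case (Suc j)
  then obtain \<F> where \<F>: "apart \<F>" "\<And>K. K \<in> \<F> \<Longrightarrow> tight_region \<Psi> D K \<and> card (N K) < j"
    "\<And>\<psi>. \<psi> \<in> \<Psi> \<Longrightarrow> lives \<psi> D \<Longrightarrow> ell D \<psi> < j \<Longrightarrow> \<exists>K\<in>\<F>. lives \<psi> K" by blast
  obtain \<G> where \<G>: "apart \<G>" "\<And>K. K \<in> \<G> \<Longrightarrow> tight_region \<Psi> D K \<and> card (N K) \<le> j"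
    "\<And>\<psi> K. K \<in> \<F> \<Longrightarrow> lives \<psi> K \<Longrightarrow> \<exists>L\<in>\<G>. lives \<psi> L"
    "\<And>\<psi>. \<psi> \<in> \<Psi> \<Longrightarrow> lives \<psi> D \<Longrightarrow> ell D \<psi> = j \<Longrightarrow> \<exists>L\<in>\<G>. lives \<psi> L"
    using tight_regions_next[OF D \<Psi> \<F>(1,2)] by blast
  have "\<exists>K\<in>\<G>. lives \<psi> K" if \<psi>: "\<psi> \<in> \<Psi>" "lives \<psi> D" "ell D \<psi> < Suc j" for \<psi>
  proof (cases "ell D \<psi> = j")
    case True then show ?thesis using \<G>(4) \<psi> by blast
  next
    case False
    then have "ell D \<psi> < j" using \<psi> by simp
    then obtain K where "K \<in> \<F>" "lives \<psi> K" using \<F>(3) \<psi> by blast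
    then show ?thesis using \<G>(3) by blast
  qed
  then show ?case using \<G>(1,2) by (intro exI[of _ \<G>]) (auto simp: less_Suc_eq_le)
qed

text \<open>Avoiding \<open>W\<close> competes with keeping minimum-order regions whole. The tight
  regions of order below that of \<open>D\<close> catch the ends of small \<open>ell\<close>. The
  envelope is enlarged by the neighbourhoods of those that meet it; a tight region disjoint from
  \<open>W\<close> then lies inside one component of what is left of \<open>D\<close>. Components
  are kept only if they contain an end \<open>\<omega>\<close> caught by no tight region. Therefore
  a kept component is not part of a tight region and is apart from those that meet \<open>W\<close>;
  and \<open>ell D \<omega>\<close> is at least the order of \<open>D\<close>, which is where the
  minimum in the conclusion comes from.\<close>

lemma cut_region:
  assumes D: "D \<subseteq> V" "finite (N D)" and \<Psi>: "\<Psi> \<subseteq> graph_ends G"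
    and W: "W \<subseteq> V" "\<And>K. K \<in> comps (V - W) \<Longrightarrow> finite (N K) \<and> (\<forall>\<phi>\<in>Y. \<not> lives \<phi> K)"
      "\<And>\<psi>. \<psi> \<in> \<Psi> \<Longrightarrow> \<exists>A. A \<subseteq> V \<and> finite (N A) \<and> lives \<psi> A \<and> A \<inter> W = {}"
  obtains \<G> where "apart \<G>"
    "\<And>A. A \<in> \<G> \<Longrightarrow> A \<subseteq> D \<and> conn A \<and> finite (N A)"
    "\<And>A. A \<in> \<G> \<Longrightarrow> card (N A) < card (N D) \<or> A \<inter> W = {} \<and> (\<forall>\<phi>\<in>Y. \<not> lives \<phi> A)"
    "\<And>A. A \<in> \<G> \<Longrightarrow> \<exists>\<omega>\<in>\<Psi>. lives \<omega> A \<and> min (card (N A)) (card (N D)) \<le> ell D \<omega>"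
    "\<And>A \<psi>. A \<in> \<G> \<Longrightarrow> \<psi> \<in> \<Psi> \<Longrightarrow> lives \<psi> A \<Longrightarrow> ell D \<psi> < card (N D) \<Longrightarrow> ell A \<psi> \<le> ell D \<psi>"
    "\<And>\<psi>. \<psi> \<in> \<Psi> \<Longrightarrow> lives \<psi> D \<Longrightarrow> \<exists>A\<in>\<G>. lives \<psi> A"
proof -
  define d where "d = card (N D)"
  obtain \<F> where \<F>: "apart \<F>" "\<And>K. K \<in> \<F> \<Longrightarrow> tight_region \<Psi> D K \<and> card (N K) < d"
    "\<And>\<psi>. \<psi> \<in> \<Psi> \<Longrightarrow> lives \<psi> D \<Longrightarrow> ell D \<psi> < d \<Longrightarrow> \<exists>K\<in>\<F>. lives \<psi> K"
    using tight_regions[OF D \<Psi>, of d] by blast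
  have F: "F \<subseteq> D" "conn F" "finite (N F)" if "F \<in> \<F>" for F
    using \<F>(2)[OF that] by (auto simp: tight_region_def)
  have FD: "F \<inter> N D = {}" if "F \<in> \<F>" for F using F(1)[OF that] N_Int_self(1)[of D] by blast
  define W' where "W' = W \<union> N D \<union> \<Union>{N F | F. F \<in> \<F> \<and> F \<inter> W \<noteq> {}}"
  define \<K> where "\<K> = {K \<in> comps (D - W'). \<exists>\<omega>\<in>\<Psi>. lives \<omega> K \<and> (\<forall>F\<in>\<F>. \<not> lives \<omega> F)}"
  have DW': "D - W' \<subseteq> V" using D by blast
  have Kconn: "conn K" if "K \<in> \<K>" for K using that conn_compsD[OF DW'] by (auto simp: \<K>_def)
  have Ksub: "K \<subseteq> D - W'" if "K \<in> \<K>" for K using that compsD_subset by (auto simp: \<K>_def)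
  have KN: "N K \<subseteq> W'" if "K \<in> \<K>" for K
  proof -
    have K: "K \<in> comps (D - W')" using that by (simp add: \<K>_def)
    have "N K \<inter> (D - W') = {}" using comps_Int_N[OF K] by blast
    moreover have "N K \<subseteq> D \<union> N D" using N_subset[of K D] compsD_subset[OF K] by blast
    ultimately show ?thesis by (auto simp: W'_def)
  qed
  have finmeet: "finite {F \<in> \<F>. F \<inter> Q \<noteq> {}}" if "finite Q" for Q
    using that apartD[OF \<F>(1)] by (intro finite_meeting) auto
  have inC: "\<exists>C\<in>comps (V - W). K \<subseteq> C" if "K \<in> \<K>" for K
  proof -
    have "K \<subseteq> V - W" using Ksub[OF that] D by (auto simp: W'_def)
    then show ?thesis using conn_subset_comps[OF Kconn[OF that]] by metis
  qed
  have Kfin: "finite (N K)" if K: "K \<in> \<K>" for K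
  proof -
    obtain C where C: "C \<in> comps (V - W)" "K \<subseteq> C" using inC K by blast
    have fC: "finite (N C)" using W(2) C(1) by blast
    have CW: "C \<inter> W = {}" using compsD_subset[OF C(1)] by blast
    \<comment> \<open>Infinitely many neighbourhoods may have been added to \<open>W\<close>. But a
      tight region that meets \<open>W\<close> and has a neighbour in \<open>C\<close> meets the
      finite set \<open>N C\<close>, so only finitely many of them matter here.\<close>
    have "N K \<subseteq> N C \<union> N D \<union> (\<Union>F\<in>{F \<in> \<F>. F \<inter> N C \<noteq> {}}. N F)"
    proof
      fix v assume v: "v \<in> N K"
      then obtain u where u: "u \<in> K" "adj u v" by (auto simp: N_iff)
      have vC: "v \<in> C \<or> v \<in> N C" using u C(2) in_N[of u C v] by blast
      have "v \<in> W'" using v KN[OF K] by blast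
      then consider "v \<in> W" | "v \<in> N D" | F' where "F' \<in> \<F>" "F' \<inter> W \<noteq> {}" "v \<in> N F'"
        unfolding W'_def by blast
      then show "v \<in> N C \<union> N D \<union> (\<Union>F\<in>{F \<in> \<F>. F \<inter> N C \<noteq> {}}. N F)"
      proof cases
        case 1 then show ?thesis using vC CW by blast
      next
        case 2 then show ?thesis by blast
      next
        case 3
        show ?thesis
        proof (cases "v \<in> N C")
          case False
          then have vC: "v \<in> C" using vC by blast
          obtain f where f: "f \<in> F'" "adj f v" using 3(3) by (auto simp: N_iff)
          have "F' \<inter> N C \<noteq> {}"
          proof (cases "f \<in> C")
            case True
            obtain w where "w \<in> F'" "w \<in> W" using 3(2) by blast
            then show ?thesis using conn_meets_N[OF F(2)[OF 3(1)] f(1) True, of w] CW by blast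
          next
            case False
            then have "f \<in> N C" using in_N[of v C f] vC adj_sym f(2) by blast
            then show ?thesis using f by blast
          qed
          then show ?thesis using 3 by blast
        qed simp
      qed
    qed
    moreover have "finite (N C \<union> N D \<union> (\<Union>F\<in>{F \<in> \<F>. F \<inter> N C \<noteq> {}}. N F))"
      using fC D(2) finmeet[OF fC] F(3) by blast
    ultimately show ?thesis using finite_subset by blast
  qed
  have split: "F \<subseteq> K \<or> K \<inter> (F \<union> N F) = {}" if FK: "F \<in> \<F>" "K \<in> \<K>" for F K
  proof (cases "F \<inter> W = {}")
    case True
    have "F \<inter> N F' = {}" if "F' \<in> \<F>" for F'
      using apartD[OF \<F>(1) FK(1) that] N_Int_self(1)[of F] by (cases "F = F'") auto
    then have "F \<inter> W' = {}" using True FD[OF FK(1)] unfolding W'_def by blast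
    then have "F \<subseteq> D - W'" using F(1)[OF FK(1)] by blast
    then obtain K' where K': "K' \<in> comps (D - W')" "F \<subseteq> K'"
      using conn_subset_comps[OF F(2)[OF FK(1)]] by metis
    have KK: "K \<in> comps (D - W')" using FK(2) by (simp add: \<K>_def)
    show ?thesis
    proof (cases "K = K'")
      case False
      then have *: "K \<inter> K' = {}" "K \<inter> N K' = {}" using apartD[OF apart_comps KK K'(1)] by auto
      have "N F \<subseteq> K' \<union> N K'" using N_subset K'(2) .
      then show ?thesis using * K'(2) by blast
    qed (use K' in simp)
  next
    case False
    then have "N F \<subseteq> W'" using FK(1) unfolding W'_def by blast
    then have KNF: "K \<inter> N F = {}" using Ksub[OF FK(2)] by blast
    moreover have "\<not> K \<subseteq> F" using FK lives_mono unfolding \<K>_def by blast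
    ultimately show ?thesis using conn_dichotomy[OF Kconn[OF FK(2)] KNF] by blast
  qed
  \<comment> \<open>A tight region inside a kept component gives way to that component.\<close>
  define \<G> where "\<G> = \<K> \<union> {F \<in> \<F>. \<forall>K\<in>\<K>. \<not> F \<subseteq> K}"
  have \<Psi>E: "\<psi> \<in> graph_ends G" if "\<psi> \<in> \<Psi>" for \<psi> using that \<Psi> by blast
  show ?thesis
  proof (rule that[of \<G>])
    show "apart \<G>" unfolding apart_def
    proof (intro ballI impI)
      fix A B assume AB: "A \<in> \<G>" "B \<in> \<G>" "A \<noteq> B"
      consider "A \<in> \<K>" "B \<in> \<K>" | "A \<in> \<F>" "B \<in> \<F>" | "A \<in> \<K>" "B \<in> \<F>" "\<not> B \<subseteq> A" |
        "A \<in> \<F>" "B \<in> \<K>" "\<not> A \<subseteq> B" using AB unfolding \<G>_def by blast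
      then show "A \<inter> (B \<union> N B) = {}"
      proof cases
        case 1 then show ?thesis using apartD[OF apart_comps[of "D - W'"], of A B] AB(3) unfolding \<K>_def by blast
      next
        case 2 then show ?thesis using apartD[OF \<F>(1)] AB(3) by blast
      next
        case 3 then show ?thesis using split by blast
      next
        case 4
        then have "B \<inter> (A \<union> N A) = {}" using split by blast
        then show ?thesis using Int_N_sym[of B A] by blast
      qed
    qed
    show "A \<subseteq> D \<and> conn A \<and> finite (N A)" if "A \<in> \<G>" for A
    proof (cases "A \<in> \<K>")
      case True then show ?thesis using Kconn Ksub Kfin by blast
    next
      case False
      then have "A \<in> \<F>" using that by (simp add: \<G>_def)
      then show ?thesis using F by blast
    qed
    show "card (N A) < card (N D) \<or> A \<inter> W = {} \<and> (\<forall>\<phi>\<in>Y. \<not> lives \<phi> A)" if A: "A \<in> \<G>" for A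
    proof (cases "A \<in> \<K>")
      case True
      then obtain C where C: "C \<in> comps (V - W)" "A \<subseteq> C" using inC by blast
      then have "\<forall>\<phi>\<in>Y. \<not> lives \<phi> A" using W(2) lives_mono by blast
      moreover have "A \<inter> W = {}" using Ksub[OF True] by (auto simp: W'_def)
      ultimately show ?thesis by blast
    next
      case False then show ?thesis using A \<F>(2) unfolding \<G>_def d_def by blast
    qed
    show "\<exists>\<omega>\<in>\<Psi>. lives \<omega> A \<and> min (card (N A)) (card (N D)) \<le> ell D \<omega>" if A: "A \<in> \<G>" for A
    proof (cases "A \<in> \<K>")
      case True
      then obtain \<omega> where \<omega>: "\<omega> \<in> \<Psi>" "lives \<omega> A" "\<forall>F\<in>\<F>. \<not> lives \<omega> F" by (auto simp: \<K>_def)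
      have "lives \<omega> D" using lives_mono[OF \<omega>(2)] Ksub[OF True] by blast
      then have "\<not> ell D \<omega> < d" using \<F>(3) \<omega> by blast
      then show ?thesis using \<omega> by (auto simp: d_def)
    next
      case False
      then have "tight_region \<Psi> D A" using A \<F>(2) unfolding \<G>_def by blast
      then show ?thesis unfolding tight_region_def by force
    qed
    \<comment> \<open>For a tight region this is \<open>ell_uncross\<close>. A kept component around
      \<open>\<psi>\<close> contains the tight region around \<open>\<psi>\<close>, and enlarging a
      region cannot increase \<open>ell\<close>.\<close>
    show "ell A \<psi> \<le> ell D \<psi>" if A: "A \<in> \<G>" "\<psi> \<in> \<Psi>" "lives \<psi> A" "ell D \<psi> < card (N D)" for A \<psi>
    proof -
      have un: "ell F \<psi> \<le> ell D \<psi>" if FF: "F \<in> \<F>" "lives \<psi> F" for F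
      proof -
        obtain \<omega> where "lives \<omega> F" "ell D \<omega> = card (N F)" using \<F>(2)[OF FF(1)] by (auto simp: tight_region_def)
        then show ?thesis using ell_uncross[OF D(2) F(1,3)[OF FF(1)]] FF(2) by simp
      qed
      show ?thesis
      proof (cases "A \<in> \<K>")
        case True
        have "lives \<psi> D" using lives_mono[OF A(3)] Ksub[OF True] by blast
        then obtain F where FF: "F \<in> \<F>" "lives \<psi> F" using \<F>(3) A(2,4) by (auto simp: d_def)
        then have "F \<inter> A \<noteq> {}" using lives_disjoint A(3) by blast
        then have "F \<subseteq> A" using split[OF FF(1) True] by blast
        then have "ell A \<psi> \<le> ell F \<psi>" using ell_mono F(3) FF by blast
        then show ?thesis using un[OF FF] by simp
      next
        case False then show ?thesis using A un unfolding \<G>_def by blast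
      qed
    qed
    show "\<exists>A\<in>\<G>. lives \<psi> A" if \<psi>: "\<psi> \<in> \<Psi>" "lives \<psi> D" for \<psi>
    proof (cases "\<exists>F\<in>\<F>. lives \<psi> F")
      case True
      then obtain F where FF: "F \<in> \<F>" "lives \<psi> F" by blast
      show ?thesis
      proof (cases "\<exists>K\<in>\<K>. F \<subseteq> K")
        case True
        then obtain K where "K \<in> \<K>" "F \<subseteq> K" by blast
        then show ?thesis using lives_mono[OF FF(2)] by (auto simp: \<G>_def)
      next
        case False then show ?thesis using FF by (auto simp: \<G>_def)
      qed
    next
      case False
      obtain A where A: "A \<subseteq> V" "finite (N A)" "lives \<psi> A" "A \<inter> W = {}" using W(3)[OF \<psi>(1)] by blast
      \<comment> \<open>An end in no tight region has to survive the enlargement of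
        \<open>W\<close>. Only tight regions that meet \<open>N A\<close> can put neighbours into
        \<open>A\<close>; these regions are finitely many, and their neighbours are removed.\<close>
      define Q where "Q = (\<Union>F\<in>{F \<in> \<F>. F \<inter> N A \<noteq> {}}. N F)"
      have Q: "finite Q" unfolding Q_def using finmeet[OF A(2)] F(3) by blast
      define A' where "A' = A \<inter> D - Q"
      have "N A' \<subseteq> N A \<union> N D \<union> Q" by (auto simp: A'_def N_iff)
      then have fA': "finite (N A')" using A(2) D(2) Q by (meson finite_Un finite_subset)
      have lA': "lives \<psi> A'" unfolding A'_def
        using lives_Diff_finite[OF \<Psi>E[OF \<psi>(1)] Q] lives_Int A(3) \<psi>(2) by blast
      have "v \<notin> W'" if v: "v \<in> A'" for v
      proof
        assume "v \<in> W'"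
        moreover have "v \<notin> W" "v \<notin> N D" using v A(4) N_Int_self(1)[of D] by (auto simp: A'_def)
        ultimately obtain F' where F': "F' \<in> \<F>" "F' \<inter> W \<noteq> {}" "v \<in> N F'" unfolding W'_def by blast
        obtain f where f: "f \<in> F'" "adj f v" using F'(3) by (auto simp: N_iff)
        have vA: "v \<in> A" "v \<notin> Q" using v by (auto simp: A'_def)
        have "F' \<inter> N A \<noteq> {}"
        proof (cases "f \<in> A")
          case True
          obtain w where "w \<in> F'" "w \<in> W" using F'(2) by blast
          then show ?thesis using conn_meets_N[OF F(2)[OF F'(1)] f(1) True, of w] A(4) by blast
        next
          case False
          then have "f \<in> N A" using in_N[of v A f] vA adj_sym f(2) by blast
          then show ?thesis using f by blast
        qed
        then show False using vA(2) F' unfolding Q_def by blast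
      qed
      then have A'sub: "A' \<subseteq> D - W'" by (auto simp: A'_def)
      obtain L where L: "L \<subseteq> A'" "conn L" "lives \<psi> L"
        by (rule lives_conn_part[OF \<Psi>E[OF \<psi>(1)] fA' lA' order_trans[OF A'sub DW']])
      obtain K where K: "K \<in> comps (D - W')" "L \<subseteq> K"
        using conn_subset_comps[OF L(2), of "D - W'"] L(1) A'sub by blast
      then have "K \<in> \<K>" using lives_mono[OF L(3)] \<psi>(1) False unfolding \<K>_def by blast
      then show ?thesis using lives_mono[OF L(3) K(2)] by (auto simp: \<G>_def)
    qed
  qed
qed

end


section \<open>Tree-decompositions over rooted trees\<close>

locale td = sgraph G + rtree M r par lev
  for G :: "'v graph" and M :: "'n set" and r par lev +
  fixes B :: "'n \<Rightarrow> 'v set"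
  assumes td: "tree_decomposition G T B"
    and fin_adh: "\<And>y. y \<in> M \<Longrightarrow> y \<noteq> r \<Longrightarrow> finite (B y \<inter> B (par y))"
begin

definition above :: "'n \<Rightarrow> 'v set" where
  "above y = side_part T B (par y) y - adhesion_set B {par y, y}"

lemma adh: "adhesion_set B {par y, y} = B y \<inter> B (par y)" "adhesion_set B {y, par y} = B y \<inter> B (par y)"
  by (auto simp: adhesion_set_def)

lemma bag_verts: "t \<in> M \<Longrightarrow> B t \<subseteq> V"
  using td by (auto simp: tree_decomposition_def)

lemma bag_cover: "v \<in> V \<Longrightarrow> \<exists>t\<in>M. v \<in> B t"
  using td by (auto simp: tree_decomposition_def induced_subgraph_def)

lemma bag_edge: assumes "adj u v" shows "\<exists>t\<in>M. u \<in> B t \<and> v \<in> B t"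
proof -
  have "{u, v} \<in> (\<Union>t\<in>M. edges (induced_subgraph G (B t)))"
    using assms td unfolding adj_def tree_decomposition_def by auto
  then show ?thesis by (auto simp: induced_subgraph_def)
qed

lemma bag_conn: "v \<in> V \<Longrightarrow> T.conn {t \<in> M. v \<in> B t}"
  using td by (auto simp: tree_decomposition_def T.connected_induced Int_absorb1)

text \<open>The nodes whose bags contain \<open>v\<close> form a connected set in \<open>T\<close>
  that meets both sides of the edge below \<open>y\<close>, so it contains both ends of that
  edge.\<close>

lemma bag_cross:
  assumes "v \<in> B t" "v \<in> B t'" "t \<in> up y" "t' \<in> M - up y" "y \<in> M" "y \<noteq> r"
  shows "v \<in> B y \<inter> B (par y)"
proof -
  have tM: "t \<in> M" using assms up_in by blast
  have v: "v \<in> V" using bag_verts[OF tM] assms by blast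
  have "T.reach {t \<in> M. v \<in> B t} t' t" using T.connD[OF bag_conn[OF v]] assms tM by blast
  moreover have "T.reach {t \<in> M. v \<in> B t} t t'" using T.connD[OF bag_conn[OF v]] assms tM by blast
  moreover have "T.N (M - up y) \<subseteq> {y}" by (rule N_down)
  ultimately have "\<exists>w\<in>{t \<in> M. v \<in> B t}. w \<in> T.N (up y)" "\<exists>w\<in>{t \<in> M. v \<in> B t}. w \<in> T.N (M - up y)"
    "T.N (M - up y) \<subseteq> {y}"
    using T.reach_meets_N[of "{t \<in> M. v \<in> B t}" t t' "up y"]
      T.reach_meets_N[of "{t \<in> M. v \<in> B t}" t' t "M - up y"] assms(3,4) by simp_all
  then show ?thesis unfolding N_up[OF assms(5,6)] by blast
qed

lemma side_up: "y \<in> M \<Longrightarrow> y \<noteq> r \<Longrightarrow> side_part T B (par y) y = (\<Union>t\<in>up y. B t)"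
  by (simp add: side_part_def edge_side_up)

lemma side_down: "y \<in> M \<Longrightarrow> y \<noteq> r \<Longrightarrow> side_part T B y (par y) = (\<Union>t\<in>M - up y. B t)"
  by (simp add: side_part_def edge_side_up)

lemma side_Int: 
  assumes "y \<in> M" "y \<noteq> r"
  shows "side_part T B (par y) y \<inter> side_part T B y (par y) = B y \<inter> B (par y)"
proof
  show "side_part T B (par y) y \<inter> side_part T B y (par y) \<subseteq> B y \<inter> B (par y)"
    using bag_cross assms unfolding side_up[OF assms] side_down[OF assms] by blast
  show "B y \<inter> B (par y) \<subseteq> side_part T B (par y) y \<inter> side_part T B y (par y)"
    unfolding side_up[OF assms] side_down[OF assms] using up_self[of y] par_notin_up[OF assms] par_in assms by blast
qed

lemma side_Un: 
  assumes "y \<in> M" "y \<noteq> r"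
  shows "side_part T B (par y) y \<union> side_part T B y (par y) = V"
proof
  show "V \<subseteq> side_part T B (par y) y \<union> side_part T B y (par y)"
    unfolding side_up[OF assms] side_down[OF assms] using bag_cover by blast
  show "side_part T B (par y) y \<union> side_part T B y (par y) \<subseteq> V"
    unfolding side_up[OF assms] side_down[OF assms] using bag_verts up_in by blast
qed

lemma above_eq: "y \<in> M \<Longrightarrow> y \<noteq> r \<Longrightarrow> above y = (\<Union>t\<in>up y. B t) - (B y \<inter> B (par y))"
  by (simp add: above_def side_up adh)

lemma above_verts: assumes "y \<in> M" "y \<noteq> r" shows "above y \<subseteq> V"
  using side_Un[OF assms] by (auto simp: above_def)

lemma above_notin: 
  assumes "v \<in> above y" "y \<in> M" "y \<noteq> r" "t \<in> M" "v \<in> B t" shows "t \<in> up y"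
proof (rule ccontr)
  assume "t \<notin> up y"
  moreover obtain s where "s \<in> up y" "v \<in> B s" "v \<notin> B y \<inter> B (par y)"
    using assms(1) unfolding above_eq[OF assms(2,3)] by blast
  ultimately show False using bag_cross[of v s t y] assms by blast
qed

text \<open>Free of adhesion sets, this description reduces monotonicity and disjointness of the
  upper parts to the tree order.\<close>

lemma above_iff: 
  assumes "v \<in> V" "y \<in> M" "y \<noteq> r" shows "v \<in> above y \<longleftrightarrow> (\<forall>t\<in>M. v \<in> B t \<longrightarrow> t \<in> up y)"
proof
  show "v \<in> above y \<Longrightarrow> \<forall>t\<in>M. v \<in> B t \<longrightarrow> t \<in> up y" using above_notin assms by blast
  assume *: "\<forall>t\<in>M. v \<in> B t \<longrightarrow> t \<in> up y"
  then have "v \<notin> B (par y)" using par_notin_up par_in assms by blast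
  moreover obtain t where "t \<in> M" "v \<in> B t" using bag_cover assms by blast
  ultimately show "v \<in> above y" using * above_eq[OF assms(2,3)] by blast
qed

lemma above_mono: 
  assumes "z \<in> up y" "y \<in> M" "y \<noteq> r" "z \<noteq> r" shows "above z \<subseteq> above y"
proof
  fix v assume v: "v \<in> above z"
  have zM: "z \<in> M" using assms up_in by blast
  then have "v \<in> V" using above_verts v assms by blast
  then show "v \<in> above y" using v above_iff[OF _ zM] above_iff[of v y] assms up_trans by blast
qed

lemma above_disjoint: 
  assumes "y \<in> M" "y \<noteq> r" "z \<in> M" "z \<noteq> r" "lev y = lev z" "y \<noteq> z" shows "above y \<inter> above z = {}"
proof (rule equals0I)
  fix v assume v: "v \<in> above y \<inter> above z"
  then have "v \<in> V" using above_verts assms by blast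
  then obtain t where "t \<in> M" "v \<in> B t" using bag_cover by blast
  then have "t \<in> up y" "t \<in> up z" using v above_notin assms by blast+
  then show False using up_disjoint assms by blast
qed

lemma N_above: assumes "y \<in> M" "y \<noteq> r" shows "N (above y) \<subseteq> B y \<inter> B (par y)"
proof
  fix v assume "v \<in> N (above y)"
  then obtain u where u: "v \<notin> above y" "u \<in> above y" "adj u v" by (auto simp: N_iff)
  obtain t where t: "t \<in> M" "u \<in> B t" "v \<in> B t" using bag_edge[OF u(3)] by blast
  then have "t \<in> up y" using above_notin u assms by blast
  then show "v \<in> B y \<inter> B (par y)" using u(1) t above_eq[OF assms] by blast
qed

lemma fin_N_above: "y \<in> M \<Longrightarrow> y \<noteq> r \<Longrightarrow> finite (N (above y))"
  using N_above fin_adh finite_subset by blast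

section \<open>Orientations of tree edges by ends, and their targets\<close>

lemma oriented_up:
  assumes "y \<in> M" "y \<noteq> r" "\<epsilon> \<in> graph_ends G"
  shows "oriented_to G T B \<epsilon> (par y) y \<longleftrightarrow> lives \<epsilon> (above y)"
proof -
  define S where "S = B y \<inter> B (par y)"
  have fS: "finite S" using fin_adh assms by (simp add: S_def)
  have "ecomp S \<epsilon> \<inter> S = {}" using ecomp_facts(2)[OF assms(3) fS] .
  then have "ecomp S \<epsilon> \<subseteq> side_part T B (par y) y \<longleftrightarrow> ecomp S \<epsilon> \<subseteq> above y"
    unfolding above_def adh S_def by blast
  then show ?thesis using ecomp_subset_iff[OF assms(3) fS, of "above y"] N_above[OF assms(1,2)]
    by (simp add: oriented_to_def adh S_def)
qed

text \<open>\<open>oriented_to\<close> does not by definition choose exactly one direction. It does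
  because the component of the end avoids the adhesion set and therefore lies strictly on one
  side.\<close>

lemma oriented_down:
  assumes "y \<in> M" "y \<noteq> r" "\<epsilon> \<in> graph_ends G"
  shows "oriented_to G T B \<epsilon> y (par y) \<longleftrightarrow> \<not> lives \<epsilon> (above y)"
proof -
  define S where "S = B y \<inter> B (par y)"
  have fS: "finite S" using fin_adh assms by (simp add: S_def)
  define K where "K = ecomp S \<epsilon>"
  have K: "K \<inter> S = {}" "conn K" "K \<subseteq> V" using ecomp_facts[OF assms(3) fS] by (auto simp: K_def)
  have "K \<subseteq> side_part T B y (par y) \<longleftrightarrow> \<not> K \<subseteq> above y"
  proof
    assume K2: "K \<subseteq> side_part T B y (par y)"
    show "\<not> K \<subseteq> above y"
    proof
      assume "K \<subseteq> above y"
      then have "K \<subseteq> S" using K2 side_Int[OF assms(1,2)] unfolding above_def S_def by blast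
      then show False using K(1,2) by (auto simp: conn_def)
    qed
  next
    assume "\<not> K \<subseteq> above y"
    then have "K \<inter> above y = {}"
      using conn_dichotomy[OF K(2), of "above y"] N_above[OF assms(1,2)] K(1) unfolding S_def by blast
    then show "K \<subseteq> side_part T B y (par y)"
      using K(1,3) side_Un[OF assms(1,2)] unfolding above_def adh S_def by blast
  qed
  moreover have "K \<subseteq> above y \<longleftrightarrow> lives \<epsilon> (above y)"
    unfolding K_def using ecomp_subset_iff[OF assms(3) fS, of "above y"] N_above[OF assms(1,2)]
    by (simp add: S_def)
  ultimately show ?thesis by (simp add: oriented_to_def adh S_def K_def)
qed

definition side :: "'n + (nat \<Rightarrow> 'n) set \<Rightarrow> 'n \<Rightarrow> bool" where
  "side z y = (case z of Inl t \<Rightarrow> t \<in> up y | Inr \<omega> \<Rightarrow> T.lives \<omega> (up y))"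

lemma on_side_up:
  assumes "z \<in> Inl ` M \<union> Inr ` graph_ends T" "y \<in> M" "y \<noteq> r"
  shows "on_side T (par y) y z \<longleftrightarrow> side z y" "on_side T y (par y) z \<longleftrightarrow> \<not> side z y"
proof -
  have fin: "finite (T.N (M - up y))" using finite_subset[OF N_down] by simp
  have "on_side T (par y) y z \<longleftrightarrow> side z y \<and> True"
    using assms(1) T.lives_iff_ray[OF _ N_up_finite[OF assms(2)]]
    by (auto simp: on_side_def side_def edge_side_up[OF assms(2,3)])
  then show "on_side T (par y) y z \<longleftrightarrow> side z y" by simp
  have "T.lives \<omega> (M - up y) \<longleftrightarrow> \<not> T.lives \<omega> (up y)" if \<omega>: "\<omega> \<in> graph_ends T" for \<omega>
  proof
    show "T.lives \<omega> (M - up y) \<Longrightarrow> \<not> T.lives \<omega> (up y)" using T.lives_disjoint by blast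
    assume "\<not> T.lives \<omega> (up y)"
    then have "T.lives \<omega> (M - up y - T.N (up y))" using T.lives_far[OF \<omega> N_up_finite[OF assms(2)]] by simp
    then show "T.lives \<omega> (M - up y)" by (rule T.lives_mono) blast
  qed
  then show "on_side T y (par y) z \<longleftrightarrow> \<not> side z y"
    using assms(1) T.lives_iff_ray[OF _ fin]
    by (auto simp: on_side_def side_def edge_side_up[OF assms(2,3)])
qed

text \<open>The upper ends of all edges that the end orients upwards, with the root added because it
  has no edge below it. These nodes form a chain closed downwards: it meets all levels and
  determines an end of \<open>T\<close>, or it has a highest node.\<close>

definition branch :: "(nat \<Rightarrow> 'v) set \<Rightarrow> 'n set" where
  "branch \<epsilon> = {y \<in> M. y = r \<or> lives \<epsilon> (above y)}"

text \<open>Turns the condition on all ordered edges in \<open>end_target\<close> into one equation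
  between sets of nodes, for which \<open>side_inj\<close> gives uniqueness.\<close>

lemma target_iff:
  assumes "\<epsilon> \<in> graph_ends G" "z \<in> Inl ` M \<union> Inr ` graph_ends T"
  shows "(\<forall>x y. {x, y} \<in> edges T \<longrightarrow> (oriented_to G T B \<epsilon> x y \<longleftrightarrow> on_side T x y z)) \<longleftrightarrow>
    branch \<epsilon> = {y \<in> M. side z y}"
proof -
  have side_r: "side z r" using assms(2) up_root T.lives_verts by (auto simp: side_def)
  have "(\<forall>x y. {x, y} \<in> edges T \<longrightarrow> (oriented_to G T B \<epsilon> x y \<longleftrightarrow> on_side T x y z)) \<longleftrightarrow>
    (\<forall>y\<in>M - {r}. lives \<epsilon> (above y) \<longleftrightarrow> side z y)"
  proof
    assume *: "\<forall>x y. {x, y} \<in> edges T \<longrightarrow> (oriented_to G T B \<epsilon> x y \<longleftrightarrow> on_side T x y z)"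
    show "\<forall>y\<in>M - {r}. lives \<epsilon> (above y) \<longleftrightarrow> side z y"
    proof
      fix y assume y: "y \<in> M - {r}"
      then have "{par y, y} \<in> edges T" using T_adj_par by (auto simp: T.adj_def)
      then have "oriented_to G T B \<epsilon> (par y) y \<longleftrightarrow> on_side T (par y) y z" using * by blast
      then show "lives \<epsilon> (above y) \<longleftrightarrow> side z y"
        using oriented_up[of y \<epsilon>] on_side_up(1)[OF assms(2), of y] assms(1) y by simp
    qed
  next
    assume *: "\<forall>y\<in>M - {r}. lives \<epsilon> (above y) \<longleftrightarrow> side z y"
    show "\<forall>x y. {x, y} \<in> edges T \<longrightarrow> (oriented_to G T B \<epsilon> x y \<longleftrightarrow> on_side T x y z)"
    proof (intro allI impI)
      fix x y assume "{x, y} \<in> edges T"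
      then consider "x \<in> M - {r}" "y = par x" | "y \<in> M - {r}" "x = par y"
        using T_adj by (auto simp: T.adj_def)
      then show "oriented_to G T B \<epsilon> x y \<longleftrightarrow> on_side T x y z"
      proof cases
        case 1
        then show ?thesis
          using * oriented_down[of x \<epsilon>] on_side_up(2)[OF assms(2), of x] assms(1) by simp
      next
        case 2
        then show ?thesis
          using * oriented_up[of y \<epsilon>] on_side_up(1)[OF assms(2), of y] assms(1) by simp
      qed
    qed
  qed
  also have "\<dots> \<longleftrightarrow> branch \<epsilon> = {y \<in> M. side z y}" using side_r by (auto simp: branch_def)
  finally show ?thesis .
qed

lemma side_inj:
  assumes "z \<in> Inl ` M \<union> Inr ` graph_ends T" "z' \<in> Inl ` M \<union> Inr ` graph_ends T"
    "{y \<in> M. side z y} = {y \<in> M. side z' y}"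
  shows "z = z'"
proof -
  have S: "side z y \<longleftrightarrow> side z' y" if "y \<in> M" for y using assms(3) that by blast
  \<comment> \<open>A node is not above any node of higher level, whereas an end lives above a node
    of every level.\<close>
  have ne: False if t: "t \<in> M" "\<omega> \<in> graph_ends T" "\<And>y. y \<in> M \<Longrightarrow> t \<in> up y \<longleftrightarrow> T.lives \<omega> (up y)" for t \<omega>
  proof -
    obtain y where "y \<in> M" "lev y = Suc (lev t)" "T.lives \<omega> (up y)" using T_end_level t(2) by blast
    then show False using t(3)[of y] up_lev[of t y] by auto
  qed
  show ?thesis
  proof (cases z; cases z')
    fix t t' assume z: "z = Inl t" "z' = Inl t'"
    then have "t \<in> M" "t' \<in> M" using assms by auto
    then show ?thesis using S[of t] S[of t'] z up_self up_antisym by (auto simp: side_def)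
  next
    fix t \<omega> assume "z = Inl t" "z' = Inr \<omega>"
    then show ?thesis using S assms ne[of t \<omega>] by (auto simp: side_def)
  next
    fix t \<omega> assume "z = Inr \<omega>" "z' = Inl t"
    then show ?thesis using S assms ne[of t \<omega>] by (auto simp: side_def)
  next
    fix \<omega> \<omega>' assume "z = Inr \<omega>" "z' = Inr \<omega>'"
    then show ?thesis using S assms T_ends_eqI[of \<omega> \<omega>'] by (auto simp: side_def)
  qed
qed

lemma branch_root: "r \<in> branch \<epsilon>"
  using root_in by (simp add: branch_def)

lemma branch_down: "z \<in> branch \<epsilon> \<Longrightarrow> z \<in> up y \<Longrightarrow> y \<in> branch \<epsilon>"
proof -
  assume z: "z \<in> branch \<epsilon>" "z \<in> up y"
  have yM: "y \<in> M" using up_in[OF z(2)] by simp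
  show ?thesis
  proof (cases "y = r")
    case False
    then have "z \<noteq> r" using root_notin_up[OF yM] z(2) by blast
    then have "lives \<epsilon> (above z)" "above z \<subseteq> above y"
      using z above_mono[OF z(2) yM False] by (auto simp: branch_def)
    then show ?thesis using lives_mono yM by (simp add: branch_def)
  qed (use yM in \<open>simp add: branch_def\<close>)
qed

lemma branch_unique:
  assumes "y \<in> branch \<epsilon>" "z \<in> branch \<epsilon>" "lev y = lev z" shows "y = z"
proof (cases "y = r \<or> z = r")
  case True
  then show ?thesis using assms lev_0_iff lev_root by (auto simp: branch_def)
next
  case False
  then show ?thesis using assms above_disjoint[of y z] lives_disjoint[of \<epsilon> "above y" "above z"]
    by (auto simp: branch_def)
qed

lemma branch_level_le:
  assumes "z \<in> branch \<epsilon>" "n \<le> lev z" shows "\<exists>y\<in>branch \<epsilon>. lev y = n \<and> z \<in> up y"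
proof -
  have zM: "z \<in> M" using assms by (simp add: branch_def)
  define y where "y = (par ^^ (lev z - n)) z"
  have "z \<in> up y" "lev y = n" unfolding y_def using up_anc[OF zM] lev_anc[OF zM] assms by auto
  then show ?thesis using branch_down[OF assms(1)] by blast
qed

lemma branch_linear: 
  assumes "y \<in> branch \<epsilon>" "z \<in> branch \<epsilon>" "lev y \<le> lev z" shows "z \<in> up y"
proof -
  obtain w where "w \<in> branch \<epsilon>" "lev w = lev y" "z \<in> up w" using branch_level_le[OF assms(2,3)] by blast
  then show ?thesis using branch_unique assms(1) by metis
qed

lemma branch_end:
  assumes "\<forall>n. \<exists>y\<in>branch \<epsilon>. lev y = n"
  shows "\<exists>\<omega>\<in>graph_ends T. branch \<epsilon> = {y \<in> M. side (Inr \<omega>) y}"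
proof -
  obtain y where y: "\<And>n. y n \<in> branch \<epsilon> \<and> lev (y n) = n" using assms by metis
  have "par (y (Suc n)) = y n" for n
  proof -
    have "y (Suc n) \<in> M" using y by (simp add: branch_def)
    then have "par (y (Suc n)) \<in> branch \<epsilon>" "lev (par (y (Suc n))) = n"
      using branch_down[OF _ up_child, of "y (Suc n)" \<epsilon>] y[of "Suc n"] lev_par[of "y (Suc n)"] by auto
    then show ?thesis using branch_unique y by metis
  qed
  moreover have "y n \<in> M" for n using y by (auto simp: branch_def)
  ultimately obtain \<omega> where \<omega>: "\<omega> \<in> graph_ends T" "\<And>n. T.lives \<omega> (up (y n))"
    using T_end_of_branch[of y] y by blast
  have "x \<in> branch \<epsilon> \<longleftrightarrow> x \<in> M \<and> T.lives \<omega> (up x)" for x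
  proof
    assume x: "x \<in> branch \<epsilon>"
    then have "x = y (lev x)" using branch_unique y by metis
    then show "x \<in> M \<and> T.lives \<omega> (up x)" using \<omega>(2) x by (metis (mono_tags, lifting) branch_def mem_Collect_eq)
  next
    assume x: "x \<in> M \<and> T.lives \<omega> (up x)"
    then obtain w where "w \<in> up x" "w \<in> up (y (lev x))" using \<omega>(2) T.lives_disjoint by blast
    then have "x = y (lev x)" using up_disjoint y by metis
    then show "x \<in> branch \<epsilon>" using y by metis
  qed
  then show ?thesis using \<omega>(1) by (intro bexI[of _ \<omega>]) (auto simp: side_def)
qed

lemma branch_node:
  assumes "\<not> (\<forall>n. \<exists>y\<in>branch \<epsilon>. lev y = n)"
  shows "\<exists>t\<in>M. branch \<epsilon> = {y \<in> M. side (Inl t) y}"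
proof -
  obtain n where n: "\<And>y. y \<in> branch \<epsilon> \<Longrightarrow> lev y \<noteq> n" using assms by blast
  have bound: "lev y < n" if "y \<in> branch \<epsilon>" for y
  proof (rule ccontr)
    assume "\<not> lev y < n"
    then have "n \<le> lev y" by simp
    then show False using branch_level_le[OF that] n by blast
  qed
  obtain t where t: "t \<in> branch \<epsilon>" "\<And>y. y \<in> branch \<epsilon> \<Longrightarrow> lev y \<le> lev t"
    using ex_has_greatest_nat[of "\<lambda>y. y \<in> branch \<epsilon>" r lev n] bound branch_root by (metis less_imp_le)
  have "branch \<epsilon> = {y \<in> M. t \<in> up y}"
    using branch_linear[OF _ t(1)] t branch_down up_in by blast
  then show ?thesis using up_in t branch_def by (intro bexI[of _ t]) (auto simp: side_def)
qed

lemma end_target: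
  assumes "\<epsilon> \<in> graph_ends G"
  shows "end_target G T B \<epsilon> \<in> Inl ` M \<union> Inr ` graph_ends T"
    and "branch \<epsilon> = {y \<in> M. side (end_target G T B \<epsilon>) y}"
proof -
  have "\<exists>z\<in>Inl ` M \<union> Inr ` graph_ends T. branch \<epsilon> = {y \<in> M. side z y}"
    using branch_end[of \<epsilon>] branch_node[of \<epsilon>] by (cases "\<forall>n. \<exists>y\<in>branch \<epsilon>. lev y = n") blast+
  then obtain z where z: "z \<in> Inl ` M \<union> Inr ` graph_ends T" "branch \<epsilon> = {y \<in> M. side z y}" by blast
  have "end_target G T B \<epsilon> = z"
    unfolding end_target_def
  proof (rule the_equality)
    show "z \<in> Inl ` verts T \<union> Inr ` graph_ends T \<and>
     (\<forall>x y. {x, y} \<in> edges T \<longrightarrow> oriented_to G T B \<epsilon> x y = on_side T x y z)"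
      using target_iff[OF assms z(1)] z by simp
    fix w assume "w \<in> Inl ` verts T \<union> Inr ` graph_ends T \<and>
     (\<forall>x y. {x, y} \<in> edges T \<longrightarrow> oriented_to G T B \<epsilon> x y = on_side T x y w)"
    then have w: "w \<in> Inl ` M \<union> Inr ` graph_ends T"
      "\<forall>x y. {x, y} \<in> edges T \<longrightarrow> oriented_to G T B \<epsilon> x y = on_side T x y w" by simp_all
    have b: "branch \<epsilon> = {y \<in> M. side w y}" using target_iff[OF assms w(1)] w(2) by blast
    show "w = z" by (rule side_inj[OF w(1) z(1) trans[OF b[symmetric] z(2)]])
  qed
  then show "end_target G T B \<epsilon> \<in> Inl ` M \<union> Inr ` graph_ends T"
    "branch \<epsilon> = {y \<in> M. side (end_target G T B \<epsilon>) y}" using z by auto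
qed

lemma boundary_iff:
  assumes "\<epsilon> \<in> graph_ends G"
  shows "\<epsilon> \<in> boundary G T B \<longleftrightarrow> (\<forall>n. \<exists>y\<in>branch \<epsilon>. lev y = n)"
proof -
  have "end_target G T B \<epsilon> \<in> Inr ` graph_ends T \<longleftrightarrow> (\<forall>n. \<exists>y\<in>branch \<epsilon>. lev y = n)"
  proof
    assume "end_target G T B \<epsilon> \<in> Inr ` graph_ends T"
    then obtain \<omega> where "\<omega> \<in> graph_ends T" "end_target G T B \<epsilon> = Inr \<omega>" by blast
    then show "\<forall>n. \<exists>y\<in>branch \<epsilon>. lev y = n"
      using end_target(2)[OF assms] T_end_level[of \<omega>] by (auto simp: side_def)
  next
    assume "\<forall>n. \<exists>y\<in>branch \<epsilon>. lev y = n"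
    then obtain \<omega> where "\<omega> \<in> graph_ends T" "branch \<epsilon> = {y \<in> M. side (Inr \<omega>) y}" using branch_end by blast
    then show "end_target G T B \<epsilon> \<in> Inr ` graph_ends T"
      using end_target[OF assms] side_inj[of "end_target G T B \<epsilon>" "Inr \<omega>"] by auto
  qed
  then show ?thesis using assms by (simp add: boundary_def)
qed

text \<open>The open set with index \<open>n\<close> uses level \<open>Suc n\<close>, as the root
  has no edge below it. A vertex is not in all of them: if it is in the bag of \<open>t\<close>,
  then it can be strictly above only edges whose upper end is at most as high as
  \<open>t\<close>.\<close>

lemma gdelta_boundary: "gdelta_in (end_space G) (Inr ` boundary G T B)"
proof -
  define U where "U n = (\<Union>y\<in>{y \<in> M. lev y = Suc n}. hat (above y))" for n
  have lev_r: "y \<noteq> r" if "lev y = Suc n" for y n using that lev_root by auto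
  have op: "openin (end_space G) (U n)" for n unfolding U_def
    using openin_hat[OF fin_N_above above_verts] lev_r by (intro openin_Union) blast
  have "\<Inter>(range U) = Inr ` boundary G T B"
  proof (intro equalityI subsetI)
    fix x assume x: "x \<in> \<Inter>(range U)"
    show "x \<in> Inr ` boundary G T B"
    proof (cases x)
      case (Inl v)
      have "\<exists>y\<in>M. lev y = Suc n \<and> v \<in> above y" for n
        using x Inl unfolding U_def hat_def by blast
      then have *: "\<exists>y\<in>M. y \<noteq> r \<and> lev y = Suc n \<and> v \<in> above y" for n using lev_r by blast
      then have "v \<in> V" using above_verts by blast
      then obtain t where t: "t \<in> M" "v \<in> B t" using bag_cover by blast
      obtain y where "y \<in> M" "y \<noteq> r" "lev y = Suc (lev t)" "v \<in> above y" using * by blast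
      then have "t \<in> up y" using above_notin t by blast
      then show ?thesis using up_lev \<open>lev y = Suc (lev t)\<close> by fastforce
    next
      case (Inr \<epsilon>)
      have *: "\<exists>y\<in>M. lev y = Suc n \<and> lives \<epsilon> (above y) \<and> \<epsilon> \<in> graph_ends G" for n
        using x Inr unfolding U_def hat_def by blast
      then have "\<exists>y\<in>branch \<epsilon>. lev y = n" for n
        using branch_root lev_root unfolding branch_def by (cases n) blast+
      then show ?thesis using * Inr boundary_iff by blast
    qed
  next
    fix x :: "'v + (nat \<Rightarrow> 'v) set" assume "x \<in> Inr ` boundary G T B"
    then obtain \<epsilon> where \<epsilon>: "x = Inr \<epsilon>" "\<epsilon> \<in> boundary G T B" by blast
    then have E: "\<epsilon> \<in> graph_ends G" by (simp add: boundary_def)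
    have "x \<in> U n" for n :: nat
    proof -
      obtain y where y: "y \<in> branch \<epsilon>" "lev y = Suc n" using boundary_iff[OF E] \<epsilon>(2) by blast
      then have "lives \<epsilon> (above y)" "y \<in> M" using lev_r by (auto simp: branch_def)
      then show ?thesis using y E \<epsilon>(1) by (auto simp: U_def hat_def)
    qed
    then show "x \<in> \<Inter>(range U)" by blast
  qed
  moreover have "gdelta_in (end_space G) (\<Inter>(range U))"
    by (rule gdelta_in_Inter) (use op in \<open>auto intro: open_imp_gdelta_in\<close>)
  ultimately show ?thesis by simp
qed

end

text \<open>The notion of displaying refers to no root, so any node may be chosen as one.\<close>

lemma tree_decomposition_gdelta:
  assumes "simple_graph G" "tree_decomposition G T B" "finite_adhesion T B" "displays G T B \<Psi>"
  shows "gdelta_in (end_space G) (Inr ` \<Psi>)"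
proof -
  have tree: "tree T" using assms(2) by (simp add: tree_decomposition_def)
  then have "verts T \<noteq> {}" by (simp add: tree_def connected_graph_def)
  then obtain r where "r \<in> verts T" by blast
  then obtain par lev where R: "rtree (verts T) r par lev" "T = rtree.T (verts T) r par"
    using tree_is_rtree[OF tree] by blast
  interpret rt: rtree "verts T" r par lev by fact
  interpret td G "verts T" r par lev B
  proof unfold_locales
    show "simple_graph G" by fact
    show "tree_decomposition G rt.T B" using assms(2) R(2) by simp
    fix y assume y: "y \<in> verts T" "y \<noteq> r"
    then have "{y, par y} \<in> edges T" using rt.edges_T R(2) by auto
    then show "finite (B y \<inter> B (par y))" using assms(3) by (auto simp: finite_adhesion_def adhesion_set_def)
  qed
  show ?thesis using gdelta_boundary assms(4) R(2) by (simp add: displays_def)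
qed


section \<open>Tree-decompositions from nested regions\<close>

text \<open>A ray is built through the sets. A finite path is kept whose only vertex in some
  \<open>D m\<close> is its last one; a later set has lost this vertex and is reached by prolonging
  the path inside \<open>D m\<close>. So the new part misses the old path, and the limit is a ray
  with a tail in every \<open>D n\<close>.\<close>

lemma (in sgraph) end_of_decreasing:
  assumes conn: "\<And>n. conn (D n)" and dec: "\<And>n. D (Suc n) \<subseteq> D n" and fin: "\<And>n. finite (N (D n))"
    and van: "\<And>v. v \<in> D 0 \<Longrightarrow> \<exists>n. v \<notin> D n"
  shows "\<exists>\<epsilon>\<in>graph_ends G. \<forall>n. lives \<epsilon> (D n)"
proof -
  have dec': "D n \<subseteq> D m" if "m \<le> n" for m n using lift_Suc_antimono_le[of D m n] dec that by blast
  have ne: "D n \<noteq> {}" "D n \<subseteq> V" for n using conn by (auto simp: conn_def)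
  \<comment> \<open>The index \<open>m\<close> may run ahead of \<open>n\<close>, since several sets
    may have to be skipped until the last vertex is lost.\<close>
  define P where "P n p \<longleftrightarrow> graph_path G p \<and> (\<exists>m\<ge>n. last p \<in> D m \<and> set (butlast p) \<inter> D m = {})" for n p
  have "\<exists>f. \<forall>n. P n (f n) \<and> (\<exists>t. f (Suc n) = f n @ t \<and> t \<noteq> [] \<and> set t \<subseteq> D n)"
  proof (rule dependent_nat_choice)
    obtain x where "x \<in> D 0" using ne by blast
    then have "P 0 [x]" using ne(2)[of 0] by (auto simp: P_def graph_path_def)
    then show "\<exists>p. P 0 p" by blast
  next
    fix p n assume "P n p"
    then obtain m where p: "graph_path G p" and m: "m \<ge> n" "last p \<in> D m" "set (butlast p) \<inter> D m = {}"
      by (auto simp: P_def)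
    define x where "x = last p"
    have pne: "p \<noteq> []" using p by (auto simp: graph_path_def)
    obtain m' where m': "x \<notin> D m'" using van[of x] m dec'[of 0 m] by (auto simp: x_def)
    have mm': "m < m'"
    proof (rule ccontr)
      assume "\<not> m < m'"
      then show False using dec'[of m' m] m m' by (auto simp: x_def)
    qed
    obtain z where z: "z \<in> D m'" using ne by blast
    then have "reach (D m) x z" using connD[OF conn] m dec'[of m m'] mm' by (auto simp: x_def)
    then obtain q where q: "AB_path G {x} (D m') q" "set q \<subseteq> D m"
      using AB_path_exists[of "D m" x z "{x}" "D m'"] z ne(2) by blast
    have q': "graph_path G q" "hd q = x" "set q \<inter> D m' = {last q}" "q \<noteq> []"
      using q(1) AB_path_ne[OF q(1)] by (auto simp: AB_path_def)
    obtain t where t: "q = x # t" using q'(2,4) by (cases q) auto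
    have lq: "last q \<in> D m'" using q'(3) by blast
    have tne: "t \<noteq> []"
    proof
      assume "t = []"
      then have "last q = x" using t by simp
      then show False using lq m' by simp
    qed
    have "set p = insert x (set (butlast p))" using pne append_butlast_last_id[OF pne]
      by (metis x_def Un_insert_right list.simps(15) set_append sup_bot_right set_empty2)
    then have dis: "set p \<inter> set t = {}"
      using m(3) q(2) q'(1) t by (auto simp: graph_path_def)
    have gp: "graph_path G (p @ t)" using graph_path_append[OF p _ dis] q'(1) t by (simp add: x_def)
    have "set (butlast (p @ t)) \<inter> D m' = {}"
    proof -
      have bl: "butlast (p @ t) = p @ butlast t" using tne by (simp add: butlast_append)
      have "set p \<inter> D m' = {}" using \<open>set p = insert x (set (butlast p))\<close> m' m(3) dec'[of m m'] mm' by auto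
      moreover have "set (butlast t) \<inter> D m' = {}"
      proof -
        have "last q \<notin> set (butlast t)"
          using q'(1) t tne append_butlast_last_id[OF tne]
          by (metis distinct.simps(2) distinct_append graph_path_def last_ConsR not_distinct_conv_prefix)
        moreover have "set (butlast t) \<subseteq> set q" using t in_set_butlastD by fastforce
        ultimately show ?thesis using Int_singleton_disjoint[OF q'(3)] by blast
      qed
      ultimately show ?thesis using bl by auto
    qed
    moreover have "last (p @ t) \<in> D m'" using lq t tne by simp
    ultimately have "P (Suc n) (p @ t)" using gp mm' m(1) unfolding P_def by (intro conjI exI[of _ m']) auto
    moreover have "set t \<subseteq> D n" using q(2) t dec'[OF m(1)] by auto
    ultimately show "\<exists>p'. P (Suc n) p' \<and> (\<exists>t. p' = p @ t \<and> t \<noteq> [] \<and> set t \<subseteq> D n)" using tne by blast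
  qed
  then obtain f where f: "\<And>n. graph_path G (f n)" "\<And>n. \<exists>t. f (Suc n) = f n @ t \<and> t \<noteq> [] \<and> set t \<subseteq> D n"
    unfolding P_def by blast
  have len: "n < length (f n)" for n
  proof (induction n)
    case 0 then show ?case using f(1)[of 0] by (auto simp: graph_path_def)
  next
    case (Suc n)
    obtain t where "f (Suc n) = f n @ t" "t \<noteq> []" using f(2) by blast
    then show ?case using Suc by (cases t) auto
  qed
  have ext: "\<exists>t. f m = f n @ t \<and> set t \<subseteq> D n" if "n \<le> m" for m n
    using that
  proof (induction m rule: dec_induct)
    case base then show ?case by auto
  next
    case (step k)
    then obtain t where t: "f k = f n @ t" "set t \<subseteq> D n" by blast
    obtain t' where t': "f (Suc k) = f k @ t'" "set t' \<subseteq> D k" using f(2) by blast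
    show ?case using t t' dec'[OF step(1)] by (intro exI[of _ "t @ t'"]) auto
  qed
  \<comment> \<open>\<open>f i\<close> has more than \<open>i\<close> entries and all later paths
    extend it, so the diagonal entry is final.\<close>
  define R where "R i = f i ! i" for i
  have R: "R i = f m ! i" if "i \<le> m" for i m
    using ext[OF that] len[of i] by (auto simp: R_def nth_append)
  have d: "distinct (f m)" for m using f(1)[of m] by (simp add: graph_path_def)
  have "inj R"
  proof (rule linorder_injI)
    fix i j :: nat assume ij: "i < j"
    then have "f j ! i \<noteq> f j ! j" using nth_eq_iff_index_eq[OF d, of i j j] len[of j] by simp
    then show "R i \<noteq> R j" using R[of i j] R[of j j] ij by simp
  qed
  moreover have "R i \<in> V" for i using f(1)[of i] len[of i] unfolding R_def graph_path_def by auto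
  moreover have "{R i, R (Suc i)} \<in> edges G" for i
    using f(1)[of "Suc i"] len[of "Suc i"] R[of i "Suc i"] R[of "Suc i" "Suc i"]
      successively_nth[of _ "f (Suc i)" i] by (auto simp: graph_path_def)
  ultimately have "ray G R" by (auto simp: ray_def)
  then obtain \<epsilon> where \<epsilon>: "\<epsilon> \<in> graph_ends G" "R \<in> \<epsilon>" using end_of_ray by blast
  have "ev R (D n)" for n
  proof -
    have "R i \<in> D n" if i: "i \<ge> length (f n)" for i
    proof -
      have "n \<le> i" using len[of n] i by simp
      then obtain t where t: "f i = f n @ t" "set t \<subseteq> D n" using ext by blast
      then have "R i = t ! (i - length (f n))" "i - length (f n) < length t"
        using i len[of i] by (auto simp: R_def nth_append)
      then show ?thesis using t(2) by auto
    qed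
    then show ?thesis by (auto simp: eventually_sequentially)
  qed
  then show ?thesis using \<epsilon> lives_iff_ev fin by blast
qed

section \<open>Bags obtained from nested regions\<close>

locale regions = sgraph G + rtree M r par lev
  for G :: "'v graph" and M :: "'n set" and r par lev +
  fixes reg :: "'n \<Rightarrow> 'v set"
  assumes reg_root: "reg r = V"
    and reg_step: "\<And>x. x \<in> M \<Longrightarrow> x \<noteq> r \<Longrightarrow> conn (reg x) \<and> finite (N (reg x)) \<and> reg x \<subseteq> reg (par x)"
    and reg_apart: "\<And>x y. x \<in> M \<Longrightarrow> y \<in> M \<Longrightarrow> lev x = lev y \<Longrightarrow> x \<noteq> y \<Longrightarrow> reg x \<inter> (reg y \<union> N (reg y)) = {}"
    and reg_vanish: "\<And>v. v \<in> V \<Longrightarrow> \<exists>n. \<forall>x\<in>M. lev x = n \<longrightarrow> v \<notin> reg x"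
begin

text \<open>The vertices that no child region takes, together with the neighbours of the region.
  With the latter included, the bags of a node \<open>x\<close> other than the root and of its
  parent intersect exactly in \<open>N (reg x)\<close>.\<close>

definition bag :: "'n \<Rightarrow> 'v set" where
  "bag x = N (reg x) \<union> (reg x - \<Union>{reg y | y. y \<in> M \<and> y \<noteq> r \<and> par y = x})"

lemma reg_verts: "x \<in> M \<Longrightarrow> reg x \<subseteq> V"
  using reg_step[of x] reg_root unfolding conn_def by (cases "x = r") auto

lemma N_reg_root: "N (reg r) = {}"
  using N_verts[of V] N_Int_self(1)[of V] reg_root by auto

lemma reg_mono: "y \<in> up x \<Longrightarrow> reg y \<subseteq> reg x"
proof (induction rule: up_induct)
  case (step y)
  then show ?case using reg_step[of y] up_in up_par(2) by blast
qed simp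

lemma reg_apart': "x \<in> M \<Longrightarrow> y \<in> M \<Longrightarrow> lev x = lev y \<Longrightarrow> v \<in> reg x \<Longrightarrow> v \<in> reg y \<union> N (reg y) \<Longrightarrow> x = y"
  using reg_apart by blast

lemma anc_level:
  assumes "x \<in> M" "n \<le> lev x" obtains y where "y \<in> M" "lev y = n" "x \<in> up y"
proof -
  define y where "y = (par ^^ (lev x - n)) x"
  have "x \<in> up y" "lev y = n" unfolding y_def using up_anc lev_anc assms by auto
  then show ?thesis using that up_in by blast
qed

text \<open>Each vertex has exactly one such node: one exists by \<open>reg_vanish\<close>, and
  regions of the same level are disjoint. It is the lowest node whose bag contains the vertex; the
  further bags contain it as a neighbour of their regions.\<close>

definition is_top :: "'n \<Rightarrow> 'v \<Rightarrow> bool" where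
  "is_top t v \<longleftrightarrow> t \<in> M \<and> v \<in> reg t \<and> (\<forall>y\<in>M. y \<noteq> r \<longrightarrow> par y = t \<longrightarrow> v \<notin> reg y)"

lemma is_top_up:
  assumes "is_top t v" "x \<in> M" "v \<in> reg x" shows "t \<in> up x"
proof (cases "lev x \<le> lev t")
  case True
  have tM: "t \<in> M" using assms by (simp add: is_top_def)
  obtain y where y: "y \<in> M" "lev y = lev x" "t \<in> up y" using anc_level[OF tM True] .
  then have "v \<in> reg y" using assms reg_mono by (auto simp: is_top_def)
  then show ?thesis using reg_apart'[of x y v] y assms by auto
next
  case False
  obtain y where y: "y \<in> M" "lev y = lev t" "x \<in> up y" using anc_level[OF assms(2), of "lev t"] False by auto
  then have "v \<in> reg y" using assms reg_mono by auto
  then have "y = t" using reg_apart'[of y t v] y assms by (auto simp: is_top_def)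
  moreover have "x \<noteq> t" using False by auto
  ultimately obtain w where "w \<in> M" "w \<noteq> r" "par w = t" "x \<in> up w" using up_to_child y by metis
  then show ?thesis using assms reg_mono by (auto simp: is_top_def)
qed

lemma is_top_unique: "is_top t v \<Longrightarrow> is_top t' v \<Longrightarrow> t = t'"
  using is_top_up[of t v t'] is_top_up[of t' v t] up_antisym by (auto simp: is_top_def)

lemma is_top_exists: assumes "v \<in> V" obtains t where "is_top t v"
proof -
  obtain n where n: "\<And>x. x \<in> M \<Longrightarrow> lev x = n \<Longrightarrow> v \<notin> reg x" using reg_vanish assms by blast
  have bound: "lev x < n" if x: "x \<in> M \<and> v \<in> reg x" for x
  proof (rule ccontr)
    assume "\<not> lev x < n"
    then obtain y where "y \<in> M" "lev y = n" "x \<in> up y" using anc_level[of x n] x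
      by (metis not_less)
    then show False using n reg_mono x by blast
  qed
  have "r \<in> M \<and> v \<in> reg r" using root_in reg_root assms by simp
  then obtain t where t: "t \<in> M \<and> v \<in> reg t" "\<And>x. x \<in> M \<and> v \<in> reg x \<Longrightarrow> lev x \<le> lev t"
    using ex_has_greatest_nat[of "\<lambda>x. x \<in> M \<and> v \<in> reg x" r lev n] bound by (metis less_imp_le)
  have "is_top t v" unfolding is_top_def
  proof (intro conjI ballI impI notI)
    fix y assume y: "y \<in> M" "y \<noteq> r" "par y = t" "v \<in> reg y"
    then show False using t(2)[of y] par_step[of y] by auto
  qed (use t in auto)
  then show ?thesis using that by blast
qed

lemma bag_iff: "x \<in> M \<Longrightarrow> v \<in> bag x \<longleftrightarrow> v \<in> N (reg x) \<or> is_top x v"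
  by (auto simp: bag_def is_top_def)

lemma bag_par:
  assumes "x \<in> M" "x \<noteq> r" "v \<in> N (reg x)" shows "v \<in> bag (par x)"
proof -
  have px: "par x \<in> M" using assms par_in by blast
  have "v \<in> reg (par x) \<union> N (reg (par x))"
    using reg_step[OF assms(1,2)] assms(3) in_N[of _ "reg (par x)" v] by (fastforce simp: N_iff)
  moreover have "is_top (par x) v" if "v \<in> reg (par x)" unfolding is_top_def
  proof (intro conjI ballI impI notI)
    fix y assume y: "y \<in> M" "y \<noteq> r" "par y = par x" "v \<in> reg y"
    then have "lev y = lev x" using par_step[of y] par_step[of x] assms by auto
    then have "y = x" using reg_apart'[of y x v] y assms by auto
    then show False using y assms(3) by (auto simp: N_iff)
  qed (use px that in auto)
  ultimately show ?thesis using bag_iff[OF px] by blast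
qed

lemma bag_subset: "x \<in> M \<Longrightarrow> bag x \<subseteq> V"
  using reg_verts N_verts by (auto simp: bag_def)

text \<open>From any other node whose bag contains \<open>v\<close>, passing to parents stays among
  such nodes until the top node of \<open>v\<close> is reached.\<close>

lemma bag_connected:
  assumes "v \<in> V" shows "T.conn {t \<in> M. v \<in> bag t}"
proof -
  obtain t where t: "is_top t v" using is_top_exists assms .
  then have tM: "t \<in> {t \<in> M. v \<in> bag t}" using bag_iff by (auto simp: is_top_def)
  have "x \<in> M \<Longrightarrow> v \<in> bag x \<longrightarrow> T.reach {t \<in> M. v \<in> bag t} t x" for x
  proof (induction rule: level_induct)
    case root
    show ?case using bag_iff[OF root_in, of v] N_reg_root is_top_unique[OF t] T.reach_refl[OF tM] by auto
  next
    case (step x)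
    show ?case
    proof
      assume v: "v \<in> bag x"
      show "T.reach {t \<in> M. v \<in> bag t} t x"
      proof (cases "is_top x v")
        case True then show ?thesis using is_top_unique[OF t True] T.reach_refl[OF tM] by simp
      next
        case False
        then have "v \<in> bag (par x)" using bag_iff v step bag_par by blast
        then show ?thesis using T.reach_step[of _ t "par x" x] step v T_adj_par by blast
      qed
    qed
  qed
  then show ?thesis using T.connI_from[of "{t \<in> M. v \<in> bag t}" t] tM by auto
qed

text \<open>Of the two top nodes, the one of higher level has both ends of the edge in its bag: the
  other end is in the region, and then has the same top node, or it is a neighbour of the
  region.\<close>

lemma bag_edges:
  assumes "adj u v" shows "\<exists>t\<in>M. u \<in> bag t \<and> v \<in> bag t"
proof -
  have *: "\<exists>t\<in>M. u \<in> bag t \<and> v \<in> bag t"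
    if uv: "adj u v" "is_top s u" "is_top t v" "lev t \<le> lev s" for u v s t
  proof -
    have s: "s \<in> M" "u \<in> reg s" "u \<in> bag s" using uv bag_iff[of s u] by (auto simp: is_top_def)
    have "v \<in> bag s"
    proof (cases "v \<in> reg s")
      case True
      then have "t \<in> up s" using is_top_up uv s by blast
      then have "t = s" using up_eqI uv(4) by blast
      then show ?thesis using uv bag_iff s by blast
    next
      case False
      then show ?thesis using in_N[of u "reg s" v] s uv(1) bag_iff by blast
    qed
    then show ?thesis using s by blast
  qed
  obtain s where s: "is_top s u" using is_top_exists adj_verts(1)[OF assms] .
  obtain t where t: "is_top t v" using is_top_exists adj_verts(2)[OF assms] .
  show ?thesis using *[OF assms s t] *[OF adj_sym[OF assms] t s] by (cases "lev t \<le> lev s") auto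
qed

lemma bag_tree_decomposition: "tree_decomposition G T bag"
  unfolding tree_decomposition_def
proof (intro conjI ballI)
  show "tree T" by (rule tree_T)
  show "bag t \<subseteq> V" if "t \<in> verts T" for t using that bag_subset by simp
  have "\<exists>t\<in>M. v \<in> bag t" if "v \<in> V" for v
  proof -
    obtain t where "is_top t v" using is_top_exists \<open>v \<in> V\<close> .
    then show ?thesis using bag_iff[of t v] by (auto simp: is_top_def)
  qed
  then show "V = (\<Union>t\<in>verts T. verts (induced_subgraph G (bag t)))"
    by (auto simp: induced_subgraph_def)
  show "edges G = (\<Union>t\<in>verts T. edges (induced_subgraph G (bag t)))"
  proof (intro equalityI subsetI)
    fix e assume e: "e \<in> edges G"
    then obtain u v where uv: "e = {u, v}" using simple by (auto simp: simple_graph_def)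
    then obtain t where "t \<in> M" "u \<in> bag t" "v \<in> bag t" using bag_edges e by (auto simp: adj_def)
    then show "e \<in> (\<Union>t\<in>verts T. edges (induced_subgraph G (bag t)))"
      using e uv by (auto simp: induced_subgraph_def)
  qed (auto simp: induced_subgraph_def)
  show "connected_graph (induced_subgraph T {t \<in> verts T. v \<in> bag t})" if "v \<in> V" for v
    using bag_connected[OF that] T.connected_induced[of "{t \<in> M. v \<in> bag t}"]
    by (simp add: Int_absorb1)
qed

lemma bag_Int:
  assumes "y \<in> M" "y \<noteq> r" shows "bag y \<inter> bag (par y) = N (reg y)"
proof
  show "N (reg y) \<subseteq> bag y \<inter> bag (par y)" using bag_par[OF assms] bag_iff[OF assms(1)] by blast
  show "bag y \<inter> bag (par y) \<subseteq> N (reg y)"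
  proof (clarify, rule ccontr)
    fix v assume v: "v \<in> bag y" "v \<in> bag (par y)" "v \<notin> N (reg y)"
    then have "v \<in> reg y" using bag_iff[OF assms(1)] by (auto simp: is_top_def)
    then have "v \<in> reg (par y)" using reg_step[OF assms] by blast
    then have "is_top (par y) v" using v(2) bag_iff[OF par_in[OF assms(1)]] by (auto simp: N_iff)
    then show False using \<open>v \<in> reg y\<close> assms by (auto simp: is_top_def)
  qed
qed

sublocale td G M r par lev bag
  by unfold_locales (auto simp: bag_tree_decomposition bag_Int reg_step)

text \<open>On every level up to that of \<open>y\<close>, a vertex of \<open>reg y\<close> lies in
  exactly one region and is not adjacent to the others. Hence none of its bags is outside
  \<open>up y\<close>.\<close>

lemma above_reg: assumes "y \<in> M" "y \<noteq> r" shows "above y = reg y"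
proof (intro equalityI subsetI)
  fix v assume v: "v \<in> above y"
  then have vV: "v \<in> V" using above_verts assms by blast
  obtain t where t: "is_top t v" using is_top_exists vV .
  then have "t \<in> M" "v \<in> bag t" using bag_iff[of t v] by (auto simp: is_top_def)
  then have "t \<in> up y" using above_notin v assms by blast
  then show "v \<in> reg y" using reg_mono t by (auto simp: is_top_def)
next
  fix v assume v: "v \<in> reg y"
  then have vV: "v \<in> V" using reg_verts assms by blast
  have "t \<in> up y" if t: "t \<in> M" "v \<in> bag t" for t
  proof (cases "is_top t v")
    case True then show ?thesis using is_top_up assms v by blast
  next
    case False
    then have vN: "v \<in> N (reg t)" using t bag_iff by blast
    show ?thesis
    proof (cases "lev y \<le> lev t")
      case True
      then obtain a where a: "a \<in> M" "lev a = lev y" "t \<in> up a" using anc_level t by metis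
      have "v \<in> reg a \<union> N (reg a)"
        using reg_mono[OF a(3)] vN in_N[of _ "reg a" v] by (fastforce simp: N_iff)
      then have "y = a" using reg_apart'[of y a v] a v assms by auto
      then show ?thesis using a by simp
    next
      case False
      then obtain b where b: "b \<in> M" "lev b = lev t" "y \<in> up b" using anc_level[OF assms(1), of "lev t"] by auto
      then have "v \<in> reg b" using v reg_mono by blast
      then have "b = t" using reg_apart'[of b t v] b t vN by auto
      then show ?thesis using \<open>v \<in> reg b\<close> vN by (auto simp: N_iff)
    qed
  qed
  then show "v \<in> above y" using above_iff[OF vV assms] by blast
qed

lemma part_above_reg: "y \<in> M \<Longrightarrow> y \<noteq> r \<Longrightarrow> part_above G T bag (par y) y = induced_subgraph G (reg y)"
  using above_reg unfolding part_above_def above_def by simp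

lemma V_Int_reg: "y \<in> M \<Longrightarrow> V \<inter> reg y = reg y"
  using reg_verts by blast

lemma componental_bag: "componental G T r bag"
  unfolding componental_def
proof (intro allI impI, elim conjE)
  fix x y assume "{x, y} \<in> edges T" "tree_less T r {x} {y}"
  then have y: "y \<in> M" "y \<noteq> r" "x = par y" using tree_less_node by blast+
  then show "connected_graph (part_above G T bag x y)"
    using part_above_reg connected_induced V_Int_reg reg_step by simp
qed

lemma tight_bag: "tight G T r bag"
  unfolding tight_def
proof (intro allI impI, elim conjE)
  fix x y assume "{x, y} \<in> edges T" "tree_less T r {x} {y}"
  then have y: "y \<in> M" "y \<noteq> r" "x = par y" using tree_less_node by blast+
  have "reg y \<in> comps (reg y)"
    using comps_eqI[of "reg y" "reg y"] reg_step[OF y(1,2)] reg_verts[OF y(1)] N_Int_self(1) by blast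
  then have "reg y \<in> graph_components (part_above G T bag x y)"
    using part_above_reg components_induced V_Int_reg y by simp
  moreover have "N (reg y) = adhesion_set bag {x, y}" using bag_Int[OF y(1,2)] adh y(3) by simp
  ultimately show "\<exists>C\<in>graph_components (part_above G T bag x y). N C = adhesion_set bag {x, y}" by blast
qed

lemma finite_adhesion_bag: "finite_adhesion T bag"
  unfolding finite_adhesion_def
proof
  fix e assume "e \<in> edges T"
  then obtain x where "x \<in> M" "x \<noteq> r" "e = {x, par x}" using edges_T by auto
  then show "finite (adhesion_set bag e)" using adh(2) fin_adh by simp
qed

end

text \<open>A region may have larger order than its parent, and then only the order of the parent
  bounds \<open>ell\<close> from below; hence the minimum in \<open>top_end\<close>. This suffices
  for linkedness, where the number of paths exceeds neither order at the last edge.\<close>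

locale linked_regions = regions G M r par lev reg
  for G :: "'v graph" and M :: "'n set" and r par lev and reg :: "'n \<Rightarrow> 'v set" +
  fixes \<Psi> :: "(nat \<Rightarrow> 'v) set set"
  assumes ends: "\<Psi> \<subseteq> graph_ends G"
    and top_end: "\<And>y. y \<in> M \<Longrightarrow> y \<noteq> r \<Longrightarrow> \<exists>\<omega>\<in>\<Psi>. lives \<omega> (reg y) \<and>
      min (card (N (reg y))) (card (N (reg (par y)))) \<le> ell (reg (par y)) \<omega>"
    and ell_step: "\<And>y \<psi>. y \<in> M \<Longrightarrow> y \<noteq> r \<Longrightarrow> \<psi> \<in> \<Psi> \<Longrightarrow> lives \<psi> (reg y) \<Longrightarrow>
      ell (reg (par y)) \<psi> < card (N (reg (par y))) \<Longrightarrow> ell (reg y) \<psi> \<le> ell (reg (par y)) \<psi>"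
    and ends_in: "\<And>\<psi> n. \<psi> \<in> \<Psi> \<Longrightarrow> \<exists>x\<in>M. lev x = n \<and> lives \<psi> (reg x)"
    and ends_only: "\<And>\<epsilon>. \<epsilon> \<in> graph_ends G \<Longrightarrow> (\<And>n. \<exists>x\<in>M. lev x = n \<and> lives \<epsilon> (reg x)) \<Longrightarrow> \<epsilon> \<in> \<Psi>"
begin

text \<open>A small separator \<open>S\<close> would make \<open>ell\<close> small along the whole path for an end \<open>\<omega>\<close> above its
  top edge, contradicting the choice of \<open>\<omega>\<close>.\<close>
lemma not_separated:
  assumes "x \<in> M" "x \<noteq> r" "y \<in> up x" "y \<noteq> x"
    and k: "\<And>z. z \<in> seg x y \<Longrightarrow> k \<le> card (N (reg z))"
    and S: "finite S" "card S < k"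
  shows "\<not> separates G S (N (reg x)) (N (reg y))"
proof
  assume sep: "separates G S (N (reg x)) (N (reg y))"
  have y: "y \<in> M" "y \<noteq> r" using up_in assms up_par(2) by (blast, metis)
  obtain \<omega> where \<omega>: "\<omega> \<in> \<Psi>" "lives \<omega> (reg y)"
    "min (card (N (reg y))) (card (N (reg (par y)))) \<le> ell (reg (par y)) \<omega>"
    using top_end[OF y] by blast
  have \<omega>E: "\<omega> \<in> graph_ends G" using ends \<omega> by blast
  define A where "A = ecomp S \<omega>"
  have A: "conn A" "A \<inter> S = {}" "N A \<subseteq> S" "A \<subseteq> V" "lives \<omega> A"
    using ecomp_facts[OF \<omega>E S(1)] ecomp(2)[OF \<omega>E S(1)] by (simp_all add: A_def)
  \<comment> \<open>\<open>A\<close> is connected and avoids \<open>S\<close>. If it left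
    \<open>reg x\<close>, it would meet both \<open>N (reg x)\<close> and \<open>N (reg y)\<close>
    and join them outside \<open>S\<close>.\<close>
  have "A \<subseteq> reg x"
  proof (rule ccontr)
    assume "\<not> A \<subseteq> reg x"
    then obtain w where w: "w \<in> A" "w \<notin> reg x" by blast
    obtain u where u: "u \<in> A" "u \<in> reg y" using lives_disjoint[OF A(5) \<omega>(2)] by blast
    have yx: "reg y \<subseteq> reg x" using reg_mono assms by blast
    obtain a where a: "a \<in> A" "a \<in> N (reg x)" using conn_meets_N[OF A(1) u(1) _ w] u yx by blast
    obtain b where b: "b \<in> A" "b \<in> N (reg y)" using conn_meets_N[OF A(1) u w(1)] w yx by blast
    have "reach (V - S) a b" using connD[OF A(1) a(1) b(1)] reach_mono A by blast
    then show False using sep a b by (auto simp: separates_iff)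
  qed
  then have "ell (reg x) \<omega> \<le> card (N A)" using ell_le A finite_subset S by metis
  then have base: "ell (reg x) \<omega> < k" using card_mono[OF S(1) A(3)] S(2) by simp
  \<comment> \<open>The bound is carried up to \<open>par y\<close> only; there it contradicts the
    choice of \<open>\<omega>\<close> for the edge below \<open>y\<close>.\<close>
  have "z \<in> up x \<Longrightarrow> par y \<in> up z \<longrightarrow> ell (reg z) \<omega> < k" for z
  proof (induction rule: up_induct)
    case base
    then show ?case using \<open>ell (reg x) \<omega> < k\<close> by blast
  next
    case (step z)
    show ?case
    proof
      assume z: "par y \<in> up z"
      have zM: "z \<in> M" "z \<noteq> r" using step up_in up_par(2) by blast+
      have pz: "par z \<in> up x" using step up_par by blast
      have yz: "y \<in> up z" using z up_child[OF y(1)] up_trans by blast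
      have "y \<in> up (par z)" "par y \<in> up (par z)" using up_trans up_child[OF zM(1)] yz z by blast+
      then have "ell (reg (par z)) \<omega> < k" "k \<le> card (N (reg (par z)))"
        using step pz k by (auto simp: seg_def)
      moreover have "lives \<omega> (reg z)" using lives_mono[OF \<omega>(2) reg_mono[OF yz]] .
      ultimately show "ell (reg z) \<omega> < k" using ell_step[OF zM \<omega>(1)] by simp
    qed
  qed
  moreover have py: "par y \<in> up x" using up_par(1)[OF assms(3,4)] .
  ultimately have "ell (reg (par y)) \<omega> < k" using up_self par_in y(1) by blast
  moreover have "k \<le> card (N (reg y))" "k \<le> card (N (reg (par y)))"
    using k seg_ends[OF assms(3)] py up_child[OF y(1)] by (auto simp: seg_def)
  ultimately show False using \<omega>(3) by simp
qed

lemma linked_bag: "linked G T r bag"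
  unfolding linked_def
proof (intro ballI allI impI, elim conjE)
  fix e f p assume e: "e \<in> edges T" and f: "f \<in> edges T" and ef: "tree_less T r e f" "minimal_path T e f p"
  obtain x where x: "x \<in> M" "x \<noteq> r" "e = {x, par x}" using e edges_T by auto
  obtain y where y: "y \<in> M" "y \<noteq> r" "f = {y, par y}" using f edges_T by auto
  have xy: "y \<in> up x" "x \<noteq> y" using tree_less_edge x y ef(1) by blast+
  have pe: "path_edges p = (\<lambda>z. {z, par z}) ` seg x y"
    using minimal_path_edges[OF x(1,2) xy(1)] ef(2) x(3) y(3) by blast
  have segM: "z \<in> M" "z \<noteq> r" if "z \<in> seg x y" for z
    using that up_in root_notin_up[OF x(1,2)] by (auto simp: seg_def)
  have adhz: "adhesion_set bag {z, par z} = N (reg z)" if "z \<in> M" "z \<noteq> r" for z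
    using adh(2) bag_Int that by simp
  define k where "k = Min ((\<lambda>g. card (adhesion_set bag g)) ` path_edges p)"
  have "path_edges p = (\<lambda>i. {p ! i, p ! Suc i}) ` {i. Suc i < length p}" by (auto simp: path_edges_def)
  moreover have "finite {i. Suc i < length p}" by (rule finite_subset[of _ "{..<length p}"]) auto
  ultimately have fin_pe: "finite (path_edges p)" by simp
  have k: "k \<le> card (N (reg z))" if "z \<in> seg x y" for z
  proof -
    have "card (adhesion_set bag {z, par z}) \<in> (\<lambda>g. card (adhesion_set bag g)) ` path_edges p"
      using pe that by blast
    then show ?thesis unfolding k_def adhz[OF segM[OF that], symmetric]
      using fin_pe by (intro Min_le) auto
  qed
  have "\<exists>P. linkage (N (reg x)) (N (reg y)) P \<and> card P = k"
    by (rule menger[OF N_verts N_verts]) (use not_separated[OF x(1,2) xy(1)] xy(2) k in blast)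
  then obtain P where P: "linkage (N (reg x)) (N (reg y)) P" "card P = k" by blast
  then show "\<exists>\<P>. finite \<P> \<and> card \<P> = Min ((\<lambda>g. card (adhesion_set bag g)) ` path_edges p) \<and>
      (\<forall>P\<in>\<P>. AB_path G (adhesion_set bag e) (adhesion_set bag f) P) \<and>
      (\<forall>P\<in>\<P>. \<forall>Q\<in>\<P>. P \<noteq> Q \<longrightarrow> set P \<inter> set Q = {})"
    using adhz x y unfolding linkage_def pairwise_def k_def by (intro exI[of _ P]) auto
qed

lemma branch_reg: "branch \<epsilon> = {y \<in> M. y = r \<or> lives \<epsilon> (reg y)}"
  unfolding branch_def by (rule Collect_cong) (metis above_reg)

lemma branch_reg': "\<epsilon> \<in> graph_ends G \<Longrightarrow> branch \<epsilon> = {y \<in> M. lives \<epsilon> (reg y)}"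
  using lives_verts reg_root by (auto simp: branch_reg)

text \<open>For injectivity, two ends with the same branch live in the same regions, which
  eventually avoid any finite set. For surjectivity, \<open>end_of_decreasing\<close> finds an end
  in the regions along a given end of \<open>T\<close>.\<close>

lemma displays_bag: "displays G T bag \<Psi>"
proof -
  have bd: "\<Psi> = boundary G T bag"
  proof (intro equalityI subsetI)
    fix \<psi> assume \<psi>: "\<psi> \<in> \<Psi>"
    then have "\<psi> \<in> graph_ends G" using ends by blast
    then show "\<psi> \<in> boundary G T bag" using boundary_iff branch_reg' ends_in[OF \<psi>] by blast
  next
    fix \<epsilon> assume \<epsilon>: "\<epsilon> \<in> boundary G T bag"
    then have E: "\<epsilon> \<in> graph_ends G" by (simp add: boundary_def)
    then show "\<epsilon> \<in> \<Psi>" using ends_only boundary_iff[OF E] branch_reg'[OF E] \<epsilon> by blast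
  qed
  have "inj_on (end_target G T bag) \<Psi>"
  proof (rule inj_onI)
    fix \<psi> \<phi> assume *: "\<psi> \<in> \<Psi>" "\<phi> \<in> \<Psi>" "end_target G T bag \<psi> = end_target G T bag \<phi>"
    then have E: "\<psi> \<in> graph_ends G" "\<phi> \<in> graph_ends G" using ends by auto
    have br: "branch \<psi> = branch \<phi>" using end_target(2)[OF E(1)] end_target(2)[OF E(2)] *(3) by simp
    show "\<psi> = \<phi>"
    proof (rule ends_eqI[OF E])
      fix S :: "'v set" assume S: "finite S"
      have "\<exists>n. \<forall>x\<in>M. lev x = n \<longrightarrow> v \<notin> reg x" for v using reg_vanish[of v] reg_verts by blast
      then obtain n where n: "\<And>v x. x \<in> M \<Longrightarrow> lev x = n v \<Longrightarrow> v \<notin> reg x" by metis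
      \<comment> \<open>\<open>Suc\<close> keeps \<open>x\<close> away from the root, whose region
        need not be connected; it does so also for empty \<open>S\<close>.\<close>
      define m where "m = Suc (Max (n ` S))"
      obtain x where x: "x \<in> M" "lev x = m" "lives \<psi> (reg x)" using ends_in[OF *(1)] by blast
      have "x \<noteq> r" using x lev_root by (auto simp: m_def)
      have "v \<notin> reg x" if v: "v \<in> S" for v
      proof
        assume vx: "v \<in> reg x"
        have "n v \<le> Max (n ` S)" using S v by simp
        then have "n v \<le> lev x" using x(2) by (simp add: m_def)
        then obtain y where "y \<in> M" "lev y = n v" "x \<in> up y" using anc_level[OF x(1)] by blast
        then show False using n reg_mono vx by blast
      qed
      moreover have "lives \<phi> (reg x)" using br x branch_reg' E by blast
      ultimately show "\<exists>A. conn A \<and> A \<inter> S = {} \<and> lives \<psi> A \<and> lives \<phi> A"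
        using x reg_step[OF x(1) \<open>x \<noteq> r\<close>] by blast
    qed
  qed
  moreover have "end_target G T bag ` \<Psi> = Inr ` graph_ends T"
  proof
    show "end_target G T bag ` \<Psi> \<subseteq> Inr ` graph_ends T" using bd by (auto simp: boundary_def)
    show "Inr ` graph_ends T \<subseteq> end_target G T bag ` \<Psi>"
    proof clarify
      fix \<omega> assume \<omega>: "\<omega> \<in> graph_ends T"
      obtain y where y: "\<And>n. y n \<in> M \<and> lev (y n) = n \<and> T.lives \<omega> (up (y n))"
        using T_end_level[OF \<omega>] by metis
      have uniq: "x = y (lev x)" if x: "x \<in> M" "T.lives \<omega> (up x)" for x
      proof -
        obtain w where "w \<in> up x" "w \<in> up (y (lev x))" using T.lives_disjoint[OF x(2)] y by blast
        then show ?thesis using up_disjoint y by metis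
      qed
      have par_y: "par (y (Suc n)) = y n" for n
      proof -
        have "T.lives \<omega> (up (par (y (Suc n))))"
          using T.lives_mono up_mono[OF up_child] y by blast
        then show ?thesis using uniq[of "par (y (Suc n))"] y[of "Suc n"] par_in lev_par[of "y (Suc n)"] by simp
      qed
      have nr: "y (Suc n) \<noteq> r" for n using y[of "Suc n"] lev_root by auto
      have "\<exists>\<epsilon>\<in>graph_ends G. \<forall>n. lives \<epsilon> (reg (y (Suc n)))"
      proof (rule end_of_decreasing)
        fix n
        show "conn (reg (y (Suc n)))" "finite (N (reg (y (Suc n))))" using reg_step nr y by blast+
        show "reg (y (Suc (Suc n))) \<subseteq> reg (y (Suc n))" using reg_step[OF _ nr] y par_y by metis
      next
        fix v assume "v \<in> reg (y (Suc 0))"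
        then have "v \<in> V" using reg_verts y by blast
        then obtain n where n: "\<And>x. x \<in> M \<Longrightarrow> lev x = n \<Longrightarrow> v \<notin> reg x" using reg_vanish by blast
        have "reg (y (Suc n)) \<subseteq> reg (y n)" using reg_step[OF _ nr] y par_y by metis
        then show "\<exists>n. v \<notin> reg (y (Suc n))" using n y by blast
      qed
      then obtain \<epsilon> where \<epsilon>: "\<epsilon> \<in> graph_ends G" "\<And>n. lives \<epsilon> (reg (y (Suc n)))" by blast
      have yb: "y n \<in> branch \<epsilon>" for n
      proof (cases n)
        case 0 then show ?thesis using y[of 0] lev_0_iff branch_root by auto
      next
        case (Suc m) then show ?thesis using \<epsilon> y branch_reg by blast
      qed
      have "\<epsilon> \<in> \<Psi>" using ends_only[OF \<epsilon>(1)] yb y branch_reg'[OF \<epsilon>(1)] by blast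
      moreover have "branch \<epsilon> = {x \<in> M. side (Inr \<omega>) x}"
      proof (intro equalityI subsetI)
        fix x assume x: "x \<in> branch \<epsilon>"
        then have "x = y (lev x)" using branch_unique yb y by metis
        then show "x \<in> {x \<in> M. side (Inr \<omega>) x}" using y by (metis (mono_tags, lifting) mem_Collect_eq side_def sum.simps(6))
      next
        fix x assume "x \<in> {x \<in> M. side (Inr \<omega>) x}"
        then have "x = y (lev x)" using uniq by (auto simp: side_def)
        then show "x \<in> branch \<epsilon>" using yb by metis
      qed
      then have "end_target G T bag \<epsilon> = Inr \<omega>"
        using side_inj[OF end_target(1)[OF \<epsilon>(1)], of "Inr \<omega>"] end_target(2)[OF \<epsilon>(1)] \<omega> by auto
      ultimately show "Inr \<omega> \<in> end_target G T bag ` \<Psi>" by force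
    qed
  qed
  ultimately show ?thesis using bd by (simp add: displays_def bij_betw_def)
qed

end


section \<open>Displaying countable intersections of open sets\<close>

context sgraph begin

lemma gdelta_envelopes:
  assumes "gdelta_in (end_space G) (Inr ` \<Psi>)" "\<Psi> \<subseteq> graph_ends G"
  shows "\<exists>C W. (\<forall>n. C (Suc n) \<subseteq> C n) \<and> \<Inter>(range C) = Inr ` \<Psi> \<and>
    (\<forall>n. W n \<subseteq> V \<and> (\<forall>v\<in>V. v \<notin> W n \<longrightarrow> Inl v \<in> C n) \<and>
      (\<forall>K\<in>comps (V - W n). finite (N K) \<and> (\<forall>\<phi>\<in>{\<phi> \<in> graph_ends G. Inr \<phi> \<notin> C n}. \<not> lives \<phi> K)) \<and>
      (\<forall>\<psi>\<in>\<Psi>. \<exists>A. A \<subseteq> V \<and> finite (N A) \<and> lives \<psi> A \<and> A \<inter> W n = {}))"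
proof -
  obtain C where C: "\<And>n. openin (end_space G) (C n)" "\<And>n. C (Suc n) \<subseteq> C n" "\<Inter>(range C) = Inr ` \<Psi>"
    using assms(1) unfolding gdelta_in_descending by blast
  define Q where "Q n W \<longleftrightarrow> {v \<in> V. Inl v \<notin> C n} \<subseteq> W \<and> W \<subseteq> V \<and>
    (\<forall>K\<in>comps (V - W). finite (N K) \<and> (\<forall>\<phi>\<in>{\<phi> \<in> graph_ends G. Inr \<phi> \<notin> C n}. \<not> lives \<phi> K)) \<and>
    (\<forall>\<psi>\<in>\<Psi>. \<exists>A. A \<subseteq> V \<and> finite (N A) \<and> lives \<psi> A \<and> A \<inter> W = {})" for n W
  have "\<exists>W. Q n W" for n
  proof -
    \<comment> \<open>The closed set to be enveloped is the complement of \<open>C n\<close>, split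
      into its vertices \<open>X\<close> and its ends \<open>Y\<close>.\<close>
    define X where "X = {v \<in> V. Inl v \<notin> C n}"
    define Y where "Y = {\<phi> \<in> graph_ends G. Inr \<phi> \<notin> C n}"
    have closed: "\<exists>A. A \<subseteq> V \<and> finite (N A) \<and> lives \<epsilon> A \<and> A \<inter> X = {} \<and> (\<forall>\<phi>\<in>Y. \<not> lives \<phi> A)"
      if \<epsilon>: "\<epsilon> \<in> graph_ends G" "\<epsilon> \<notin> Y" for \<epsilon>
    proof -
      have "Inr \<epsilon> \<in> C n" using \<epsilon> by (simp add: Y_def)
      then obtain A where A: "conn A" "finite (N A)" "lives \<epsilon> A" "hat A \<subseteq> C n"
        using open_contains_hat[OF C(1) _ \<epsilon>(1)] by blast
      have "A \<inter> X = {}" "\<forall>\<phi>\<in>Y. \<not> lives \<phi> A" using A(4) by (auto simp: hat_def X_def Y_def)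
      then show ?thesis using A(1-3) by (intro exI[of _ A]) (simp add: conn_def)
    qed
    obtain W where W: "X \<subseteq> W" "W \<subseteq> V"
      "\<And>K. K \<in> comps (V - W) \<Longrightarrow> finite (N K) \<and> (\<forall>\<phi>\<in>Y. \<not> lives \<phi> K)"
      "\<And>\<epsilon>. \<epsilon> \<in> graph_ends G \<Longrightarrow> \<epsilon> \<notin> Y \<Longrightarrow> \<exists>A. A \<subseteq> V \<and> finite (N A) \<and> lives \<epsilon> A \<and> A \<inter> W = {}"
      by (rule envelope[of X Y, OF _ _ closed]) (auto simp: X_def Y_def)
    have "\<psi> \<notin> Y" if "\<psi> \<in> \<Psi>" for \<psi>
    proof -
      have "Inr \<psi> \<in> \<Inter>(range C)" using that C(3) by blast
      then show ?thesis by (simp add: Y_def)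
    qed
    then have "\<forall>\<psi>\<in>\<Psi>. \<exists>A. A \<subseteq> V \<and> finite (N A) \<and> lives \<psi> A \<and> A \<inter> W = {}"
      using W(4) assms(2) by blast
    then have "Q n W" unfolding Q_def X_def[symmetric] Y_def[symmetric] using W(1-3) by blast
    then show ?thesis by blast
  qed
  then obtain W where W: "\<And>n. Q n (W n)" by metis
  have "Inl v \<in> C n" if "v \<in> V" "v \<notin> W n" for n v using W[of n] that unfolding Q_def by blast
  then show ?thesis using C(2,3) W unfolding Q_def by (intro exI[of _ C] exI[of _ W]) simp
qed

text \<open>The outcome of \<open>cut_region\<close> for one open set \<open>C\<close>; the envelope
  has served its purpose and is no longer mentioned.\<close>

definition cut :: "('v + (nat \<Rightarrow> 'v) set) set \<Rightarrow> (nat \<Rightarrow> 'v) set set \<Rightarrow> 'v set \<Rightarrow> 'v set set \<Rightarrow> bool" where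
  "cut C \<Psi> D \<G> \<longleftrightarrow> apart \<G> \<and>
    (\<forall>A\<in>\<G>. A \<subseteq> D \<and> conn A \<and> finite (N A) \<and> (card (N A) < card (N D) \<or> hat A \<subseteq> C) \<and>
      (\<exists>\<omega>\<in>\<Psi>. lives \<omega> A \<and> min (card (N A)) (card (N D)) \<le> ell D \<omega>) \<and>
      (\<forall>\<psi>\<in>\<Psi>. lives \<psi> A \<longrightarrow> ell D \<psi> < card (N D) \<longrightarrow> ell A \<psi> \<le> ell D \<psi>)) \<and>
    (\<forall>\<psi>\<in>\<Psi>. lives \<psi> D \<longrightarrow> (\<exists>A\<in>\<G>. lives \<psi> A))"

lemma not_always_decreasing: "\<exists>m\<ge>n. \<not> f (Suc m) < (f m :: nat)"
proof (rule ccontr)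
  assume "\<not> ?thesis"
  then have d: "f (Suc m) < f m" if "m \<ge> n" for m using that by blast
  have "f (n + i) + i \<le> f n" for i
  proof (induction i)
    case (Suc i) then show ?case using d[of "n + i"] by simp
  qed simp
  from this[of "Suc (f n)"] show False by simp
qed

end

locale cutting = sgraph G for G :: "'v graph" +
  fixes \<Psi> :: "(nat \<Rightarrow> 'v) set set" and C :: "nat \<Rightarrow> ('v + (nat \<Rightarrow> 'v) set) set"
    and g :: "nat \<Rightarrow> 'v set \<Rightarrow> 'v set set"
  assumes \<Psi>: "\<Psi> \<subseteq> graph_ends G"
    and C_dec: "\<And>n. C (Suc n) \<subseteq> C n" and C_Int: "\<Inter>(range C) = Inr ` \<Psi>"
    and g: "\<And>n D. D \<subseteq> V \<Longrightarrow> finite (N D) \<Longrightarrow> cut (C n) \<Psi> D (g n D)"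
begin

primrec L :: "nat \<Rightarrow> 'v set set" where
  "L 0 = {V}"
| "L (Suc n) = (\<Union>D\<in>L n. g n D)"

lemma N_V: "N V = {}"
  using N_verts[of V] N_Int_self(1)[of V] by auto

lemma L_region: "D \<in> L n \<Longrightarrow> D \<subseteq> V \<and> finite (N D)"
proof (induction n arbitrary: D)
  case 0 then show ?case by (simp add: N_V)
next
  case (Suc n)
  then obtain D' where "D' \<in> L n" "D \<in> g n D'" by auto
  then show ?case using Suc.IH[of D'] g[of D' n] unfolding cut_def by blast
qed

lemma L_cut: "D \<in> L n \<Longrightarrow> cut (C n) \<Psi> D (g n D)"
  using L_region g by blast

lemma g_sub: "D \<in> L n \<Longrightarrow> A \<in> g n D \<Longrightarrow> A \<subseteq> D \<and> conn A \<and> finite (N A)"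
  using L_cut unfolding cut_def by blast

lemma L_apart: "apart (L n)"
proof (induction n)
  case 0 then show ?case by (simp add: apart_def)
next
  case (Suc n)
  show ?case unfolding apart_def
  proof (intro ballI impI)
    fix A B assume AB: "A \<in> L (Suc n)" "B \<in> L (Suc n)" "A \<noteq> B"
    obtain D where D: "D \<in> L n" "A \<in> g n D" using AB by auto
    obtain E where E: "E \<in> L n" "B \<in> g n E" using AB by auto
    show "A \<inter> (B \<union> N B) = {}"
    proof (cases "D = E")
      case True
      have "apart (g n D)" using L_cut[OF D(1)] by (simp add: cut_def)
      then show ?thesis using apartD D(2) E(2) True AB(3) by blast
    next
      case False
      then have "D \<inter> E = {}" "D \<inter> N E = {}" using apartD[OF Suc.IH D(1) E(1)] by auto
      moreover have "A \<subseteq> D" "B \<subseteq> E" using g_sub D E by auto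
      moreover then have "N B \<subseteq> E \<union> N E" using N_subset by blast
      ultimately show ?thesis by blast
    qed
  qed
qed

lemma L_unique: "D \<in> L n \<Longrightarrow> E \<in> L n \<Longrightarrow> v \<in> D \<Longrightarrow> v \<in> E \<union> N E \<Longrightarrow> D = E"
  using apartD[OF L_apart] by blast

text \<open>Orders cannot decrease for ever, so a nested sequence of regions lies in infinitely many
  \<open>C n\<close>.\<close>
lemma branch_in_C:
  assumes "\<And>n. D n \<in> L n" "\<And>n. D (Suc n) \<in> g n (D n)" "\<And>n. x \<in> hat (D n)" shows "x \<in> Inr ` \<Psi>"
proof -
  have "x \<in> C n" for n
  proof -
    obtain m where m: "m \<ge> n" "\<not> card (N (D (Suc m))) < card (N (D m))"
      using not_always_decreasing[of n "\<lambda>m. card (N (D m))"] by blast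
    then have "hat (D (Suc m)) \<subseteq> C m" using L_cut[OF assms(1)] assms(2) unfolding cut_def by blast
    moreover have "C m \<subseteq> C n" using lift_Suc_antimono_le[of C, OF C_dec m(1)] .
    ultimately show ?thesis using assms(3) by blast
  qed
  then show ?thesis using C_Int by blast
qed

lemma L_parent: "A \<in> L (Suc n) \<Longrightarrow> \<exists>D\<in>L n. A \<in> g n D"
  by auto

text \<open>The region from which \<open>D (Suc n)\<close> was cut contains it and thus meets
  \<open>D n\<close>; as regions of one level are disjoint, it equals \<open>D n\<close>.\<close>

lemma L_branch:
  assumes "\<And>n. D n \<in> L n" "\<And>n. D n \<inter> D (Suc n) \<noteq> {}" shows "D (Suc n) \<in> g n (D n)"
proof -
  obtain E where E: "E \<in> L n" "D (Suc n) \<in> g n E" using L_parent assms(1) by blast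
  then have "D (Suc n) \<subseteq> E" using g_sub by blast
  then have "E = D n" using L_unique[OF E(1) assms(1)] assms(2) by blast
  then show ?thesis using E by simp
qed

lemma L_vanish: assumes "v \<in> V" shows "\<exists>n. \<forall>D\<in>L n. v \<notin> D"
proof (rule ccontr)
  assume "\<not> ?thesis"
  then have "\<forall>n. \<exists>D. D \<in> L n \<and> v \<in> D" by blast
  then obtain D where D: "\<And>n. D n \<in> L n" "\<And>n. v \<in> D n" by metis
  have "Inl v \<in> Inr ` \<Psi>"
  proof (rule branch_in_C[of D])
    show "D (Suc n) \<in> g n (D n)" for n by (rule L_branch[of D]) (use D in blast)+
  qed (use D in \<open>auto simp: hat_def\<close>)
  then show False by blast
qed

lemma L_ends_only:
  assumes "\<epsilon> \<in> graph_ends G" "\<And>n. \<exists>D\<in>L n. lives \<epsilon> D" shows "\<epsilon> \<in> \<Psi>"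
proof -
  obtain D where D: "\<And>n. D n \<in> L n" "\<And>n. lives \<epsilon> (D n)" using assms(2) by metis
  have "(Inr \<epsilon> :: 'v + (nat \<Rightarrow> 'v) set) \<in> Inr ` \<Psi>"
  proof (rule branch_in_C[of D])
    show "D (Suc n) \<in> g n (D n)" for n
      by (rule L_branch[of D]) (use D lives_disjoint in blast)+
  qed (use D assms in \<open>auto simp: hat_def\<close>)
  then show ?thesis by blast
qed

lemma L_ends_in: "\<psi> \<in> \<Psi> \<Longrightarrow> \<exists>D\<in>L n. lives \<psi> D"
proof (induction n)
  case 0 then show ?case using lives_verts \<Psi> by auto
next
  case (Suc n)
  then obtain D where "D \<in> L n" "lives \<psi> D" by blast
  then obtain A where "A \<in> g n D" "lives \<psi> A" using L_cut[of D n] Suc.prems unfolding cut_def by blast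
  then show ?case using \<open>D \<in> L n\<close> by auto
qed

lemma linked_decomposition:
  assumes "infinite (UNIV :: 'n set)" "V \<lesssim> (UNIV :: 'n set)"
  shows "\<exists>(T :: 'n graph) r B. r \<in> verts T \<and> tree_decomposition G T B \<and>
              linked G T r B \<and> tight G T r B \<and> componental G T r B \<and>
              finite_adhesion T B \<and> displays G T B \<Psi>"
proof -
  define P where "P = {(n, D). D \<in> L n}"
  obtain f :: "'v \<Rightarrow> 'n" where f: "inj_on f V" using assms(2) by (auto simp: lepoll_def)
  \<comment> \<open>An infinite type absorbs the product with the naturals, which makes room for the
    level in the name of a node.\<close>
  have "\<exists>h :: nat \<times> 'n \<Rightarrow> 'n. inj_on h (UNIV \<times> UNIV) \<and> h ` (UNIV \<times> UNIV) \<subseteq> UNIV"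
    unfolding card_of_ordLeq
    using card_of_Times_infinite_simps(3)[of "UNIV :: 'n set" "UNIV :: nat set"] assms(1)
      infinite_iff_card_of_nat[of "UNIV :: 'n set"] ordIso_iff_ordLeq by blast
  then obtain h :: "nat \<times> 'n \<Rightarrow> 'n" where h: "inj h" by auto
  \<comment> \<open>A node is named by its level and one vertex of its region. This is unambiguous
    because regions of one level are disjoint, and non-empty from level one on. Level zero consists
    of \<open>V\<close> alone, so the arbitrary choice made for an empty graph does no harm.\<close>
  define node where "node = (\<lambda>(n, D). h (n, f (SOME v. v \<in> D)))"
  have pos: "D \<noteq> {}" if "D \<in> L (Suc n)" for n D
    using L_parent[OF that] g_sub unfolding conn_def by blast
  have "inj_on node P"
  proof (rule inj_onI, clarify)
    fix n D m E assume *: "(n, D) \<in> P" "(m, E) \<in> P" "node (n, D) = node (m, E)"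
    then have nm: "n = m" and ff: "f (SOME v. v \<in> D) = f (SOME v. v \<in> E)"
      using injD[OF h, of "(n, f (SOME v. v \<in> D))" "(m, f (SOME v. v \<in> E))"] by (simp_all add: node_def)
    have DE: "D \<in> L n" "E \<in> L n" using * nm by (auto simp: P_def)
    show "n = m \<and> D = E"
    proof (cases n)
      case 0 then show ?thesis using DE nm by simp
    next
      case (Suc k)
      then have ne: "D \<noteq> {}" "E \<noteq> {}" using pos DE by auto
      then have "(SOME v. v \<in> D) \<in> D" "(SOME v. v \<in> E) \<in> E" by (simp_all add: some_in_eq)
      moreover then have "(SOME v. v \<in> D) = (SOME v. v \<in> E)"
        using ff f L_region[OF DE(1)] L_region[OF DE(2)] by (meson inj_onD subsetD)
      ultimately show ?thesis using L_unique[OF DE] nm by auto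
    qed
  qed
  then obtain inv where inv: "\<And>p. p \<in> P \<Longrightarrow> inv (node p) = p" by (metis inv_into_f_f)
  define M where "M = node ` P"
  define r where "r = node (0, V)"
  define lev where "lev x = fst (inv x)" for x
  define reg where "reg x = snd (inv x)" for x
  define up_reg where "up_reg n A = (SOME D. D \<in> L n \<and> A \<in> g n D)" for n A
  define par where "par x = (case lev x of 0 \<Rightarrow> r | Suc n \<Rightarrow> node (n, up_reg n (reg x)))" for x
  have M: "x \<in> M \<longleftrightarrow> (\<exists>n. \<exists>D\<in>L n. x = node (n, D))" for x by (auto simp: M_def P_def)
  have nd: "lev (node (n, D)) = n" "reg (node (n, D)) = D" if "D \<in> L n" for n D
    using inv[of "(n, D)"] that by (auto simp: P_def lev_def reg_def)
  have reg_L: "reg x \<in> L (lev x)" "node (lev x, reg x) = x" if "x \<in> M" for x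
    using that nd by (auto simp: M)
  have V0: "V \<in> L 0" by simp
  have lev_r: "lev r = 0" "reg r = V" using nd[OF V0] by (simp_all add: r_def)
  have lev0: "x = r" if "x \<in> M" "lev x = 0" for x
    using reg_L[OF that(1)] that(2) by (simp add: r_def)
  have par: "par x \<in> M \<and> lev x = Suc (lev (par x)) \<and> reg x \<in> g (lev (par x)) (reg (par x))"
    if x: "x \<in> M" "x \<noteq> r" for x
  proof -
    obtain n where n: "lev x = Suc n" using lev0 x by (cases "lev x") auto
    have "\<exists>D. D \<in> L n \<and> reg x \<in> g n D" using reg_L(1)[OF x(1)] n L_parent by auto
    then have "up_reg n (reg x) \<in> L n \<and> reg x \<in> g n (up_reg n (reg x))"
      unfolding up_reg_def by (rule someI_ex)
    moreover have "par x = node (n, up_reg n (reg x))" by (simp add: par_def n)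
    ultimately show ?thesis using nd M n by auto
  qed
  have pcut: "cut (C (lev (par x))) \<Psi> (reg (par x)) (g (lev (par x)) (reg (par x)))" 
    "reg x \<in> g (lev (par x)) (reg (par x))" if x: "x \<in> M" "x \<noteq> r" for x
    using par[OF x] L_cut[OF reg_L(1)] by blast+
  interpret linked_regions G M r par lev reg \<Psi>
  proof unfold_locales
    show "r \<in> M" using M V0 unfolding r_def by blast
    show "par r = r" by (simp add: par_def lev_r)
    show "lev r = 0" "reg r = V" by (fact lev_r)+
    show "par x \<in> M \<and> lev x = Suc (lev (par x))" if "x \<in> M" "x \<noteq> r" for x using par that by blast
    show "conn (reg x) \<and> finite (N (reg x)) \<and> reg x \<subseteq> reg (par x)" if "x \<in> M" "x \<noteq> r" for x
      using pcut[OF that] unfolding cut_def by blast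
    show "reg x \<inter> (reg y \<union> N (reg y)) = {}" if xy: "x \<in> M" "y \<in> M" "lev x = lev y" "x \<noteq> y" for x y
    proof -
      have "reg x \<noteq> reg y" using reg_L(2)[OF xy(1)] reg_L(2)[OF xy(2)] xy(3,4) by metis
      then show ?thesis
        using apartD[OF L_apart reg_L(1)[OF xy(1)], of "reg y"] reg_L(1)[OF xy(2)] xy(3) by auto
    qed
    show "\<exists>n. \<forall>x\<in>M. lev x = n \<longrightarrow> v \<notin> reg x" if vV: "v \<in> V" for v
    proof -
      obtain n where "\<forall>D\<in>L n. v \<notin> D" using L_vanish[OF vV] by blast
      then show ?thesis using reg_L(1) by (intro exI[of _ n]) blast
    qed
    show "\<Psi> \<subseteq> graph_ends G" by (fact \<Psi>)
    show "\<exists>\<omega>\<in>\<Psi>. lives \<omega> (reg y) \<and> min (card (N (reg y))) (card (N (reg (par y)))) \<le> ell (reg (par y)) \<omega>"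
      if "y \<in> M" "y \<noteq> r" for y
      using pcut[OF that] unfolding cut_def by blast
    show "ell (reg y) \<psi> \<le> ell (reg (par y)) \<psi>"
      if "y \<in> M" "y \<noteq> r" "\<psi> \<in> \<Psi>" "lives \<psi> (reg y)" "ell (reg (par y)) \<psi> < card (N (reg (par y)))" for y \<psi>
      using pcut[OF that(1,2)] that(3-5) unfolding cut_def by blast
    show "\<exists>x\<in>M. lev x = n \<and> lives \<psi> (reg x)" if "\<psi> \<in> \<Psi>" for \<psi> n
      using L_ends_in[OF that, of n] nd M by metis
    show "\<epsilon> \<in> \<Psi>" if "\<epsilon> \<in> graph_ends G" "\<And>n. \<exists>x\<in>M. lev x = n \<and> lives \<epsilon> (reg x)" for \<epsilon>
      using L_ends_only[OF that(1)] that(2) reg_L(1) by metis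
  qed
  show ?thesis
    using root_in bag_tree_decomposition linked_bag tight_bag componental_bag finite_adhesion_bag
      displays_bag verts_T by blast
qed

end

lemma gdelta_linked_decomposition:
  fixes G :: "'v graph"
  assumes "simple_graph G" "\<Psi> \<subseteq> graph_ends G" "infinite (UNIV :: 'n set)" "verts G \<lesssim> (UNIV :: 'n set)"
    and gd: "gdelta_in (end_space G) (Inr ` \<Psi>)"
  shows "\<exists>(T :: 'n graph) r B. r \<in> verts T \<and> tree_decomposition G T B \<and>
              linked G T r B \<and> tight G T r B \<and> componental G T r B \<and>
              finite_adhesion T B \<and> displays G T B \<Psi>"
proof -
  interpret sgraph G using assms(1) by unfold_locales
  obtain C W where C: "\<forall>n. C (Suc n) \<subseteq> C n" "\<Inter>(range C) = Inr ` \<Psi>"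
    and W: "\<forall>n. W n \<subseteq> V \<and> (\<forall>v\<in>V. v \<notin> W n \<longrightarrow> Inl v \<in> C n) \<and>
      (\<forall>K\<in>comps (V - W n). finite (N K) \<and> (\<forall>\<phi>\<in>{\<phi> \<in> graph_ends G. Inr \<phi> \<notin> C n}. \<not> lives \<phi> K)) \<and>
      (\<forall>\<psi>\<in>\<Psi>. \<exists>A. A \<subseteq> V \<and> finite (N A) \<and> lives \<psi> A \<and> A \<inter> W n = {})"
    using gdelta_envelopes[OF gd assms(2)] by (elim exE conjE)
  have CW: "W n \<subseteq> V" "\<And>v. v \<in> V \<Longrightarrow> v \<notin> W n \<Longrightarrow> Inl v \<in> C n"
    "\<And>K. K \<in> comps (V - W n) \<Longrightarrow> finite (N K) \<and> (\<forall>\<phi>\<in>{\<phi> \<in> graph_ends G. Inr \<phi> \<notin> C n}. \<not> lives \<phi> K)"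
    "\<And>\<psi>. \<psi> \<in> \<Psi> \<Longrightarrow> \<exists>A. A \<subseteq> V \<and> finite (N A) \<and> lives \<psi> A \<and> A \<inter> W n = {}" for n
    using spec[OF W, of n] by simp_all
  have "\<exists>\<G>. cut (C n) \<Psi> D \<G>" if D: "D \<subseteq> V" "finite (N D)" for n D
  proof (rule cut_region[OF D assms(2) CW(1,3,4)])
    fix \<G> assume \<G>: "apart \<G>" "\<And>A. A \<in> \<G> \<Longrightarrow> A \<subseteq> D \<and> conn A \<and> finite (N A)"
      "\<And>A. A \<in> \<G> \<Longrightarrow> card (N A) < card (N D) \<or>
        A \<inter> W n = {} \<and> (\<forall>\<phi>\<in>{\<phi> \<in> graph_ends G. Inr \<phi> \<notin> C n}. \<not> lives \<phi> A)"
      "\<And>A. A \<in> \<G> \<Longrightarrow> \<exists>\<omega>\<in>\<Psi>. lives \<omega> A \<and> min (card (N A)) (card (N D)) \<le> ell D \<omega>"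
      "\<And>A \<psi>. A \<in> \<G> \<Longrightarrow> \<psi> \<in> \<Psi> \<Longrightarrow> lives \<psi> A \<Longrightarrow> ell D \<psi> < card (N D) \<Longrightarrow> ell A \<psi> \<le> ell D \<psi>"
      "\<And>\<psi>. \<psi> \<in> \<Psi> \<Longrightarrow> lives \<psi> D \<Longrightarrow> \<exists>A\<in>\<G>. lives \<psi> A"
    have "hat A \<subseteq> C n"
      if "A \<in> \<G>" "A \<inter> W n = {}" "\<forall>\<phi>\<in>{\<phi> \<in> graph_ends G. Inr \<phi> \<notin> C n}. \<not> lives \<phi> A" for A
      using that(2,3) CW(2)[of _ n] \<G>(2)[OF that(1)] unfolding hat_def conn_def by blast
    then have small: "card (N A) < card (N D) \<or> hat A \<subseteq> C n" if "A \<in> \<G>" for A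
      using \<G>(3)[OF that] that by blast
    have "cut (C n) \<Psi> D \<G>" unfolding cut_def
    proof (intro conjI ballI impI)
      show "apart \<G>" by (rule \<G>(1))
      show "A \<subseteq> D" "conn A" "finite (N A)" if "A \<in> \<G>" for A using \<G>(2)[OF that] by simp_all
      show "card (N A) < card (N D) \<or> hat A \<subseteq> C n" if "A \<in> \<G>" for A using small[OF that] .
      show "\<exists>\<omega>\<in>\<Psi>. lives \<omega> A \<and> min (card (N A)) (card (N D)) \<le> ell D \<omega>" if "A \<in> \<G>" for A
        using \<G>(4)[OF that] .
      show "ell A \<psi> \<le> ell D \<psi>"
        if "A \<in> \<G>" "\<psi> \<in> \<Psi>" "lives \<psi> A" "ell D \<psi> < card (N D)" for A \<psi> using \<G>(5)[OF that] .
      show "\<exists>A\<in>\<G>. lives \<psi> A" if "\<psi> \<in> \<Psi>" "lives \<psi> D" for \<psi> using \<G>(6)[OF that] .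
    qed
    then show "\<exists>\<G>. cut (C n) \<Psi> D \<G>" by blast
  qed
  then have ex: "\<exists>\<G>. cut (C n) \<Psi> D \<G>" if "D \<subseteq> V" "finite (N D)" for n D using that by blast
  define g where "g n D = (SOME \<G>. cut (C n) \<Psi> D \<G>)" for n D
  have g: "cut (C n) \<Psi> D (g n D)" if "D \<subseteq> V" "finite (N D)" for n D
    unfolding g_def by (rule someI_ex) (rule ex[OF that])
  interpret cutting G \<Psi> C g by unfold_locales (use assms(2) C g in auto)
  show ?thesis by (rule linked_decomposition[OF assms(3,4)])
qed

(* The type 'n only supplies names for the nodes of decomposition trees. It is arbitrary
   apart from being large enough; every tree has a copy whose nodes are in some such type. *)
theorem theorem1:
  fixes G :: "'v graph" and \<Psi> :: "(nat \<Rightarrow> 'v) set set"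
  assumes "simple_graph G"
    and "\<Psi> \<subseteq> graph_ends G"
    and "infinite (UNIV :: 'n set)"
    and "verts G \<lesssim> (UNIV :: 'n set)"
  shows "((\<exists>(T :: 'n graph) r B. r \<in> verts T \<and> tree_decomposition G T B \<and>
              linked G T r B \<and> tight G T r B \<and> componental G T r B \<and>
              finite_adhesion T B \<and> displays G T B \<Psi>)
          \<longleftrightarrow> (\<exists>(T :: 'n graph) B. tree_decomposition G T B \<and>
              finite_adhesion T B \<and> displays G T B \<Psi>))
       \<and> ((\<exists>(T :: 'n graph) B. tree_decomposition G T B \<and>
              finite_adhesion T B \<and> displays G T B \<Psi>)
          \<longleftrightarrow> gdelta_in (end_space G) (Inr ` \<Psi>))"
  using tree_decomposition_gdelta[OF assms(1)] gdelta_linked_decomposition[OF assms] by blast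

end
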